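(* Let $T>0$ be arbitrary, let $\alpha\in(\tfrac12,1)$, and let $W\subset\mathbb{T}^2$ be a nonempty open set, with $W^e:=\mathbb{T}^2\setminus\overline{W}$. Let $\mathcal{R}_1,\mathcal{R}_2$ be two admissible operators (with kernels $K_1,K_2$). If the source-to-solution maps coincide, $L_{\mathcal{R}_1}=L_{\mathcal{R}_2}$, then $$\mathcal{R}_1 g|_{W^e}=\mathcal{R}_2 g|_{W^e}\qquad\text{for all } g\in C^\infty_c(W^e).$$
   Context: $\mathbb{T}^2=\mathbb{R}^2/\mathbb{Z}^2$ (identified with $[-\tfrac12,\tfrac12)^2$ for integration). For $u\in\mathcal{D}'(\mathbb{T}^2)$ with Fourier coefficients $\hat u(k)$, $k\in\mathbb{Z}^2$, $H^r(\mathbb{T}^2)$ is the space of $u$ with $\sum_k(1+|k|^2)^r|\hat u(k)|^2<\infty$, and for $r\ge 0$, $(-\Delta)^r u=\sum_k|2\pi k|^{2r}\hat u(k)e^{2\pi i x\cdot k}$. An operator $\mathcal{R}$ is called admissible if there is a kernel $K\in L^1(\mathbb{T}^2)\cap C^\infty(\mathbb{T}^2\setminus\{0\})$ whose Fourier coefficients satisfy $c|k|^{-1}\le \hat K(k)\le C|k|^{-1}$ for all $k\neq 0$ (for some constants $0<c\le C$), such that, with $\mathcal{K}\theta(x)=K*\theta(x)=\int_{\mathbb{T}^2}K(x-y)\theta(y)\,dy$, one has $\mathcal{R}\theta=(-\partial_2(\mathcal{K}\theta),\partial_1(\mathcal{K}\theta))$, and $\mathcal{R}$ is bounded on $L^p(\mathbb{T}^2)$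 for every $p\in(1,\infty)$. For a source $f\in C^\infty_c(\mathbb{T}^2\times(0,T))$, consider the dissipative active scalar equation $$\partial_t\theta+(\mathcal{R}\theta)\cdot\nabla\theta+(-\Delta)^\alpha\theta=f\ \text{ in }\mathbb{T}^2\times(0,T),\qquad \theta(0)=0,$$ which has a unique solution $\theta_f$ with $\theta_f\in L^\infty(0,T;H^s(\mathbb{T}^2))\cap L^2(0,T;H^{s+\alpha}(\mathbb{T}^2))$ for every $s>0$. The source-to-solution map is $L_{\mathcal{R}}:f\mapsto(\theta_f|_{W\times(0,T)},\,(\mathcal{R}\theta_f)|_{W\times(0,T)})$, defined for $f\in C^\infty_c(W\times(0,T))$. *)

theory Defs
  imports "HOL-Analysis.Analysis"
begin

text \<open>Points of the torus are represented by their lifts in real x real;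
functions on the torus are Z^2-periodic functions on real x real.\<close>

type_synonym pt = "real \<times> real"

definition lat :: "int \<times> int \<Rightarrow> pt" where
  "lat k = (real_of_int (fst k), real_of_int (snd k))"

definition periodic :: "(pt \<Rightarrow> 'b) \<Rightarrow> bool" where
  "periodic u \<longleftrightarrow> (\<forall>x k. u (x + lat k) = u x)"

definition Qcell :: "pt set" where
  "Qcell = {-1/2..<1/2} \<times> {-1/2..<1/2}"

definition ip :: "int \<times> int \<Rightarrow> pt \<Rightarrow> real" where
  "ip k x = real_of_int (fst k) * fst x + real_of_int (snd k) * snd x"

definition knorm :: "int \<times> int \<Rightarrow> real" where
  "knorm k = sqrt (real_of_int (fst k) ^ 2 + real_of_int (snd k) ^ 2)"

definition fcoef :: "(pt \<Rightarrow> real) \<Rightarrow> int \<times> int \<Rightarrow> complex" where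
  "fcoef u k = (LINT x:Qcell|lborel. complex_of_real (u x) * cis (- 2 * pi * ip k x))"

definition pd :: "'a::real_normed_vector \<Rightarrow> ('a \<Rightarrow> real) \<Rightarrow> 'a \<Rightarrow> real" where
  "pd v u x = deriv (\<lambda>t. u (x + t *\<^sub>R v)) 0"

fun iter_pd :: "'a::real_normed_vector list \<Rightarrow> ('a \<Rightarrow> real) \<Rightarrow> 'a \<Rightarrow> real" where
  "iter_pd [] u = u"
| "iter_pd (v # vs) u = pd v (iter_pd vs u)"

definition smooth_on :: "'a::euclidean_space set \<Rightarrow> ('a \<Rightarrow> real) \<Rightarrow> bool" where
  "smooth_on S u \<longleftrightarrow> (\<forall>vs. set vs \<subseteq> Basis \<longrightarrow> iter_pd vs u differentiable_on S)"

definition conv :: "(pt \<Rightarrow> real) \<Rightarrow> (pt \<Rightarrow> real) \<Rightarrow> pt \<Rightarrow> real" where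
  "conv K \<theta> x = (LINT y:Qcell|lborel. K (x - y) * \<theta> y)"

definition Rop :: "(pt \<Rightarrow> real) \<Rightarrow> (pt \<Rightarrow> real) \<Rightarrow> pt \<Rightarrow> real \<times> real" where
  "Rop K \<theta> x = (- pd (0, 1) (conv K \<theta>) x, pd (1, 0) (conv K \<theta>) x)"

definition lpnorm :: "real \<Rightarrow> (pt \<Rightarrow> 'b::real_normed_vector) \<Rightarrow> real" where
  "lpnorm p u = (LINT x:Qcell|lborel. norm (u x) powr p) powr (1 / p)"

text \<open>Admissibility (R determined by its kernel K).  L^p boundedness is
required on smooth periodic functions (dense in L^p).\<close>
definition admissible :: "(pt \<Rightarrow> real) \<Rightarrow> bool" where
  "admissible K \<longleftrightarrow>
     periodic K \<and> set_integrable lborel Qcell K \<and>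
     smooth_on (- range lat) K \<and>
     (\<exists>c C. 0 < c \<and> c \<le> C \<and>
        (\<forall>k. k \<noteq> (0, 0) \<longrightarrow> Im (fcoef K k) = 0 \<and>
              c / knorm k \<le> Re (fcoef K k) \<and> Re (fcoef K k) \<le> C / knorm k)) \<and>
     (\<forall>p. 1 < p \<longrightarrow> (\<exists>C. \<forall>\<theta>. smooth_on UNIV \<theta> \<and> periodic \<theta> \<longrightarrow>
            lpnorm p (Rop K \<theta>) \<le> C * lpnorm p \<theta>))"

definition hs_weight :: "real \<Rightarrow> (pt \<Rightarrow> real) \<Rightarrow> int \<times> int \<Rightarrow> real" where
  "hs_weight s u k = (1 + knorm k ^ 2) powr s * (cmod (fcoef u k))\<^sup>2"

definition in_Hs :: "real \<Rightarrow> (pt \<Rightarrow> real) \<Rightarrow> bool" where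
  "in_Hs s u \<longleftrightarrow> set_integrable lborel Qcell u \<and> hs_weight s u summable_on UNIV"

definition hs_sq :: "real \<Rightarrow> (pt \<Rightarrow> real) \<Rightarrow> real" where
  "hs_sq s u = infsum (hs_weight s u) UNIV"

definition fraclap :: "real \<Rightarrow> (pt \<Rightarrow> real) \<Rightarrow> pt \<Rightarrow> real" where
  "fraclap r u x = Re (infsum (\<lambda>k. complex_of_real ((2 * pi * knorm k) powr (2 * r))
                                  * fcoef u k * cis (2 * pi * ip k x)) UNIV)"

text \<open>Sources in C_c^infty(W x (0,T)) (extended by zero in time).\<close>
definition source :: "pt set \<Rightarrow> real \<Rightarrow> (pt \<times> real \<Rightarrow> real) \<Rightarrow> bool" where
  "source W T f \<longleftrightarrow> smooth_on UNIV f \<and> (\<forall>t. periodic (\<lambda>x. f (x, t))) \<and>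
     (\<exists>a b. 0 < a \<and> a \<le> b \<and> b < T \<and> closure {z. f z \<noteq> 0} \<subseteq> W \<times> {a..b})"

text \<open>Weak solution of the dissipative active scalar equation with theta(0) = 0,
in the class L^infty(0,T;H^s) and L^2(0,T;H^(s+alpha)) for every s > 0.\<close>
definition is_solution ::
  "(pt \<Rightarrow> real) \<Rightarrow> real \<Rightarrow> real \<Rightarrow> (pt \<times> real \<Rightarrow> real) \<Rightarrow> (pt \<times> real \<Rightarrow> real) \<Rightarrow> bool" where
  "is_solution K \<alpha> T f \<theta> \<longleftrightarrow>
     \<theta> \<in> borel_measurable borel \<and>
     (\<forall>t. periodic (\<lambda>x. \<theta> (x, t))) \<and>
     (AE t in lborel. t \<in> {0<..<T} \<longrightarrow> smooth_on UNIV (\<lambda>x. \<theta> (x, t))) \<and>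
     (\<forall>s. 0 < s \<longrightarrow>
        (\<exists>M. AE t in lborel. t \<in> {0<..<T} \<longrightarrow>
             in_Hs s (\<lambda>x. \<theta> (x, t)) \<and> hs_sq s (\<lambda>x. \<theta> (x, t)) \<le> M) \<and>
        (AE t in lborel. t \<in> {0<..<T} \<longrightarrow> in_Hs (s + \<alpha>) (\<lambda>x. \<theta> (x, t))) \<and>
        (\<integral>\<^sup>+ t\<in>{0<..<T}. ennreal (hs_sq (s + \<alpha>) (\<lambda>x. \<theta> (x, t))) \<partial>lborel) < \<infinity>) \<and>
     (\<forall>\<phi>. smooth_on UNIV \<phi> \<and> (\<forall>t. periodic (\<lambda>x. \<phi> (x, t))) \<and>
           (\<exists>b<T. \<forall>x t. b \<le> t \<longrightarrow> \<phi> (x, t) = 0) \<longrightarrow>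
        (let g = (\<lambda>z. - \<theta> z * pd ((0, 0), 1) \<phi> z
                   + (fst (Rop K (\<lambda>y. \<theta> (y, snd z)) (fst z)) * pd (1, 0) (\<lambda>y. \<theta> (y, snd z)) (fst z)
                    + snd (Rop K (\<lambda>y. \<theta> (y, snd z)) (fst z)) * pd (0, 1) (\<lambda>y. \<theta> (y, snd z)) (fst z))
                     * \<phi> z
                   + \<theta> z * fraclap \<alpha> (\<lambda>y. \<phi> (y, snd z)) (fst z)
                   - f z * \<phi> z)
         in set_integrable lborel (Qcell \<times> {0<..<T}) g \<and>
            (LINT z:(Qcell \<times> {0<..<T})|lborel. g z) = 0))"

end

theory Submission
  imports Defs "HOL-Complex_Analysis.Conformal_Mappings"
begin

text \<open>The linearization of the data at the zero solution already determines the kernel. For the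
source \<open>e * f0\<close> with small \<open>e\<close> a solution exists by a contraction argument for its Fourier
coefficients: the nonlinearity loses one derivative, and the Duhamel integral gains \<open>2 * \<alpha> > 1\<close>
derivatives; the surplus also bootstraps the solution to all Sobolev orders. Up to \<open>O(e^2)\<close>
it equals \<open>e * U\<close>, where \<open>U\<close> solves the linear fractional heat equation with source \<open>f0\<close> and does
not depend on the operator. Hence \<open>R1 U = R2 U\<close> on \<open>W\<close> for all times.
After the source is switched off, every Fourier mode of \<open>U\<close> is a pure exponential in time, so
that the difference \<open>R1 U - R2 U\<close> at a point of \<open>W\<close> is a Dirichlet series in time. It extends
holomorphically to the right half plane, so it vanishes for all times, and its blocks of equal decay
rate vanish separately. Such a block is a trigonometric polynomial in space that vanishes on an open
set, so all of its coefficients vanish. Choosing \<open>f0\<close> with a nonzero \<open>k\<close>-th Fourier mode shows that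
the two kernels have the same \<open>k\<close>-th Fourier coefficient for every nonzero \<open>k\<close>. They therefore
differ by a constant, which the derivatives in the definition of the operators annihilate.\<close>

section \<open>Integrals of periodic functions\<close>

text \<open>The hypothesis is an implication over pairs of solutions, so it speaks only about
  sources for which solutions in the class \<open>is_solution\<close> have been exhibited, for both
  kernels. This forces an existence proof that reaches all Sobolev orders and the weak formulation,
  with an error bound uniform in space and time. All estimates are made in the weighted sup norms
  \<open>dec\<close> of Fourier coefficients: there a product of functions is a convolution that the
  weights absorb, and the heat flow acts mode by mode, so the contraction reduces to scalar
  integrals. The source separates variables, a pulse in time times a periodic bump in
  \<open>W\<close>, so each mode of the linear solution is a positive time integral times a Fourier
  coefficient of the bump. The bump is shrunk depending on \<open>k\<close>, which makes its
  \<open>k\<close>-th coefficient nonzero while its support stays inside \<open>W\<close>. The data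
  agree only almost everywhere and only up to real parts; continuity of the linear part and
  hermitian symmetry of the coefficients turn this into exact vanishing of a complex series at every
  point of \<open>W\<close>.\<close>

definition fundom :: "pt set \<Rightarrow> bool" where
  "fundom D \<longleftrightarrow> D \<in> sets borel \<and> (\<forall>y. \<exists>!k. y + lat k \<in> D)"

lemma lat_uminus [simp]: "lat (- k) = - lat k"
  by (simp add: lat_def prod_eq_iff)

lemma periodicD: "periodic u \<Longrightarrow> u (x + lat k) = u x"
  unfolding periodic_def by blast

lemma periodic_diffD: "periodic u \<Longrightarrow> u (x - lat k) = u x"
  using periodicD[of u x "- k"] by simp

lemma unique_int_in_halfopen: "\<exists>!n::int. a + of_int n \<in> {c..<c+1::real}"
proof
  show "a + of_int (\<lceil>c - a\<rceil>) \<in> {c..<c+1}" by (auto; linarith)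
next
  fix n :: int assume "a + of_int n \<in> {c..<c+1}"
  then show "n = \<lceil>c - a\<rceil>" by (simp add: ceiling_unique eq_commute; linarith)
qed

lemma unique_int_in_halfopen': "\<exists>!n::int. a + of_int n \<in> {c<..c+1::real}"
proof
  show "a + of_int (\<lfloor>c + 1 - a\<rfloor>) \<in> {c<..c+1}" by (auto; linarith)
next
  fix n :: int assume "a + of_int n \<in> {c<..c+1}"
  then show "n = \<lfloor>c + 1 - a\<rfloor>" by (intro floor_unique[symmetric]) (auto simp: algebra_simps)
qed

lemma ex1_prod: "\<exists>!x. P x \<Longrightarrow> \<exists>!y. Q y \<Longrightarrow> \<exists>!k. P (fst k) \<and> Q (snd k)"
  by (metis prod.collapse fst_conv snd_conv)

lemma fundom_box1: "fundom ({c..<c+1} \<times> {d..<d+1})"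
  unfolding fundom_def
proof (intro conjI allI)
  fix y :: pt
  show "\<exists>!k. y + lat k \<in> {c..<c+1} \<times> {d..<d+1}"
    using ex1_prod[OF unique_int_in_halfopen[of "fst y" c] unique_int_in_halfopen[of "snd y" d]]
    by (simp add: mem_Times_iff lat_def del: atLeastLessThan_iff)
qed (auto intro!: borel_Times)

text \<open>The substitution of \<open>x - y\<close> for \<open>y\<close> exchanges the open and the
  closed sides of the half-open cell, so convolution needs this second shape besides
  \<open>fundom_box1\<close>.\<close>

lemma fundom_box2: "fundom ({c<..c+1} \<times> {d<..d+1})"
  unfolding fundom_def
proof (intro conjI allI)
  fix y :: pt
  show "\<exists>!k. y + lat k \<in> {c<..c+1} \<times> {d<..d+1}"
    using ex1_prod[OF unique_int_in_halfopen'[of "fst y" c] unique_int_in_halfopen'[of "snd y" d]]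
    by (simp add: mem_Times_iff lat_def del: greaterThanAtMost_iff)
qed (auto intro!: borel_Times)

lemma Qcell_fundom: "fundom Qcell"
  using fundom_box1[of "-1/2" "-1/2"] by (simp add: Qcell_def)

lemma Qcell_shift: "{y. x + y \<in> Qcell} = {-1/2 - fst x..<-1/2 - fst x+1} \<times> {-1/2 - snd x..<-1/2 - snd x+1}"
  by (auto simp: Qcell_def mem_Times_iff)

lemma Qcell_reflect: "{y. x - y \<in> Qcell} = {fst x - 1/2<..fst x - 1/2+1} \<times> {snd x - 1/2<..snd x - 1/2+1}"
  by (auto simp: Qcell_def mem_Times_iff)

lemma Qcell_borel [measurable]: "Qcell \<in> sets borel"
  using Qcell_fundom by (simp add: fundom_def)

lemma nn_integral_lborel_shift:
  assumes [measurable]: "f \<in> borel_measurable borel"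
  shows "(\<integral>\<^sup>+x. f (x + a) \<partial>lborel) = (\<integral>\<^sup>+x. f x \<partial>(lborel :: 'a::euclidean_space measure))"
  by (subst lborel_distr_plus[symmetric, of a]) (simp add: nn_integral_distr add.commute)

lemma countable_bij: obtains \<kappa> :: "nat \<Rightarrow> int \<times> int" where "bij \<kappa>"
  using bij_betw_from_nat_into[of "UNIV :: (int\<times>int) set"] by (auto simp: infinite_UNIV_char_0 finite_prod)

text \<open>Cut \<open>D\<close> according to the unique lattice translation that carries a point
  into \<open>D'\<close>, then move each piece into \<open>D'\<close> by translation invariance of
  Lebesgue measure.\<close>

lemma nn_integral_fundom_aux:
  fixes h :: "pt \<Rightarrow> ennreal"
  assumes D: "fundom D" and D': "fundom D'" and [measurable]: "h \<in> borel_measurable borel"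
    and per: "periodic h" and k: "bij (\<kappa> :: nat \<Rightarrow> int \<times> int)"
  shows "(\<integral>\<^sup>+x. h x * indicator D x \<partial>lborel) = (\<Sum>n. \<integral>\<^sup>+x. h x * indicator D (x - lat (\<kappa> n)) * indicator D' x \<partial>lborel)"
proof -
  have [measurable]: "D \<in> sets borel" "D' \<in> sets borel" using D D' by (simp_all add: fundom_def)
  have ind: "indicator D x = (\<Sum>n. indicator D x * indicator D' (x + lat (\<kappa> n)) :: ennreal)" for x :: pt
  proof -
    obtain k where k1: "x + lat k \<in> D'" "\<And>l. x + lat l \<in> D' \<Longrightarrow> l = k" using D' unfolding fundom_def by metis
    have inj: "m = n" if "\<kappa> m = \<kappa> n" for m n using k that by (metis bij_pointE)
    have k2: "\<kappa> m = k" if "x + lat (\<kappa> m) \<in> D'" for m using k1(2)[OF that] .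
    obtain n where n: "\<kappa> n = k" using k by (metis bij_pointE)
    have "(\<Sum>n. indicator D' (x + lat (\<kappa> n)) :: ennreal) = (\<Sum>m\<in>{n}. indicator D' (x + lat (\<kappa> m)))"
      by (rule suminf_finite) (use k2 n inj in \<open>auto simp: indicator_def\<close>)
    then show ?thesis using k1(1) n by simp
  qed
  have "(\<integral>\<^sup>+x. h x * indicator D x \<partial>lborel) = (\<integral>\<^sup>+x. (\<Sum>n. h x * indicator D x * indicator D' (x + lat (\<kappa> n))) \<partial>lborel)"
    by (subst ind) (simp add: mult.assoc)
  also have "\<dots> = (\<Sum>n. \<integral>\<^sup>+x. h x * indicator D x * indicator D' (x + lat (\<kappa> n)) \<partial>lborel)"
    by (rule nn_integral_suminf) measurable
  also have "\<dots> = (\<Sum>n. \<integral>\<^sup>+x. h x * indicator D (x - lat (\<kappa> n)) * indicator D' x \<partial>lborel)"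
  proof (rule suminf_cong)
    fix n
    show "(\<integral>\<^sup>+x. h x * indicator D x * indicator D' (x + lat (\<kappa> n)) \<partial>lborel)
      = (\<integral>\<^sup>+x. h x * indicator D (x - lat (\<kappa> n)) * indicator D' x \<partial>lborel)"
      using nn_integral_lborel_shift[of "\<lambda>x. h x * indicator D (x - lat (\<kappa> n)) * indicator D' x" "lat (\<kappa> n)"]
      by (simp add: periodicD[OF per])
  qed
  finally show ?thesis .
qed

text \<open>The pieces moved in \<open>nn_integral_fundom_aux\<close> partition \<open>D'\<close>,
  because each of its points has exactly one lattice translate in \<open>D\<close>.\<close>

lemma nn_integral_fundom:
  fixes h :: "pt \<Rightarrow> ennreal"
  assumes D: "fundom D" and D': "fundom D'" and m[measurable]: "h \<in> borel_measurable borel"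
    and per: "periodic h"
  shows "(\<integral>\<^sup>+x. h x * indicator D x \<partial>lborel) = (\<integral>\<^sup>+x. h x * indicator D' x \<partial>lborel)"
proof -
  have [measurable]: "D \<in> sets borel" "D' \<in> sets borel" using D D' by (simp_all add: fundom_def)
  obtain \<kappa> :: "nat \<Rightarrow> int \<times> int" where k: "bij \<kappa>" by (rule countable_bij)
  have ind: "indicator D' x = (\<Sum>n. indicator D (x - lat (\<kappa> n)) * indicator D' x :: ennreal)" for x :: pt
  proof -
    obtain k' where k1: "x + lat k' \<in> D" "\<And>l. x + lat l \<in> D \<Longrightarrow> l = k'" using D unfolding fundom_def by metis
    have inj: "m = n" if "\<kappa> m = \<kappa> n" for m n using k that by (metis bij_pointE)
    obtain n where n: "\<kappa> n = - k'" using k by (metis bij_pointE)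
    have k2: "\<kappa> m = - k'" if "x - lat (\<kappa> m) \<in> D" for m
      using k1(2)[of "- \<kappa> m"] that by (metis add.inverse_inverse lat_uminus uminus_add_conv_diff add.commute)
    have "(\<Sum>n. indicator D (x - lat (\<kappa> n)) :: ennreal) = (\<Sum>m\<in>{n}. indicator D (x - lat (\<kappa> m)))"
      by (rule suminf_finite) (use k2 n inj in \<open>auto simp: indicator_def\<close>)
    then show ?thesis using k1(1) n by simp
  qed
  have "(\<integral>\<^sup>+x. h x * indicator D' x \<partial>lborel) = (\<integral>\<^sup>+x. (\<Sum>n. h x * indicator D (x - lat (\<kappa> n)) * indicator D' x) \<partial>lborel)"
    by (subst ind) (simp add: mult.assoc)
  also have "\<dots> = (\<Sum>n. \<integral>\<^sup>+x. h x * indicator D (x - lat (\<kappa> n)) * indicator D' x \<partial>lborel)"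
    by (rule nn_integral_suminf) measurable
  finally show ?thesis using nn_integral_fundom_aux[OF D D' m per k] by simp
qed

lemma periodic_compose: "periodic h \<Longrightarrow> periodic (\<lambda>x. F (h x))"
  unfolding periodic_def by simp

lemma set_integrable_fundom_iff:
  fixes h :: "pt \<Rightarrow> 'b::{banach,second_countable_topology}"
  assumes D: "fundom D" and D': "fundom D'" and m[measurable]: "h \<in> borel_measurable borel"
    and per: "periodic h"
  shows "set_integrable lborel D h \<longleftrightarrow> set_integrable lborel D' h"
proof -
  have [measurable]: "D \<in> sets borel" "D' \<in> sets borel" using D D' by (simp_all add: fundom_def)
  have *: "(\<integral>\<^sup>+x. ennreal (norm (indicator E x *\<^sub>R h x)) \<partial>lborel) = (\<integral>\<^sup>+x. ennreal (norm (h x)) * indicator E x \<partial>lborel)" for E :: "pt set"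
    by (intro nn_integral_cong) (auto simp: indicator_def)
  show ?thesis unfolding set_integrable_def integrable_iff_bounded *
    using nn_integral_fundom[OF D D' _ periodic_compose[OF per, of "\<lambda>y. ennreal (norm y)"]] by simp
qed

lemma set_integral_fundom_real:
  fixes h :: "pt \<Rightarrow> real"
  assumes D: "fundom D" and D': "fundom D'" and m[measurable]: "h \<in> borel_measurable borel"
    and per: "periodic h" and int: "set_integrable lborel D h"
  shows "(LINT x:D|lborel. h x) = (LINT x:D'|lborel. h x)"
proof -
  have [measurable]: "D \<in> sets borel" "D' \<in> sets borel" using D D' by (simp_all add: fundom_def)
  have *: "(\<integral>\<^sup>+x. ennreal (F (indicator E x *\<^sub>R h x)) \<partial>lborel) = (\<integral>\<^sup>+x. ennreal (F (h x)) * indicator E x \<partial>lborel)"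
    if "F 0 = 0" for E :: "pt set" and F :: "real \<Rightarrow> real"
    using that by (intro nn_integral_cong) (auto simp: indicator_def)
  have int': "set_integrable lborel D' h" using set_integrable_fundom_iff[OF D D' m per] int by simp
  have e1: "(\<integral>\<^sup>+x. ennreal (h x) * indicator D x \<partial>lborel) = (\<integral>\<^sup>+x. ennreal (h x) * indicator D' x \<partial>lborel)"
    using nn_integral_fundom[OF D D' _ periodic_compose[OF per, of "\<lambda>y. ennreal y"]] by simp
  have e2: "(\<integral>\<^sup>+x. ennreal (- h x) * indicator D x \<partial>lborel) = (\<integral>\<^sup>+x. ennreal (- h x) * indicator D' x \<partial>lborel)"
    using nn_integral_fundom[OF D D' _ periodic_compose[OF per, of "\<lambda>y. ennreal (- y)"]] by simp
  show ?thesis using int int' unfolding set_integrable_def set_lebesgue_integral_def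
    by (simp add: real_lebesgue_integral_def *[of "\<lambda>x. x", simplified] *[of "\<lambda>x. - x", simplified] e1 e2)
qed

lemma set_integral_fundom:
  fixes h :: "pt \<Rightarrow> complex"
  assumes D: "fundom D" and D': "fundom D'" and m[measurable]: "h \<in> borel_measurable borel"
    and per: "periodic h" and int: "set_integrable lborel D h"
  shows "(LINT x:D|lborel. h x) = (LINT x:D'|lborel. h x)"
proof -
  have *: "set_integrable lborel E (\<lambda>x. Re (h x))" "set_integrable lborel E (\<lambda>x. Im (h x))"
     "Re (LINT x:E|lborel. h x) = (LINT x:E|lborel. Re (h x))" "Im (LINT x:E|lborel. h x) = (LINT x:E|lborel. Im (h x))"
    if "set_integrable lborel E h" for E
    using that integrable_Re[OF that[unfolded set_integrable_def]] integrable_Im[OF that[unfolded set_integrable_def]]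
    unfolding set_integrable_def set_lebesgue_integral_def by (auto simp flip: integral_Re integral_Im)
  have int': "set_integrable lborel D' h" using set_integrable_fundom_iff[OF D D' m per] int by simp
  show ?thesis
    by (rule complex_eqI)
      (use *[OF int] *[OF int'] set_integral_fundom_real[OF D D' _ periodic_compose[OF per, of Re]]
       set_integral_fundom_real[OF D D' _ periodic_compose[OF per, of Im]] in simp_all)
qed

lemma lborel_isometry:
  fixes a :: "'a::euclidean_space"
  assumes "c = 1 \<or> c = -1"
  shows "distr lborel borel (\<lambda>x. a + c *\<^sub>R x) = lborel"
proof -
  have "(lborel :: 'a measure) = density (distr lborel borel (\<lambda>x. a + c *\<^sub>R x)) (\<lambda>_. \<bar>c\<bar>^DIM('a))"
    by (rule lborel_affine) (use assms in auto)
  also have "\<dots> = distr lborel borel (\<lambda>x. a + c *\<^sub>R x)"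
    using assms by (auto simp: density_1 simp flip: one_ennreal_def)
  finally show ?thesis ..
qed

lemma lborel_isometry_integral:
  fixes f :: "'a::euclidean_space \<Rightarrow> 'b::{banach,second_countable_topology}"
  assumes c: "c = 1 \<or> c = -1" and [measurable]: "f \<in> borel_measurable borel"
  shows "integrable lborel (\<lambda>x. f (a + c *\<^sub>R x)) \<longleftrightarrow> integrable lborel f"
    "(\<integral>x. f (a + c *\<^sub>R x) \<partial>lborel) = (\<integral>x. f x \<partial>lborel)"
proof -
  have "integrable lborel f \<longleftrightarrow> integrable (distr lborel borel (\<lambda>x. a + c *\<^sub>R x)) f"
    by (simp add: lborel_isometry[OF c])
  also have "\<dots> \<longleftrightarrow> integrable lborel (\<lambda>x. f (a + c *\<^sub>R x))"
    by (subst integrable_distr_eq) auto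
  finally show "integrable lborel (\<lambda>x. f (a + c *\<^sub>R x)) \<longleftrightarrow> integrable lborel f" ..
  have "(\<integral>x. f x \<partial>lborel) = (\<integral>x. f x \<partial>(distr lborel borel (\<lambda>x. a + c *\<^sub>R x)))"
    by (simp add: lborel_isometry[OF c])
  also have "\<dots> = (\<integral>x. f (a + c *\<^sub>R x) \<partial>lborel)"
    by (subst integral_distr) auto
  finally show "(\<integral>x. f (a + c *\<^sub>R x) \<partial>lborel) = (\<integral>x. f x \<partial>lborel)" ..
qed

text \<open>A change of variables turns the shift or reflection of the function into one of the
  cell, and the moved cell is again a fundamental domain.\<close>

lemma set_integrable_Qcell_shift:
  fixes h :: "pt \<Rightarrow> 'b::{banach,second_countable_topology}"
  assumes m[measurable]: "h \<in> borel_measurable borel"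
    and per: "periodic h" and int: "set_integrable lborel Qcell h"
  shows "set_integrable lborel Qcell (\<lambda>y. h (y + a))" "set_integrable lborel Qcell (\<lambda>y. h (a - y))"
proof -
  have F: "fundom {y. - a + y \<in> Qcell}" unfolding Qcell_shift by (rule fundom_box1)
  then have [measurable]: "{y. - a + y \<in> Qcell} \<in> sets borel" by (simp add: fundom_def)
  have "set_integrable lborel {y. - a + y \<in> Qcell} h"
    using set_integrable_fundom_iff[OF Qcell_fundom F m per] int by blast
  then show "set_integrable lborel Qcell (\<lambda>y. h (y + a))" 
    unfolding set_integrable_def by (subst (asm) lborel_isometry_integral(1)[of 1 _ a, symmetric]) (simp_all add: indicator_def add.commute)
  have F: "fundom {y. a - y \<in> Qcell}" unfolding Qcell_reflect by (rule fundom_box2)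
  then have [measurable]: "{y. a - y \<in> Qcell} \<in> sets borel" by (simp add: fundom_def)
  have "set_integrable lborel {y. a - y \<in> Qcell} h"
    using set_integrable_fundom_iff[OF Qcell_fundom F m per] int by blast
  then show "set_integrable lborel Qcell (\<lambda>y. h (a - y))" 
    unfolding set_integrable_def by (subst (asm) lborel_isometry_integral(1)[of "-1" _ a, symmetric]) (simp_all add: indicator_def)
qed

lemma set_integral_Qcell_shift:
  fixes h :: "pt \<Rightarrow> complex"
  assumes m[measurable]: "h \<in> borel_measurable borel"
    and per: "periodic h" and int: "set_integrable lborel Qcell h"
  shows "(LINT y:Qcell|lborel. h (y + a)) = (LINT y:Qcell|lborel. h y)"
    "(LINT y:Qcell|lborel. h (a - y)) = (LINT y:Qcell|lborel. h y)"
proof -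
  have F: "fundom {y. - a + y \<in> Qcell}" unfolding Qcell_shift by (rule fundom_box1)
  then have [measurable]: "{y. - a + y \<in> Qcell} \<in> sets borel" by (simp add: fundom_def)
  from set_integral_fundom[OF Qcell_fundom F m per int]
  have "(LINT y:Qcell|lborel. h y) = (LINT y:{y. - a + y \<in> Qcell}|lborel. h y)" .
  also have "\<dots> = (LINT y:Qcell|lborel. h (y + a))"
    unfolding set_lebesgue_integral_def
    by (subst lborel_isometry_integral(2)[of 1 _ a, symmetric]) (simp_all add: indicator_def add.commute)
  finally show "(LINT y:Qcell|lborel. h (y + a)) = (LINT y:Qcell|lborel. h y)" ..
  have F: "fundom {y. a - y \<in> Qcell}" unfolding Qcell_reflect by (rule fundom_box2)
  then have [measurable]: "{y. a - y \<in> Qcell} \<in> sets borel" by (simp add: fundom_def)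
  from set_integral_fundom[OF Qcell_fundom F m per int]
  have "(LINT y:Qcell|lborel. h y) = (LINT y:{y. a - y \<in> Qcell}|lborel. h y)" .
  also have "\<dots> = (LINT y:Qcell|lborel. h (a - y))"
    unfolding set_lebesgue_integral_def
    by (subst lborel_isometry_integral(2)[of "-1" _ a, symmetric]) (simp_all add: indicator_def)
  finally show "(LINT y:Qcell|lborel. h (a - y)) = (LINT y:Qcell|lborel. h y)" ..
qed

section \<open>Bounds for integrals over the unit cell\<close>

lemma Qcell_measure: "emeasure lborel Qcell = 1" "measure lborel Qcell = 1"
proof -
  have "emeasure (lborel \<Otimes>\<^sub>M lborel) ({-1/2..<1/2::real} \<times> {-1/2..<1/2::real}) = 1"
    by (subst lborel.emeasure_pair_measure_Times) auto
  then show "emeasure lborel Qcell = 1" by (simp add: lborel_prod Qcell_def)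
  then show "measure lborel Qcell = 1" by (simp add: measure_def)
qed

lemma Qcell_shift_into: "\<exists>k. x + lat k \<in> Qcell"
  using Qcell_fundom unfolding fundom_def by blast

lemma Qcell_subset_cbox: "Qcell \<subseteq> cbox (-1/2, -1/2) (1/2, 1/2)"
  by (auto simp: Qcell_def cbox_Pair_eq)

lemma periodic_continuous_bounded:
  fixes u :: "pt \<Rightarrow> 'b::real_normed_vector"
  assumes "periodic u" "continuous_on UNIV u"
  obtains B where "\<And>x. norm (u x) \<le> B" "B \<ge> 0"
proof -
  have "compact (u ` cbox (-1/2, -1/2) (1/2, 1/2))"
    by (intro compact_continuous_image continuous_on_subset[OF assms(2)]) auto
  then obtain B where B: "\<And>x. x \<in> cbox (-1/2, -1/2) (1/2, 1/2) \<Longrightarrow> norm (u x) \<le> B"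
    by (meson bounded_iff compact_imp_bounded imageI)
  have "norm (u x) \<le> B" for x
  proof -
    obtain k where "x + lat k \<in> Qcell" using Qcell_shift_into by blast
    then have "norm (u (x + lat k)) \<le> B" using B Qcell_subset_cbox by blast
    then show ?thesis by (simp add: periodicD[OF assms(1)])
  qed
  moreover have "B \<ge> 0" using calculation[of 0] norm_ge_zero order_trans by blast
  ultimately show ?thesis using that by blast
qed

lemma set_integrable_Qcell_bounded:
  fixes u :: "pt \<Rightarrow> 'b::{banach,second_countable_topology}"
  assumes [measurable]: "u \<in> borel_measurable borel" and "\<And>x. norm (u x) \<le> B"
  shows "set_integrable lborel Qcell u"
proof -
  have "integrable lborel (\<lambda>x. indicator Qcell x *\<^sub>R B)"
    using Qcell_measure by (intro integrable_scaleR_left) (auto simp: integrable_indicator_iff)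
  then show ?thesis unfolding set_integrable_def
  proof (rule Bochner_Integration.integrable_bound)
    show "AE x in lborel. norm (indicator Qcell x *\<^sub>R u x) \<le> norm (indicator Qcell x *\<^sub>R B)"
      by (intro AE_I2) (use order_trans[OF assms(2) abs_ge_self] in \<open>auto simp: indicator_def\<close>)
  qed auto
qed

lemma set_integral_Qcell_norm_le:
  fixes u :: "pt \<Rightarrow> 'b::{banach,second_countable_topology}"
  assumes [measurable]: "u \<in> borel_measurable borel" and b: "\<And>x. norm (u x) \<le> B"
  shows "norm (LINT x:Qcell|lborel. u x) \<le> B"
proof -
  have "norm (LINT x:Qcell|lborel. u x) \<le> (\<integral>x. norm (indicator Qcell x *\<^sub>R u x) \<partial>lborel)"
    unfolding set_lebesgue_integral_def by (rule integral_norm_bound)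
  also have "\<dots> \<le> (\<integral>x. indicator Qcell x *\<^sub>R B \<partial>lborel)"
  proof (intro integral_mono integrable_norm)
    show "integrable lborel (\<lambda>x. indicator Qcell x *\<^sub>R u x)"
      using set_integrable_Qcell_bounded[OF assms] by (simp add: set_integrable_def)
    show "integrable lborel (\<lambda>x. indicator Qcell x *\<^sub>R B)"
      using Qcell_measure by (intro integrable_scaleR_left) (auto simp: integrable_indicator_iff)
  qed (use b in \<open>auto simp: indicator_def\<close>)
  also have "\<dots> = B" using Qcell_measure by simp
  finally show ?thesis .
qed

lemma set_integrable_Qcell_continuous:
  fixes u :: "pt \<Rightarrow> 'b::{banach,second_countable_topology}"
  assumes "periodic u" "continuous_on UNIV u"
  shows "set_integrable lborel Qcell u"
  using periodic_continuous_bounded[OF assms] set_integrable_Qcell_bounded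
    borel_measurable_continuous_onI[OF assms(2)] by metis

section \<open>Fourier series with absolutely summable coefficients\<close>

definition ek :: "int \<times> int \<Rightarrow> pt \<Rightarrow> complex" where
  "ek k x = cis (2 * pi * ip k x)"

text \<open>The square of the Japanese bracket, the base of the weight in
  \<open>hs_weight\<close>.\<close>

definition jb :: "int \<times> int \<Rightarrow> real" where
  "jb k = 1 + (knorm k)\<^sup>2"

definition fser :: "(int \<times> int \<Rightarrow> complex) \<Rightarrow> pt \<Rightarrow> complex" where
  "fser c x = (\<Sum>\<^sub>\<infinity>k. c k * ek k x)"

abbreviation acs :: "(int \<times> int \<Rightarrow> complex) \<Rightarrow> bool" where
  "acs c \<equiv> (\<lambda>k. cmod (c k)) summable_on UNIV"

text \<open>A weighted sup norm. Orders count powers of \<open>jb\<close>, so order \<open>s\<close>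
  means decay like \<open>knorm k\<close> to the power \<open>-2 s\<close>.\<close>

definition dec :: "real \<Rightarrow> real \<Rightarrow> (int \<times> int \<Rightarrow> complex) \<Rightarrow> bool" where
  "dec s C c \<longleftrightarrow> (\<forall>k. cmod (c k) \<le> C * jb k powr (- s))"

definition herm :: "(int \<times> int \<Rightarrow> complex) \<Rightarrow> bool" where
  "herm c \<longleftrightarrow> (\<forall>k. c (- k) = cnj (c k))"

section \<open>Weights on the frequency lattice\<close>

lemma knorm_sq: "(knorm k)\<^sup>2 = (real_of_int (fst k))\<^sup>2 + (real_of_int (snd k))\<^sup>2"
  by (simp add: knorm_def)

lemma knorm_nonneg [simp]: "knorm k \<ge> 0"
  by (simp add: knorm_def)

lemma knorm_uminus [simp]: "knorm (- k) = knorm k"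
  by (simp add: knorm_def)

lemma knorm_0 [simp]: "knorm 0 = 0"
  by (simp add: knorm_def)

lemma knorm_ge1: "k \<noteq> 0 \<Longrightarrow> knorm k \<ge> 1"
proof -
  assume "k \<noteq> 0"
  then have "(fst k)\<^sup>2 + (snd k)\<^sup>2 > 0" by (auto simp: prod_eq_iff sum_power2_gt_zero_iff)
  then have "(fst k)\<^sup>2 + (snd k)\<^sup>2 \<ge> 1" by linarith
  then have "real_of_int ((fst k)\<^sup>2 + (snd k)\<^sup>2) \<ge> 1" by linarith
  then show ?thesis by (simp add: knorm_def)
qed

lemma jb_ge1: "jb k \<ge> 1" and jb_pos [simp]: "jb k > 0"
  by (simp_all add: jb_def add_pos_nonneg)

lemma jb_nonneg [simp]: "jb k \<ge> 0" using jb_pos[of k] by linarith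

lemma jb_uminus [simp]: "jb (- k) = jb k"
  by (simp add: jb_def)

lemma fst_le_jb: "\<bar>real_of_int (fst k)\<bar> \<le> knorm k" and snd_le_jb: "\<bar>real_of_int (snd k)\<bar> \<le> knorm k"
  by (auto simp: knorm_def intro: real_le_rsqrt)

lemma knorm_le_jb: "knorm k \<le> jb k"
proof -
  have "0 \<le> (knorm k - 1)\<^sup>2 + (knorm k)\<^sup>2 + 1" by simp
  then show ?thesis by (simp add: jb_def power2_eq_square algebra_simps)
qed

lemma knorm_le_jb_powr: "knorm k \<le> jb k powr (1/2)"
proof -
  have "knorm k = sqrt ((knorm k)\<^sup>2)" by simp
  also have "\<dots> \<le> sqrt (jb k)" unfolding jb_def by (intro real_sqrt_le_mono) simp
  finally show ?thesis by (simp add: powr_half_sqrt)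
qed

lemma jb_triangle: "jb k \<le> 2 * (jb l + jb (k - l))"
proof -
  have *: "(a::real)\<^sup>2 \<le> 2 * (b\<^sup>2 + (a - b)\<^sup>2)" for a b
  proof -
    have "0 \<le> (a - 2 * b)\<^sup>2" by simp
    then show ?thesis by (simp add: power2_eq_square algebra_simps)
  qed
  show ?thesis
    using *[of "real_of_int (fst k)" "real_of_int (fst l)"] *[of "real_of_int (snd k)" "real_of_int (snd l)"]
    by (simp add: jb_def knorm_sq)
qed

lemma jb_powr_triangle:
  assumes "s \<ge> 0"
  shows "jb k powr s \<le> 4 powr s * (jb l powr s + jb (k - l) powr s)"
proof -
  have "jb k \<le> 4 * max (jb l) (jb (k - l))" using jb_triangle[of k l] by (auto simp: max_def)
  then have "jb k powr s \<le> (4 * max (jb l) (jb (k - l))) powr s"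
    using assms by (intro powr_mono2) auto
  also have "\<dots> = 4 powr s * max (jb l) (jb (k - l)) powr s"
    by (simp add: powr_mult)
  also have "\<dots> \<le> 4 powr s * (jb l powr s + jb (k - l) powr s)"
    by (intro mult_left_mono) (auto simp: max_def)
  finally show ?thesis .
qed

text \<open>This is \<open>jb_powr_triangle\<close> divided by all three powers. Summed over
  \<open>l\<close>, it shows that the norms of \<open>dec\<close> are stable under
  convolution.\<close>

lemma jb_conv_pointwise:
  assumes "s \<ge> 0"
  shows "jb l powr (- s) * jb (k - l) powr (- s)
    \<le> 4 powr s * jb k powr (- s) * (jb l powr (- s) + jb (k - l) powr (- s))"
proof -
  define a b c where "a = jb l powr s" and "b = jb (k - l) powr s" and "c = jb k powr s"
  have pos: "a > 0" "b > 0" "c > 0" by (auto simp: a_def b_def c_def less_imp_neq[OF jb_pos, symmetric])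
  have le: "c \<le> 4 powr s * (a + b)" using jb_powr_triangle[OF assms, of k l] by (simp add: a_def b_def c_def)
  have "inverse a * inverse b = c * (inverse a * inverse b * inverse c)" using pos by simp
  also have "\<dots> \<le> 4 powr s * (a + b) * (inverse a * inverse b * inverse c)"
    using pos by (intro mult_right_mono le) auto
  also have "\<dots> = 4 powr s * inverse c * (inverse a + inverse b)"
    using pos by (simp add: field_simps)
  finally show ?thesis by (simp add: powr_minus a_def b_def c_def)
qed

lemma summable_int_inverse_square: "(\<lambda>n::int. 1 / (1 + (real_of_int n)\<^sup>2)) summable_on UNIV"
proof -
  let ?f = "\<lambda>n::int. 1 / (1 + (real_of_int n)\<^sup>2)"
  have "summable (\<lambda>n. 1 / (1 + (real n)\<^sup>2))"
  proof (rule summable_comparison_test)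
    show "\<exists>N. \<forall>n\<ge>N. norm (1 / (1 + (real n)\<^sup>2)) \<le> inverse ((real n)^2)"
      by (intro exI[of _ 1]) (auto simp: divide_simps add_pos_nonneg)
  qed (rule inverse_power_summable, simp)
  then have s: "(\<lambda>n. 1 / (1 + (real n)\<^sup>2)) summable_on UNIV"
    by (intro norm_summable_imp_summable_on) auto
  have "?f summable_on range int" 
    using s by (subst summable_on_reindex) (auto simp: o_def)
  moreover have "?f summable_on range (\<lambda>n. - int n)"
    using s by (subst summable_on_reindex) (auto simp: o_def inj_def)
  ultimately have "?f summable_on (range int \<union> range (\<lambda>n. - int n))"
    by (rule summable_on_union)
  moreover have "range int \<union> range (\<lambda>n. - int n) = UNIV"
    by (auto intro: int_cases2)
  ultimately show ?thesis by simp
qed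

lemma summable_on_times_UNIV:
  fixes f :: "int \<Rightarrow> real"
  assumes nn: "\<And>n. f n \<ge> 0" and sum: "f summable_on UNIV"
  shows "(\<lambda>x. f (fst x) * f (snd x)) summable_on UNIV"
proof -
  have "(\<lambda>(x,y). f x * f y) summable_on (Sigma UNIV (\<lambda>_. UNIV))"
    by (rule summable_on_SigmaI[where g = "\<lambda>x. f x * infsum f UNIV"])
      (auto intro!: has_sum_cmult_right has_sum_infsum summable_on_cmult_left sum mult_nonneg_nonneg nn)
  then show ?thesis by (simp add: case_prod_unfold)
qed

text \<open>The square of \<open>jb\<close> dominates the product of the two one-dimensional
  weights, so the lattice sum is bounded by a product of two sums over the integers. This comparison
  is the origin of the order 2 that recurs throughout.\<close>

lemma summable_jb:
  assumes "s \<ge> 2"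
  shows "(\<lambda>k. jb k powr (- s)) summable_on UNIV"
proof (rule summable_on_comparison_test)
  let ?f = "\<lambda>n::int. 1 / (1 + (real_of_int n)\<^sup>2)"
  show "(\<lambda>x. ?f (fst x) * ?f (snd x)) summable_on UNIV"
    by (intro summable_on_times_UNIV summable_int_inverse_square) auto
  show "jb k powr (- s) \<le> ?f (fst k) * ?f (snd k)" for k
  proof -
    have "(1 + (real_of_int (fst k))\<^sup>2) * (1 + (real_of_int (snd k))\<^sup>2) \<le> jb k * jb k"
      by (intro mult_mono) (auto simp: jb_def knorm_sq)
    also have "\<dots> = jb k powr 2" by (simp add: powr_numeral power2_eq_square)
    also have "\<dots> \<le> jb k powr s" using assms jb_ge1 by (intro powr_mono) auto
    finally show ?thesis
      by (simp add: powr_minus divide_simps add_pos_nonneg) 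
  qed
qed auto

section \<open>Characters and their orthogonality\<close>

lemma cmod_ek [simp]: "cmod (ek k x) = 1"
  by (simp add: ek_def)

lemma ek_0 [simp]: "ek 0 x = 1"
  by (simp add: ek_def ip_def)

lemma ek_uminus: "ek (- k) x = cnj (ek k x)"
  by (simp add: ek_def ip_def cis_cnj algebra_simps)

lemma ek_uminus_right: "ek k (- x) = cnj (ek k x)"
  by (simp add: ek_def ip_def cis_cnj algebra_simps)

lemma ek_add: "ek (k + l) x = ek k x * ek l x"
  by (simp add: ek_def ip_def cis_mult algebra_simps)

lemma ek_add_right: "ek k (x + y) = ek k x * ek k y"
  by (simp add: ek_def ip_def cis_mult algebra_simps)

lemma ek_diff_right: "ek k (x - y) = ek k x * cnj (ek k y)"
  using ek_add_right[of k x "- y"] by (simp add: ek_uminus_right)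

lemma cnj_ek_mult [simp]: "cnj (ek k x) * ek k x = 1" "ek k x * cnj (ek k x) = 1"
  by (simp_all add: complex_norm_square[symmetric] mult.commute[of "cnj _"])

lemma ek_lat: "ek k (lat l) = 1"
proof -
  have "ip k (lat l) = of_int (fst k * fst l + snd k * snd l)" by (simp add: ip_def lat_def)
  then have "ek k (lat l) = cis (2 * pi * of_int (fst k * fst l + snd k * snd l))" by (simp only: ek_def)
  then show ?thesis by (simp add: cis_multiple_2pi del: of_int_add of_int_mult)
qed

lemma periodic_ek: "periodic (ek k)"
  by (simp add: periodic_def ek_add_right ek_lat)

lemma fcoef_ek: "fcoef u k = (LINT x:Qcell|lborel. complex_of_real (u x) * cnj (ek k x))"
  by (simp add: fcoef_def ek_def cis_cnj mult.assoc)

lemma continuous_ek: "continuous_on A (ek k)"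
  unfolding ek_def ip_def by (intro continuous_intros)

lemma continuous_ek' [continuous_intros]: "continuous_on A f \<Longrightarrow> continuous_on A (\<lambda>x. ek k (f x))"
  unfolding ek_def ip_def by (intro continuous_intros)

lemma measurable_ek [measurable]: "ek k \<in> borel_measurable borel"
  by (intro borel_measurable_continuous_onI continuous_ek)

lemma set_integral_ek: "(LINT x:Qcell|lborel. ek k x) = (if k = 0 then 1 else 0)"
proof (cases "k = 0")
  case True
  have "emeasure lborel Qcell < \<infinity>" by (simp add: Qcell_measure)
  then show ?thesis using True Qcell_measure by (simp add: set_lebesgue_integral_def scaleR_conv_of_real)
next
  case False
  then consider "fst k \<noteq> 0" | "snd k \<noteq> 0" by (auto simp: prod_eq_iff)
  \<comment> \<open>A shift by half a wavelength multiplies the character by -1, so its integral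
    equals its own negative.\<close>
  then obtain a :: pt where a: "ip k a = 1/2"
  proof cases
    case 1 then show ?thesis by (intro that[of "(1 / (2 * of_int (fst k)), 0)"]) (simp add: ip_def)
  next
    case 2 then show ?thesis by (intro that[of "(0, 1 / (2 * of_int (snd k)))"]) (simp add: ip_def)
  qed
  have ea: "ek k a = -1" by (simp add: ek_def a)
  have "(LINT x:Qcell|lborel. ek k x) = (LINT x:Qcell|lborel. ek k (x + a))"
    by (intro set_integral_Qcell_shift(1)[symmetric] periodic_ek set_integrable_Qcell_continuous continuous_ek measurable_ek)
  also have "\<dots> = - (LINT x:Qcell|lborel. ek k x)"
    by (simp add: ek_add_right ea set_lebesgue_integral_def)
  finally show ?thesis using False by simp
qed

section \<open>Absolutely convergent Fourier series and their derivatives\<close>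

lemma acs_dec: assumes "dec s C c" "s \<ge> 2" shows "acs c"
proof (rule summable_on_comparison_test)
  show "(\<lambda>k. C * jb k powr (- s)) summable_on UNIV" by (intro summable_on_cmult_right summable_jb assms)
qed (use assms in \<open>auto simp: dec_def\<close>)

lemma fser_summable: assumes "acs c" shows "(\<lambda>k. c k * ek k x) summable_on UNIV"
  by (rule abs_summable_summable) (use assms in \<open>simp add: norm_mult\<close>)

lemma fser_add: assumes "acs c" "acs d" shows "fser (\<lambda>k. c k + d k) x = fser c x + fser d x"
  unfolding fser_def using fser_summable[OF assms(1)] fser_summable[OF assms(2)]
  by (subst infsum_add[symmetric]) (auto simp: algebra_simps)

lemma fser_cmult: "fser (\<lambda>k. a * c k) x = a * fser c x"
  unfolding fser_def by (simp add: mult.assoc infsum_cmult_right')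

lemma fser_diff: assumes "acs c" "acs d" shows "fser (\<lambda>k. c k - d k) x = fser c x - fser d x"
  using fser_add[of c "\<lambda>k. (-1) * d k" x] fser_cmult[of "-1" d x] assms by (simp del: )

lemma fser_norm_le: assumes "acs c" shows "cmod (fser c x) \<le> (\<Sum>\<^sub>\<infinity>k. cmod (c k))"
  unfolding fser_def using norm_infsum_bound[of "\<lambda>k. c k * ek k x" UNIV] assms by (simp add: norm_mult)

lemma periodic_fser: "periodic (fser c)"
  unfolding periodic_def fser_def by (simp add: periodicD[OF periodic_ek])

lemma infsum_uminus_index: "(\<Sum>\<^sub>\<infinity>k. f (- k)) = (\<Sum>\<^sub>\<infinity>k. f (k :: int \<times> int))"
  by (rule infsum_reindex_bij_witness[of _ uminus uminus]) auto

lemma fser_herm: assumes "herm c" shows "fser c x \<in> \<real>"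
proof -
  have "cnj (fser c x) = (\<Sum>\<^sub>\<infinity>k. c (- k) * ek (- k) x)"
    unfolding fser_def infsum_cnj[symmetric] using assms[unfolded herm_def, rule_format]
    by (intro infsum_cong) (simp add: ek_uminus)
  also have "\<dots> = fser c x" unfolding fser_def by (rule infsum_uminus_index)
  finally show ?thesis by (simp add: Reals_cnj_iff)
qed

lemma of_real_Re_fser: assumes "herm c" shows "complex_of_real (Re (fser c x)) = fser c x"
  using fser_herm[OF assms] by (simp add: of_real_Re)

text \<open>Uniform limit of finite partial sums by the Weierstrass test, jointly in space and the
  parameter.\<close>

lemma continuous_fser_param:
  fixes c :: "int \<times> int \<Rightarrow> 'a::topological_space \<Rightarrow> complex"
  assumes c: "\<And>k. continuous_on S (c k)" and M: "\<And>k t. t \<in> S \<Longrightarrow> cmod (c k t) \<le> M k" "M summable_on UNIV"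
  shows "continuous_on (UNIV \<times> S) (\<lambda>z. fser (\<lambda>k. c k (snd z)) (fst z))"
  unfolding fser_def
proof (rule uniform_limit_theorem)
  show "uniform_limit (UNIV \<times> S) (\<lambda>X z. \<Sum>k\<in>X. c k (snd z) * ek k (fst z)) (\<lambda>z. \<Sum>\<^sub>\<infinity>k. c k (snd z) * ek k (fst z)) (finite_subsets_at_top UNIV)"
    by (rule Weierstrass_m_test_general[OF _ M(2)]) (auto simp: norm_mult M)
  show "\<forall>\<^sub>F X in finite_subsets_at_top UNIV. continuous_on (UNIV \<times> S) (\<lambda>z. \<Sum>k\<in>X. c k (snd z) * ek k (fst z))"
    by (intro always_eventually allI continuous_intros continuous_on_compose2[OF c]) auto
qed simp

lemma continuous_fser: assumes "acs c" shows "continuous_on UNIV (fser c)"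
proof -
  have "continuous_on (UNIV \<times> (UNIV::real set)) (\<lambda>z. fser (\<lambda>k. c k) (fst z))"
    by (rule continuous_fser_param[where c = "\<lambda>k _. c k", OF _ _ assms]) auto
  then have "continuous_on UNIV (\<lambda>x. (\<lambda>z. fser (\<lambda>k. c k) (fst z)) (x, 0::real))"
    by (rule continuous_on_compose2) (auto intro!: continuous_intros)
  then show ?thesis by simp
qed

lemma norm_cis_taylor: "cmod (cis y - 1 - \<i> * y) \<le> y\<^sup>2"
proof -
  have "cmod (exp (\<i> * of_real y) - (\<Sum>i\<le>1. (\<i> * of_real y) ^ i / fact i))
     \<le> exp \<bar>Re (\<i> * of_real y)\<bar> * (cmod (\<i> * of_real y)) ^ Suc 1 / fact 1"
    by (rule Taylor_exp)
  then show ?thesis by (simp add: cis_conv_exp norm_mult numeral_2_eq_2 algebra_simps power_abs[symmetric] abs_mult)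
qed

lemma abs_ip_le: "\<bar>ip k h\<bar> \<le> 2 * knorm k * norm h"
proof -
  have "\<bar>ip k h\<bar> \<le> \<bar>real_of_int (fst k)\<bar> * \<bar>fst h\<bar> + \<bar>real_of_int (snd k)\<bar> * \<bar>snd h\<bar>"
    unfolding ip_def by (metis abs_mult abs_triangle_ineq)
  also have "\<dots> \<le> knorm k * norm h + knorm k * norm h"
    using norm_fst_le[of "fst h" "snd h"] norm_snd_le[of "snd h" "fst h"]
    by (intro add_mono mult_mono fst_le_jb snd_le_jb) auto
  finally show ?thesis by simp
qed

lemma acs_mult_bounded:
  assumes "acs c" "\<And>k. cmod (m k) \<le> B"
  shows "acs (\<lambda>k. m k * c k)"
proof (rule summable_on_comparison_test)
  show "(\<lambda>k. B * cmod (c k)) summable_on UNIV" by (intro summable_on_cmult_right assms)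
qed (use assms in \<open>auto simp: norm_mult mult_right_mono\<close>)

lemma acs_mono:
  assumes "M summable_on UNIV" "\<And>k. cmod (c k) \<le> M k"
  shows "acs c"
  by (rule summable_on_comparison_test[OF assms(1)]) (use assms in auto)

lemma acs_add: "acs c \<Longrightarrow> acs d \<Longrightarrow> acs (\<lambda>k. c k + d k)"
  by (rule acs_mono[where M = "\<lambda>k. cmod (c k) + cmod (d k)"]) (auto intro: summable_on_add norm_triangle_ineq)

lemma acs_diff: "acs c \<Longrightarrow> acs d \<Longrightarrow> acs (\<lambda>k. c k - d k)"
  by (rule acs_mono[where M = "\<lambda>k. cmod (c k) + cmod (d k)"]) (auto intro: summable_on_add norm_triangle_ineq4)

text \<open>By \<open>norm_cis_taylor\<close> the remainder of the \<open>k\<close>-th mode is at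
  most a constant times \<open>(knorm k)^2 * (norm h)^2\<close>. Two summable powers of the
  frequency therefore give a remainder quadratic in \<open>h\<close> for the whole series at
  once.\<close>

lemma fser_has_derivative:
  assumes "(\<lambda>k. (knorm k)\<^sup>2 * cmod (c k)) summable_on UNIV" "acs c"
  shows "(fser c has_derivative (\<lambda>h. fser (\<lambda>k. 2 * pi * \<i> * ip k h * c k) x)) (at x)"
proof -
  define S where "S = (\<Sum>\<^sub>\<infinity>k. (knorm k)\<^sup>2 * cmod (c k))"
  have S: "S \<ge> 0" unfolding S_def by (intro infsum_nonneg) auto
  have a1: "acs (\<lambda>k. knorm k * c k)"
  proof (rule acs_mono)
    show "(\<lambda>k. cmod (c k) + (knorm k)\<^sup>2 * cmod (c k)) summable_on UNIV"
      by (intro summable_on_add assms)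
    have "knorm k * cmod (c k) \<le> jb k * cmod (c k)" for k
      by (intro mult_right_mono knorm_le_jb) auto
    then show "cmod (knorm k * c k) \<le> cmod (c k) + (knorm k)\<^sup>2 * cmod (c k)" for k
      by (simp add: norm_mult jb_def algebra_simps)
  qed
  have a2: "acs (\<lambda>k. 2 * pi * \<i> * ip k h * c k)" for h
  proof (rule acs_mono)
    show "(\<lambda>k. 4 * pi * norm h * cmod (knorm k * c k)) summable_on UNIV"
      by (intro summable_on_cmult_right a1)
    have "\<bar>ip k h\<bar> * cmod (c k) \<le> 2 * knorm k * norm h * cmod (c k)" for k
      by (intro mult_right_mono abs_ip_le) auto
    then show "cmod (2 * pi * \<i> * ip k h * c k) \<le> 4 * pi * norm h * cmod (knorm k * c k)" for k
      by (simp add: norm_mult algebra_simps)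
  qed
  have lin: "bounded_linear (\<lambda>h. fser (\<lambda>k. 2 * pi * \<i> * ip k h * c k) x)"
  proof (rule bounded_linear_intro)
    fix h h' :: pt and r :: real
    have "fser (\<lambda>k. 2 * pi * \<i> * ip k (h + h') * c k) x 
       = fser (\<lambda>k. 2 * pi * \<i> * ip k h * c k + 2 * pi * \<i> * ip k h' * c k) x"
      by (simp add: ip_def algebra_simps)
    then show "fser (\<lambda>k. 2 * pi * \<i> * ip k (h + h') * c k) x 
       = fser (\<lambda>k. 2 * pi * \<i> * ip k h * c k) x + fser (\<lambda>k. 2 * pi * \<i> * ip k h' * c k) x"
      by (rule trans[OF _ fser_add[OF a2 a2]])
    have "fser (\<lambda>k. 2 * pi * \<i> * ip k (r *\<^sub>R h) * c k) x = fser (\<lambda>k. r * (2 * pi * \<i> * ip k h * c k)) x"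
      by (simp add: ip_def algebra_simps)
    then show "fser (\<lambda>k. 2 * pi * \<i> * ip k (r *\<^sub>R h) * c k) x = r *\<^sub>R fser (\<lambda>k. 2 * pi * \<i> * ip k h * c k) x"
      by (simp add: fser_cmult scaleR_conv_of_real)
    have "cmod (fser (\<lambda>k. 2 * pi * \<i> * ip k h * c k) x) \<le> (\<Sum>\<^sub>\<infinity>k. cmod (2 * pi * \<i> * ip k h * c k))"
      by (rule fser_norm_le[OF a2])
    also have "\<dots> \<le> (\<Sum>\<^sub>\<infinity>k. (norm h * 4 * pi) * cmod (knorm k * c k))"
    proof (intro infsum_mono a2 summable_on_cmult_right a1)
      fix k
      have "\<bar>ip k h\<bar> * cmod (c k) \<le> 2 * knorm k * norm h * cmod (c k)"
        by (intro mult_right_mono abs_ip_le) auto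
      then show "cmod (2 * pi * \<i> * ip k h * c k) \<le> (norm h * 4 * pi) * cmod (knorm k * c k)"
        by (simp add: norm_mult algebra_simps)
    qed
    also have "\<dots> = norm h * (4 * pi * (\<Sum>\<^sub>\<infinity>k. cmod (knorm k * c k)))"
      by (simp add: infsum_cmult_right' mult.assoc)
    finally show "cmod (fser (\<lambda>k. 2 * pi * \<i> * ip k h * c k) x) \<le> norm h * (4 * pi * (\<Sum>\<^sub>\<infinity>k. cmod (knorm k * c k)))" .
  qed
  have rem: "cmod (fser c (x + h) - fser c x - fser (\<lambda>k. 2 * pi * \<i> * ip k h * c k) x) \<le> 16 * pi\<^sup>2 * S * (norm h)\<^sup>2" for h
  proof -
    let ?r = "\<lambda>k. cis (2 * pi * ip k h) - 1 - \<i> * complex_of_real (2 * pi * ip k h)"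
    have shift: "fser c (x + h) = fser (\<lambda>k. ek k h * c k) x"
      by (simp add: fser_def ek_add_right algebra_simps)
    have aE: "acs (\<lambda>k. ek k h * c k)" by (rule acs_mult_bounded[where B = 1]) (use assms in auto)
    have "fser c (x + h) - fser c x - fser (\<lambda>k. 2 * pi * \<i> * ip k h * c k) x = fser (\<lambda>k. ek k h * c k - c k - 2 * pi * \<i> * ip k h * c k) x"
      unfolding shift fser_diff[OF acs_diff[OF aE assms(2)] a2] fser_diff[OF aE assms(2)] ..
    also have "\<dots> = fser (\<lambda>k. ?r k * c k) x" by (simp add: ek_def algebra_simps)
    finally have eq: "fser c (x + h) - fser c x - fser (\<lambda>k. 2 * pi * \<i> * ip k h * c k) x = fser (\<lambda>k. ?r k * c k) x" .
    have b: "cmod (?r k * c k) \<le> 16 * pi\<^sup>2 * (norm h)\<^sup>2 * ((knorm k)\<^sup>2 * cmod (c k))" for k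
    proof -
      have "cmod (?r k) \<le> (2 * pi * ip k h)\<^sup>2" by (rule norm_cis_taylor)
      also have "\<dots> = 4 * pi\<^sup>2 * \<bar>ip k h\<bar>\<^sup>2" by (simp add: power_mult_distrib)
      also have "\<dots> \<le> 4 * pi\<^sup>2 * (2 * knorm k * norm h)\<^sup>2"
        by (intro mult_left_mono power_mono abs_ip_le) auto
      finally have "cmod (?r k) * cmod (c k) \<le> 4 * pi\<^sup>2 * (2 * knorm k * norm h)\<^sup>2 * cmod (c k)"
        by (intro mult_right_mono) auto
      then show ?thesis by (subst norm_mult) (simp add: power_mult_distrib mult_ac)
    qed
    have "cmod (fser (\<lambda>k. ?r k * c k) x) \<le> (\<Sum>\<^sub>\<infinity>k. cmod (?r k * c k))"
      by (rule fser_norm_le, rule acs_mono[OF _ b]) (intro summable_on_cmult_right assms)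
    also have "\<dots> \<le> (\<Sum>\<^sub>\<infinity>k. 16 * pi\<^sup>2 * (norm h)\<^sup>2 * ((knorm k)\<^sup>2 * cmod (c k)))"
      by (intro infsum_mono b summable_on_cmult_right assms, rule acs_mono[OF _ b]) (intro summable_on_cmult_right assms)
    also have "\<dots> = 16 * pi\<^sup>2 * S * (norm h)\<^sup>2" by (simp add: infsum_cmult_right' S_def)
    finally show ?thesis unfolding eq .
  qed
  show ?thesis
    unfolding has_derivative_at
  proof (intro conjI lin)
    show "(\<lambda>h. norm (fser c (x + h) - fser c x - fser (\<lambda>k. 2 * pi * \<i> * ip k h * c k) x) / norm h) \<midarrow>0\<rightarrow> 0"
    proof (rule Lim_null_comparison)
      show "((\<lambda>h. 16 * pi\<^sup>2 * S * norm h) \<longlongrightarrow> 0) (at 0)"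
        by (intro tendsto_eq_intros refl tendsto_norm_zero) auto
      show "\<forall>\<^sub>F h in at 0. norm (norm (fser c (x + h) - fser c x - fser (\<lambda>k. 2 * pi * \<i> * ip k h * c k) x) / norm h) \<le> 16 * pi\<^sup>2 * S * norm h"
        by (rule eventuallyI) (use rem S in \<open>auto simp: divide_le_eq power2_eq_square mult.assoc\<close>)
    qed
  qed
qed

section \<open>Decay classes of coefficients and Fourier multipliers\<close>

lemma decD: "dec s C c \<Longrightarrow> cmod (c k) \<le> C * jb k powr (- s)"
  unfolding dec_def by blast

lemma dec_mono: assumes "dec s C c" "C \<le> D" "r \<le> s" "0 \<le> D" shows "dec r D c"
  unfolding dec_def
proof
  fix k
  have "cmod (c k) \<le> C * jb k powr (- s)" by (rule decD[OF assms(1)])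
  also have "\<dots> \<le> D * jb k powr (- r)"
    using assms jb_ge1 by (intro mult_mono powr_mono) auto
  finally show "cmod (c k) \<le> D * jb k powr (- r)" .
qed

lemma dec_nonneg: "dec s C c \<Longrightarrow> C \<ge> 0"
proof -
  assume "dec s C c"
  then have "0 \<le> C * jb 0 powr (- s)" unfolding dec_def using norm_ge_zero order_trans by blast
  then show "C \<ge> 0" using jb_pos[of 0] by (simp add: zero_le_mult_iff)
qed

lemma dec_mult:
  assumes "dec s C c" "\<And>k. cmod (m k) \<le> D * jb k powr r" "D \<ge> 0"
  shows "dec (s - r) (D * C) (\<lambda>k. m k * c k)"
  unfolding dec_def
proof
  fix k
  have "cmod (m k * c k) \<le> (D * jb k powr r) * (C * jb k powr (- s))"
    unfolding norm_mult by (intro mult_mono decD[OF assms(1)] assms(2)) (use assms(3) in auto)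
  also have "\<dots> = D * C * jb k powr (- (s - r))" by (simp add: powr_add[symmetric] algebra_simps)
  finally show "cmod (m k * c k) \<le> D * C * jb k powr (- (s - r))" .
qed

lemma dec_mult_bounded:
  assumes "dec s C c" "\<And>k. cmod (m k) \<le> D"
  shows "dec s (D * C) (\<lambda>k. m k * c k)"
proof -
  have "D \<ge> 0" using assms(2)[of 0] norm_ge_zero order_trans by blast
  moreover have "cmod (m k) \<le> D * jb k powr 0" for k using assms(2)[of k] by (simp add: less_imp_neq[OF jb_pos, symmetric])
  ultimately show ?thesis using dec_mult[OF assms(1), where r = 0] by simp
qed

text \<open>The coefficient side of smoothness: \<open>smooth_Re_fser\<close> and
  \<open>rapid_fcoef\<close> are the two directions.\<close>

definition rapid :: "(int \<times> int \<Rightarrow> complex) \<Rightarrow> bool" where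
  "rapid c \<longleftrightarrow> (\<forall>s. \<exists>C. dec s C c)"

lemma rapid_acs: "rapid c \<Longrightarrow> acs c"
  unfolding rapid_def using acs_dec[of 2] by auto

lemma rapid_mult:
  assumes "rapid c" "\<And>k. cmod (m k) \<le> D * jb k powr r"
  shows "rapid (\<lambda>k. m k * c k)"
proof -
  have "0 \<le> D * jb 0 powr r" using assms(2)[of 0] norm_ge_zero order_trans by blast
  then have "D \<ge> 0" using jb_pos[of 0] by (simp add: zero_le_mult_iff)
  show ?thesis
    unfolding rapid_def
  proof
    fix s
    obtain C where "dec (s + r) C c" using assms(1) unfolding rapid_def by blast
    from dec_mult[OF this assms(2) \<open>D \<ge> 0\<close>] show "\<exists>C. dec s C (\<lambda>k. m k * c k)" by auto
  qed
qed

lemma rapid_mult_bounded: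
  assumes "rapid c" "\<And>k. cmod (m k) \<le> D"
  shows "rapid (\<lambda>k. m k * c k)"
  using dec_mult_bounded[of _ _ c m D] assms unfolding rapid_def by meson

text \<open>The Fourier symbol of the derivative in direction \<open>v\<close>.\<close>

definition dsym :: "pt \<Rightarrow> int \<times> int \<Rightarrow> complex" where
  "dsym v k = 2 * pi * \<i> * ip k v"

lemma cmod_dsym_le: "cmod (dsym v k) \<le> 4 * pi * norm v * jb k powr (1/2)"
proof -
  have "\<bar>ip k v\<bar> \<le> 2 * jb k powr (1/2) * norm v"
    by (rule order_trans[OF abs_ip_le]) (intro mult_right_mono mult_left_mono knorm_le_jb_powr, auto)
  then show ?thesis by (simp add: dsym_def norm_mult mult_ac)
qed

lemma rapid_dsym: "rapid c \<Longrightarrow> rapid (\<lambda>k. dsym v k * c k)"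
  using rapid_mult[OF _ cmod_dsym_le] .

lemma herm_mult: "herm c \<Longrightarrow> herm d \<Longrightarrow> herm (\<lambda>k. c k * d k)"
  unfolding herm_def by simp

lemma herm_dsym: "herm (dsym v)"
  unfolding herm_def dsym_def ip_def by (simp add: algebra_simps del: split_paired_All)

lemma knorm_sq_summable: assumes "rapid c" shows "(\<lambda>k. (knorm k)\<^sup>2 * cmod (c k)) summable_on UNIV"
proof -
  have "acs (\<lambda>k. jb k powr 1 * c k)"
    by (intro rapid_acs rapid_mult[OF assms, where D = 1 and r = 1]) auto
  then have "(\<lambda>k. jb k * cmod (c k)) summable_on UNIV" by (simp add: norm_mult)
  then show ?thesis
    by (rule summable_on_comparison_test) (auto intro!: mult_right_mono simp: jb_def)
qed

lemma fser_has_derivative_rapid: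
  assumes "rapid c"
  shows "(fser c has_derivative (\<lambda>h. fser (\<lambda>k. dsym h k * c k) x)) (at x)"
  using fser_has_derivative[OF knorm_sq_summable[OF assms] rapid_acs[OF assms]] by (simp add: dsym_def)

lemma has_derivative_directional:
  assumes "(u has_derivative u') (at x)"
  shows "((\<lambda>t. u (x + t *\<^sub>R v)) has_real_derivative u' v) (at 0)"
proof -
  have "((\<lambda>t. u (x + t *\<^sub>R v)) has_derivative (\<lambda>t. u' (t *\<^sub>R v))) (at 0)"
    by (rule has_derivative_compose[of "\<lambda>t. x + t *\<^sub>R v" "\<lambda>t. t *\<^sub>R v" 0 UNIV u u'])
      (auto intro!: derivative_eq_intros simp: assms)
  moreover have "(\<lambda>t. u' (t *\<^sub>R v)) = (*) (u' v)"
    using linear_scale[OF has_derivative_linear[OF assms]] by (auto simp: mult.commute)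
  ultimately show ?thesis by (simp add: has_field_derivative_def)
qed

lemma pd_eqI: "(u has_derivative u') (at x) \<Longrightarrow> pd v u x = u' v"
  unfolding pd_def by (rule DERIV_imp_deriv[OF has_derivative_directional])

lemma Re_fser_has_derivative:
  assumes "rapid c"
  shows "((\<lambda>x. Re (fser c x)) has_derivative (\<lambda>h. Re (fser (\<lambda>k. dsym h k * c k) x))) (at x)"
  using fser_has_derivative_rapid[OF assms, THEN bounded_linear.has_derivative[OF bounded_linear_Re]] .

lemma pd_Re_fser: "rapid c \<Longrightarrow> pd v (\<lambda>x. Re (fser c x)) = (\<lambda>x. Re (fser (\<lambda>k. dsym v k * c k) x))"
  using pd_eqI[OF Re_fser_has_derivative] by blast

text \<open>Real parts of rapid series are closed under \<open>pd\<close>, since the coefficients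
  only acquire a factor \<open>dsym v k\<close>; induction on the list of directions then covers all
  orders.\<close>

lemma smooth_Re_fser: assumes "rapid c" shows "smooth_on UNIV (\<lambda>x. Re (fser c x))"
proof -
  have "\<exists>d. rapid d \<and> iter_pd vs (\<lambda>x. Re (fser c x)) = (\<lambda>x. Re (fser d x))" for vs
  proof (induction vs)
    case Nil
    show ?case by (rule exI[of _ c]) (simp add: assms)
  next
    case (Cons v vs)
    then obtain d where d: "rapid d" "iter_pd vs (\<lambda>x. Re (fser c x)) = (\<lambda>x. Re (fser d x))" by blast
    show ?case by (rule exI[of _ "\<lambda>k. dsym v k * d k"]) (simp add: d rapid_dsym pd_Re_fser)
  qed
  moreover have "(\<lambda>x. Re (fser d x)) differentiable_on UNIV" if "rapid d" for d
    unfolding differentiable_on_def differentiable_def using Re_fser_has_derivative[OF that] by auto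
  ultimately show ?thesis unfolding smooth_on_def by metis
qed

text \<open>An enumeration of the index set reduces this to term-by-term integration of a series,
  and absolute summability makes the ordered and the unordered sum agree. The separated bound
  \<open>B k * g x\<close> supplies both requirements.\<close>

lemma infsum_integral:
  fixes f :: "int \<times> int \<Rightarrow> 'a \<Rightarrow> complex"
  assumes [measurable]: "\<And>k. f k \<in> borel_measurable M"
    and b: "\<And>k x. cmod (f k x) \<le> B k * g x" and B: "B summable_on UNIV" "\<And>k. B k \<ge> 0" and g: "integrable M g" "\<And>x. g x \<ge> 0"
  shows "integrable M (\<lambda>x. \<Sum>\<^sub>\<infinity>k. f k x)" "(\<lambda>k. norm (\<integral>x. f k x \<partial>M)) summable_on UNIV"
    "(\<integral>x. (\<Sum>\<^sub>\<infinity>k. f k x) \<partial>M) = (\<Sum>\<^sub>\<infinity>k. \<integral>x. f k x \<partial>M)"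
proof -
  obtain \<kappa> :: "nat \<Rightarrow> int \<times> int" where k: "bij \<kappa>" by (rule countable_bij)
  have int: "integrable M (f k)" for k
  proof (rule Bochner_Integration.integrable_bound[where f = "\<lambda>x. B k * g x"])
    show "integrable M (\<lambda>x. B k * g x)" using g by simp
    show "AE x in M. norm (f k x) \<le> norm (B k * g x)" 
      by (rule AE_I2) (rule order_trans[OF b], simp)
  qed auto
  have nb: "(\<integral>x. cmod (f k x) \<partial>M) \<le> B k * (\<integral>x. g x \<partial>M)" for k
  proof -
    have "(\<integral>x. cmod (f k x) \<partial>M) \<le> (\<integral>x. B k * g x \<partial>M)"
      using g int b by (intro integral_mono) auto
    then show ?thesis by simp
  qed
  have Bk: "(\<lambda>n. B (\<kappa> n)) summable_on UNIV"
    using summable_on_reindex_bij_betw[OF k, of B] B by simp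
  then have Bs: "summable (\<lambda>n. B (\<kappa> n))" by (rule summable_on_imp_summable)
  have sf: "(\<lambda>k. norm (f k x)) summable_on UNIV" for x
    by (rule summable_on_comparison_test[OF _ b]) (auto intro: summable_on_cmult_left B)
  have sk: "(\<lambda>n. norm (f (\<kappa> n) x)) summable_on UNIV" for x
    using summable_on_reindex_bij_betw[OF k, of "\<lambda>k. cmod (f k x)"] sf by simp
  have A1: "AE x in M. summable (\<lambda>n. norm (f (\<kappa> n) x))"
    using summable_on_imp_summable[OF sk] by simp
  have A2: "summable (\<lambda>n. \<integral>x. norm (f (\<kappa> n) x) \<partial>M)"
  proof (rule summable_comparison_test')
    show "summable (\<lambda>n. B (\<kappa> n) * (\<integral>x. g x \<partial>M))" by (intro summable_mult2 Bs)
    show "norm (\<integral>x. norm (f (\<kappa> n) x) \<partial>M) \<le> B (\<kappa> n) * (\<integral>x. g x \<partial>M)" if "n \<ge> 0" for n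
      using nb[of "\<kappa> n"] by (simp add: integral_nonneg)
  qed
  have eq: "(\<Sum>\<^sub>\<infinity>k. f k x) = (\<Sum>n. f (\<kappa> n) x)" for x
  proof -
    have "(\<Sum>\<^sub>\<infinity>k. f k x) = (\<Sum>\<^sub>\<infinity>n. f (\<kappa> n) x)" by (rule infsum_reindex_bij_betw[OF k, symmetric])
    also have "\<dots> = (\<Sum>n. f (\<kappa> n) x)"
      using has_sum_imp_sums[OF has_sum_infsum[OF abs_summable_summable[OF sk]]] by (rule sums_unique)
    finally show ?thesis .
  qed
  show "integrable M (\<lambda>x. \<Sum>\<^sub>\<infinity>k. f k x)" unfolding eq using integrable_suminf[OF int A1 A2] .
  have cm: "cmod (\<integral>x. f k x \<partial>M) \<le> B k * (\<integral>x. g x \<partial>M)" for k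
    by (rule order_trans[OF integral_norm_bound nb])
  show as: "(\<lambda>k. norm (\<integral>x. f k x \<partial>M)) summable_on UNIV"
    by (rule summable_on_comparison_test[OF _ cm]) (auto intro: summable_on_cmult_left B)
  have "(\<lambda>n. norm (\<integral>x. f (\<kappa> n) x \<partial>M)) summable_on UNIV"
    using summable_on_reindex_bij_betw[OF k, of "\<lambda>k. cmod (\<integral>x. f k x \<partial>M)"] as by simp
  from has_sum_imp_sums[OF has_sum_infsum[OF abs_summable_summable[OF this]]]
  have "(\<Sum>n. \<integral>x. f (\<kappa> n) x \<partial>M) = (\<Sum>\<^sub>\<infinity>n. \<integral>x. f (\<kappa> n) x \<partial>M)" by (rule sums_unique[symmetric])
  also have "\<dots> = (\<Sum>\<^sub>\<infinity>k. \<integral>x. f k x \<partial>M)" by (rule infsum_reindex_bij_betw[OF k])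
  finally show "(\<integral>x. (\<Sum>\<^sub>\<infinity>k. f k x) \<partial>M) = (\<Sum>\<^sub>\<infinity>k. \<integral>x. f k x \<partial>M)"
    unfolding eq using integral_suminf[OF int A1 A2] by simp
qed

text \<open>One exchange of sum and integral with three uses: \<open>h\<close> is a conjugate
  character in \<open>fcoef_fser_aux\<close>, a reflected kernel in \<open>conv_Re_fser\<close> and
  a continuous function in \<open>parseval\<close>. Integrability of \<open>h\<close> suffices, so
  singular kernels are covered.\<close>

lemma set_integral_fser_mult:
  assumes c: "acs c" and h: "set_integrable lborel Qcell h" "h \<in> borel_measurable borel"
  shows "set_integrable lborel Qcell (\<lambda>x. fser c x * h x)"
    "(LINT x:Qcell|lborel. fser c x * h x) = (\<Sum>\<^sub>\<infinity>k. c k * (LINT x:Qcell|lborel. ek k x * h x))"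
proof -
  note [measurable] = h(2)
  have *: "indicator Qcell x *\<^sub>R (fser c x * h x) = (\<Sum>\<^sub>\<infinity>k. indicator Qcell x *\<^sub>R (c k * ek k x * h x))" for x
    unfolding fser_def by (simp add: infsum_scaleR_right infsum_cmult_left'[symmetric])
  have g: "integrable lborel (\<lambda>x. norm (indicator Qcell x *\<^sub>R h x))"
    using h(1) unfolding set_integrable_def by (rule integrable_norm)
  have b: "cmod (indicator Qcell x *\<^sub>R (c k * ek k x * h x)) \<le> cmod (c k) * norm (indicator Qcell x *\<^sub>R h x)" for k x
    by (simp add: norm_mult)
  note I = infsum_integral[of "\<lambda>k x. indicator Qcell x *\<^sub>R (c k * ek k x * h x)" lborel, OF _ b c _ g]
  show "set_integrable lborel Qcell (\<lambda>x. fser c x * h x)"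
    unfolding set_integrable_def * by (rule I(1)) auto
  have "(LINT x:Qcell|lborel. fser c x * h x) = (\<Sum>\<^sub>\<infinity>k. \<integral>x. indicator Qcell x *\<^sub>R (c k * ek k x * h x) \<partial>lborel)"
    unfolding set_lebesgue_integral_def * by (rule I(3)) auto
  also have "\<dots> = (\<Sum>\<^sub>\<infinity>k. c k * (LINT x:Qcell|lborel. ek k x * h x))"
  proof (rule infsum_cong)
    fix k
    have "(\<integral>x. indicator Qcell x *\<^sub>R (c k * ek k x * h x) \<partial>lborel) = (\<integral>x. c k * (indicator Qcell x *\<^sub>R (ek k x * h x)) \<partial>lborel)"
      by (simp add: mult_ac)
    then show "(\<integral>x. indicator Qcell x *\<^sub>R (c k * ek k x * h x) \<partial>lborel) = c k * (LINT x:Qcell|lborel. ek k x * h x)"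
      unfolding set_lebesgue_integral_def by (simp only: integral_mult_right_zero)
  qed
  finally show "(LINT x:Qcell|lborel. fser c x * h x) = (\<Sum>\<^sub>\<infinity>k. c k * (LINT x:Qcell|lborel. ek k x * h x))" .
qed

lemma set_integral_ek_cnj: "(LINT x:Qcell|lborel. ek l x * cnj (ek k x)) = (if l = k then 1 else 0)"
  using set_integral_ek[of "l - k"] ek_add[of l "- k"] by (simp add: ek_uminus)

lemma fcoef_fser_aux:
  assumes "acs c"
  shows "(LINT x:Qcell|lborel. fser c x * cnj (ek k x)) = c k"
proof -
  have "(LINT x:Qcell|lborel. fser c x * cnj (ek k x)) = (\<Sum>\<^sub>\<infinity>l. c l * (LINT x:Qcell|lborel. ek l x * cnj (ek k x)))"
  proof (rule set_integral_fser_mult(2)[OF assms])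
    have "set_integrable lborel Qcell (ek (- k))"
      by (intro set_integrable_Qcell_continuous periodic_ek continuous_ek)
    then show "set_integrable lborel Qcell (\<lambda>x. cnj (ek k x))" by (simp add: ek_uminus[abs_def])
    have "ek (- k) \<in> borel_measurable borel" by measurable
    then show "(\<lambda>x. cnj (ek k x)) \<in> borel_measurable borel" by (simp add: ek_uminus[abs_def])
  qed
  also have "\<dots> = (\<Sum>\<^sub>\<infinity>l\<in>{k}. c l)"
    unfolding set_integral_ek_cnj by (rule infsum_cong_neutral) auto
  finally show ?thesis by simp
qed

lemma fcoef_Re_fser: assumes "acs c" "herm c" shows "fcoef (\<lambda>x. Re (fser c x)) = c"
  unfolding fcoef_ek of_real_Re_fser[OF assms(2)] using fcoef_fser_aux[OF assms(1)] by blast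

definition cconv :: "(int \<times> int \<Rightarrow> complex) \<Rightarrow> (int \<times> int \<Rightarrow> complex) \<Rightarrow> int \<times> int \<Rightarrow> complex" where
  "cconv c d k = (\<Sum>\<^sub>\<infinity>l. c l * d (k - l))"

lemma fser_mult:
  assumes c: "acs c" and d: "acs d"
  shows "fser c x * fser d x = fser (cconv c d) x"
proof -
  \<comment> \<open>A shear of the double index: a pair of frequencies is replaced by the first one
    and their sum. It carries absolute summability of the product family over to the convolution
    family.\<close>
  have bij: "bij_betw (\<lambda>(l, k). (l, k - l)) (UNIV \<times> UNIV) (UNIV \<times> (UNIV :: (int \<times> int) set))"
    by (rule bij_betw_byWitness[where f' = "\<lambda>(l, j). (l, j + l)"]) auto
  have "(\<lambda>(l, j). cmod (c l) * cmod (d j)) summable_on (Sigma UNIV (\<lambda>_. UNIV))"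
    by (rule summable_on_SigmaI[where g = "\<lambda>l. cmod (c l) * (\<Sum>\<^sub>\<infinity>j. cmod (d j))"])
      (auto intro!: has_sum_cmult_right has_sum_infsum summable_on_cmult_left c d)
  then have s0: "(\<lambda>(l, j). norm (c l * d j * ek (l + j) x)) summable_on (UNIV \<times> UNIV)"
    by (simp add: case_prod_unfold norm_mult)
  have s1: "(\<lambda>(l, k). norm (c l * d (k - l) * ek k x)) summable_on (UNIV \<times> UNIV)"
    using summable_on_reindex_bij_betw[OF bij, of "\<lambda>p. norm ((\<lambda>(l, j). c l * d j * ek (l + j) x) p)"] s0
    by (simp add: case_prod_unfold)
  have "fser c x * fser d x = (\<Sum>\<^sub>\<infinity>l. \<Sum>\<^sub>\<infinity>j. c l * d j * ek (l + j) x)"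
  proof -
    have "fser c x * fser d x = (\<Sum>\<^sub>\<infinity>l. c l * ek l x * fser d x)"
      unfolding fser_def[of c] by (rule infsum_cmult_left'[symmetric])
    also have "\<dots> = (\<Sum>\<^sub>\<infinity>l. \<Sum>\<^sub>\<infinity>j. c l * ek l x * (d j * ek j x))"
      unfolding fser_def by (simp only: infsum_cmult_right')
    finally show ?thesis by (simp add: ek_add mult_ac)
  qed
  also have "\<dots> = (\<Sum>\<^sub>\<infinity>l. \<Sum>\<^sub>\<infinity>k. c l * d (k - l) * ek k x)"
  proof (rule infsum_cong)
    fix l
    show "(\<Sum>\<^sub>\<infinity>j. c l * d j * ek (l + j) x) = (\<Sum>\<^sub>\<infinity>k. c l * d (k - l) * ek k x)"
      by (rule infsum_reindex_bij_witness[of _ "\<lambda>k. k - l" "\<lambda>j. j + l"]) (auto simp: add.commute)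
  qed
  also have "\<dots> = (\<Sum>\<^sub>\<infinity>k. \<Sum>\<^sub>\<infinity>l. c l * d (k - l) * ek k x)"
    by (rule infsum_swap_banach) (rule abs_summable_summable, use s1 in \<open>simp add: case_prod_unfold\<close>)
  also have "\<dots> = fser (cconv c d) x"
    unfolding fser_def cconv_def by (simp add: infsum_cmult_left')
  finally show ?thesis .
qed

text \<open>Summation of \<open>jb_conv_pointwise\<close> over \<open>l\<close>. Both resulting sums
  are compared with order 2, so one lattice sum serves every \<open>s\<close>.\<close>

lemma conv_weight_sum:
  assumes "s \<ge> 2"
  shows "(\<lambda>l. jb l powr (- s) * jb (k - l) powr (- s)) summable_on UNIV"
    "(\<Sum>\<^sub>\<infinity>l. jb l powr (- s) * jb (k - l) powr (- s)) \<le> 4 powr s * 2 * (\<Sum>\<^sub>\<infinity>l. jb l powr (- 2)) * jb k powr (- s)"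
proof -
  have re: "(\<lambda>l. jb (k - l) powr (- r)) summable_on UNIV" "(\<Sum>\<^sub>\<infinity>l. jb (k - l) powr (- r)) = (\<Sum>\<^sub>\<infinity>l. jb l powr (- r))" if "r \<ge> 2" for r
    using summable_jb[OF that] summable_on_reindex_bij_witness[of UNIV "\<lambda>l. k - l" "\<lambda>l. k - l" UNIV "\<lambda>l. jb (k - l) powr (- r)" "\<lambda>l. jb l powr (- r)"]
      infsum_reindex_bij_witness[of UNIV "\<lambda>l. k - l" "\<lambda>l. k - l" UNIV "\<lambda>l. jb l powr (- r)" "\<lambda>l. jb (k - l) powr (- r)"] by auto
  have le2: "jb l powr (- s) \<le> jb l powr (- 2)" for l using assms jb_ge1 by (intro powr_mono) auto
  let ?g = "\<lambda>l. 4 powr s * jb k powr (- s) * (jb l powr (- 2) + jb (k - l) powr (- 2))"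
  have g: "?g summable_on UNIV"
    by (intro summable_on_cmult_right summable_on_add re(1) summable_jb) auto
  have le: "jb l powr (- s) * jb (k - l) powr (- s) \<le> ?g l" for l
  proof -
    have "jb l powr (- s) * jb (k - l) powr (- s) \<le> 4 powr s * jb k powr (- s) * (jb l powr (- s) + jb (k - l) powr (- s))"
      using assms by (intro jb_conv_pointwise) auto
    also have "\<dots> \<le> ?g l" by (intro mult_left_mono add_mono le2) auto
    finally show ?thesis .
  qed
  show sm: "(\<lambda>l. jb l powr (- s) * jb (k - l) powr (- s)) summable_on UNIV"
    by (rule summable_on_comparison_test[OF g le]) auto
  have "(\<Sum>\<^sub>\<infinity>l. jb l powr (- s) * jb (k - l) powr (- s)) \<le> (\<Sum>\<^sub>\<infinity>l. ?g l)"
    by (rule infsum_mono[OF sm g le])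
  also have "\<dots> = 4 powr s * jb k powr (- s) * ((\<Sum>\<^sub>\<infinity>l. jb l powr (- 2)) + (\<Sum>\<^sub>\<infinity>l. jb (k - l) powr (- 2)))"
    unfolding infsum_cmult_right' by (subst infsum_add) (auto intro!: summable_jb re(1))
  also have "(\<Sum>\<^sub>\<infinity>l. jb (k - l) powr (- 2)) = (\<Sum>\<^sub>\<infinity>l. jb l powr (- 2))" by (rule re(2)) simp
  finally show "(\<Sum>\<^sub>\<infinity>l. jb l powr (- s) * jb (k - l) powr (- s)) \<le> 4 powr s * 2 * (\<Sum>\<^sub>\<infinity>l. jb l powr (- 2)) * jb k powr (- s)"
    by (simp add: algebra_simps)
qed

section \<open>Fourier coefficients of integrable periodic functions, and convolution\<close>

lemma cell_rep_measurable: "(\<lambda>x::pt. x - lat (\<lfloor>fst x + 1/2\<rfloor>, \<lfloor>snd x + 1/2\<rfloor>)) \<in> borel_measurable borel"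
  unfolding lat_def fst_conv snd_conv
proof (intro borel_measurable_diff borel_measurable_Pair)
  have [measurable]: "(fst :: pt \<Rightarrow> real) \<in> borel_measurable borel" "(snd :: pt \<Rightarrow> real) \<in> borel_measurable borel"
    by (intro borel_measurable_continuous_onI continuous_intros)+
  show "(\<lambda>x::pt. real_of_int \<lfloor>fst x + 1/2\<rfloor>) \<in> borel_measurable borel"
    "(\<lambda>x::pt. real_of_int \<lfloor>snd x + 1/2\<rfloor>) \<in> borel_measurable borel" by measurable
qed simp

lemma measurable_cnj_ek [measurable]: "(\<lambda>x. cnj (ek k x)) \<in> borel_measurable borel"
  by (intro borel_measurable_continuous_onI continuous_intros)

lemma cell_rep_in: "x - lat (\<lfloor>fst x + 1/2\<rfloor>, \<lfloor>snd x + 1/2\<rfloor>) \<in> Qcell"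
proof -
  have *: "- (1/2) \<le> a - of_int \<lfloor>a + 1/2\<rfloor> \<and> a - of_int \<lfloor>a + 1/2\<rfloor> < 1/2" for a :: real by linarith
  show ?thesis using *[of "fst x"] *[of "snd x"] by (simp add: Qcell_def lat_def mem_Times_iff)
qed

text \<open>Set integrability only makes the function cut off to the cell measurable. Composition
  with the map to the representative in the cell recovers the whole function by periodicity.\<close>

lemma periodic_measurable:
  fixes K :: "pt \<Rightarrow> real"
  assumes "periodic K" "set_integrable lborel Qcell K"
  shows "K \<in> borel_measurable borel"
proof -
  let ?r = "\<lambda>x::pt. x - lat (\<lfloor>fst x + 1/2\<rfloor>, \<lfloor>snd x + 1/2\<rfloor>)"
  have m: "(\<lambda>x. indicator Qcell x *\<^sub>R K x) \<in> borel_measurable borel"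
    using assms(2) unfolding set_integrable_def by auto
  have "(\<lambda>x. indicator Qcell (?r x) *\<^sub>R K (?r x)) \<in> borel_measurable borel"
    by (rule measurable_compose[OF cell_rep_measurable m])
  then show ?thesis using cell_rep_in periodic_diffD[OF assms(1)] by simp
qed

lemma herm_fcoef: "herm (fcoef u)"
  unfolding herm_def
proof
  fix k
  have "cnj (fcoef u k) = (LINT x:Qcell|lborel. cnj (complex_of_real (u x) * cnj (ek k x)))"
    unfolding fcoef_ek set_lebesgue_integral_def by (rule trans[OF Bochner_Integration.integral_cnj[symmetric]]) simp
  then show "fcoef u (- k) = cnj (fcoef u k)" unfolding fcoef_ek by (simp add: ek_uminus)
qed

lemma set_integrable_mult_ek:
  assumes "set_integrable lborel Qcell u" "(u :: pt \<Rightarrow> complex) \<in> borel_measurable borel" "(f :: pt \<Rightarrow> complex) \<in> borel_measurable borel" "\<And>x. cmod (f x) \<le> B"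
  shows "set_integrable lborel Qcell (\<lambda>x. u x * f x)"
  unfolding set_integrable_def
proof (rule Bochner_Integration.integrable_bound)
  show "integrable lborel (\<lambda>x. B *\<^sub>R (indicator Qcell x *\<^sub>R u x))"
    using assms(1) unfolding set_integrable_def by (rule integrable_scaleR_right)
  show "(\<lambda>x. indicat_real Qcell x *\<^sub>R (u x * f x)) \<in> borel_measurable lborel" using assms(2,3) by auto
  have B: "B \<ge> 0" using assms(4)[of 0] norm_ge_zero order_trans by blast
  have "norm (indicator Qcell x *\<^sub>R (u x * f x)) \<le> norm (B *\<^sub>R (indicator Qcell x *\<^sub>R u x))" for x
  proof -
    have "cmod (u x) * cmod (f x) \<le> cmod (u x) * B" by (intro mult_left_mono assms(4)) auto
    then show ?thesis using B by (auto simp: indicator_def norm_mult mult.commute)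
  qed
  then show "AE x in lborel. norm (indicator Qcell x *\<^sub>R (u x * f x)) \<le> norm (B *\<^sub>R (indicator Qcell x *\<^sub>R u x))"
    by (rule AE_I2)
qed

lemma set_integrable_of_real:
  "set_integrable M A u \<Longrightarrow> set_integrable M A (\<lambda>x. complex_of_real (u x))"
  unfolding set_integrable_def using integrable_of_real[of M "\<lambda>x. indicator A x *\<^sub>R u x", where 'a = complex]
  by (simp add: scaleR_conv_of_real)

lemma fcoef_bounded:
  assumes "set_integrable lborel Qcell u"
  shows "cmod (fcoef u k) \<le> (LINT x:Qcell|lborel. \<bar>u x\<bar>)"
proof -
  have "cmod (fcoef u k) \<le> (\<integral>x. norm (indicator Qcell x *\<^sub>R (complex_of_real (u x) * cnj (ek k x))) \<partial>lborel)"
    unfolding fcoef_ek set_lebesgue_integral_def by (rule integral_norm_bound)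
  also have "\<dots> = (LINT x:Qcell|lborel. \<bar>u x\<bar>)"
    unfolding set_lebesgue_integral_def by (simp add: norm_mult abs_mult)
  finally show ?thesis .
qed

text \<open>A substitution in the periodic integral pulls the character out. The first form says
  that characters are eigenfunctions of convolution with \<open>u\<close>; the second moves the base
  point to the origin.\<close>

lemma periodic_fcoef_shift:
  assumes p: "periodic u" and i: "set_integrable lborel Qcell u"
  shows "(LINT y:Qcell|lborel. ek k y * complex_of_real (u (x - y))) = ek k x * fcoef u k"
    and "fcoef (\<lambda>y. u (y + x)) k = ek k x * fcoef u k"
proof -
  note [measurable] = periodic_measurable[OF p i]
  let ?h = "\<lambda>z. complex_of_real (u z) * cnj (ek k z)"
  have per: "periodic ?h" using p periodic_ek[of k] unfolding periodic_def by simp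
  have int: "set_integrable lborel Qcell ?h"
    by (rule set_integrable_mult_ek[OF set_integrable_of_real[OF i], where B = 1]) auto
  have "(LINT y:Qcell|lborel. ek k y * complex_of_real (u (x - y))) = (LINT y:Qcell|lborel. ek k x * ?h (x - y))"
  proof -
    have "ek k y * complex_of_real (u (x - y)) = ek k x * ?h (x - y)" for y
      unfolding ek_diff_right complex_cnj_mult complex_cnj_cnj using cnj_ek_mult(2)[of k x] by algebra
    then show ?thesis by (simp only:)
  qed
  also have "\<dots> = ek k x * (LINT y:Qcell|lborel. ?h (x - y))"
    by (rule set_integral_mult_right)
  also have "(LINT y:Qcell|lborel. ?h (x - y)) = (LINT y:Qcell|lborel. ?h y)"
    by (rule set_integral_Qcell_shift(2)[OF _ per int]) measurable
  finally show "(LINT y:Qcell|lborel. ek k y * complex_of_real (u (x - y))) = ek k x * fcoef u k"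
    by (simp add: fcoef_ek)
  have "fcoef (\<lambda>y. u (y + x)) k = (LINT y:Qcell|lborel. ek k x * ?h (y + x))"
  proof -
    have "complex_of_real (u (y + x)) * cnj (ek k y) = ek k x * ?h (y + x)" for y
      unfolding ek_add_right complex_cnj_mult using cnj_ek_mult(2)[of k x] by algebra
    then show ?thesis unfolding fcoef_ek by (simp only:)
  qed
  also have "\<dots> = ek k x * (LINT y:Qcell|lborel. ?h (y + x))"
    by (rule set_integral_mult_right)
  also have "(LINT y:Qcell|lborel. ?h (y + x)) = (LINT y:Qcell|lborel. ?h y)"
    by (rule set_integral_Qcell_shift(1)[OF _ per int]) measurable
  finally show "fcoef (\<lambda>y. u (y + x)) k = ek k x * fcoef u k" by (simp add: fcoef_ek)
qed

lemma conv_Re_fser: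
  assumes p: "periodic K" and i: "set_integrable lborel Qcell K" and c: "acs c" "herm c"
  shows "conv K (\<lambda>x. Re (fser c x)) x = Re (fser (\<lambda>k. fcoef K k * c k) x)"
proof -
  note m[measurable] = periodic_measurable[OF p i]
  have "complex_of_real (conv K (\<lambda>x. Re (fser c x)) x) = (LINT y:Qcell|lborel. fser c y * complex_of_real (K (x - y)))"
    unfolding conv_def set_integral_complex_of_real[symmetric] by (simp add: of_real_Re_fser[OF c(2)] mult.commute)
  also have "\<dots> = (\<Sum>\<^sub>\<infinity>k. c k * (LINT y:Qcell|lborel. ek k y * complex_of_real (K (x - y))))"
  proof (rule set_integral_fser_mult(2)[OF c(1)])
    show "set_integrable lborel Qcell (\<lambda>y. complex_of_real (K (x - y)))"
      by (intro set_integrable_of_real set_integrable_Qcell_shift(2) m p i)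
  qed measurable
  also have "\<dots> = fser (\<lambda>k. fcoef K k * c k) x"
    unfolding periodic_fcoef_shift(1)[OF p i] fser_def by (simp add: mult_ac)
  finally show ?thesis by (metis Re_complex_of_real)
qed

lemma Rop_Re_fser:
  assumes p: "periodic K" and i: "set_integrable lborel Qcell K" and c: "rapid c" "herm c"
  shows "Rop K (\<lambda>x. Re (fser c x)) x = (Re (fser (\<lambda>k. - dsym (0,1) k * fcoef K k * c k) x), Re (fser (\<lambda>k. dsym (1,0) k * fcoef K k * c k) x))"
proof -
  have eq: "conv K (\<lambda>x. Re (fser c x)) = (\<lambda>x. Re (fser (\<lambda>k. fcoef K k * c k) x))"
    using conv_Re_fser[OF p i rapid_acs[OF c(1)] c(2)] by blast
  have r: "rapid (\<lambda>k. fcoef K k * c k)" by (rule rapid_mult_bounded[OF c(1) fcoef_bounded[OF i]])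
  have "- fser (\<lambda>k. dsym (0,1) k * (fcoef K k * c k)) x = fser (\<lambda>k. - dsym (0,1) k * fcoef K k * c k) x"
    using fser_cmult[of "-1" "\<lambda>k. dsym (0,1) k * (fcoef K k * c k)" x] by (simp add: mult.assoc)
  then show ?thesis unfolding Rop_def eq pd_Re_fser[OF r] by (simp add: mult.assoc flip: uminus_complex.sel(1))
qed

section \<open>Uniqueness of Fourier coefficients\<close>

text \<open>The powers of the trigonometric polynomial \<open>q\<close> below concentrate at the origin, because
\<open>q > 1\<close> near the origin and \<open>0 \<le> q \<le> 1\<close> on the rest of the cell away from it.\<close>

lemma fourier_vanish_aux:
  fixes h :: "pt \<Rightarrow> real"
  assumes m[measurable]: "h \<in> borel_measurable borel" and int: "set_integrable lborel Qcell h"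
    and z: "\<And>k. fcoef h k = 0" and pos: "h 0 > 0" and cont: "isCont h 0"
  shows False
proof -
  define \<delta> where "\<delta> = h 0 / 2"
  have \<delta>: "\<delta> > 0" using pos by (simp add: \<delta>_def)
  obtain d where d: "d > 0" "\<And>x. dist x 0 < d \<Longrightarrow> dist (h x) (h 0) < \<delta>"
    using cont \<delta> unfolding continuous_at_eps_delta by (metis dist_commute)
  define r where "r = min (d / 2) (1/4)"
  have r: "0 < r" "r \<le> 1/4" "r \<le> d/2" using d by (auto simp: r_def)
  have near: "h y > \<delta>" if "\<bar>fst y\<bar> < r" "\<bar>snd y\<bar> < r" for y
  proof -
    have "norm y \<le> \<bar>fst y\<bar> + \<bar>snd y\<bar>" using sqrt_sum_squares_le_sum_abs by (simp add: norm_prod_def)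
    then have "dist y 0 < d" using that r by simp
    then show ?thesis using d(2)[of y] by (simp add: dist_real_def \<delta>_def abs_if split: if_splits)
  qed
  \<comment> \<open>Outside the square of half-side \<open>r\<close>, one cosine in \<open>q\<close>
    is at most \<open>cos (2 * pi * r)\<close> and the other at most 1. With this divisor
    \<open>q\<close> is at most 1 there, while its value \<open>4 / A\<close> at the origin exceeds
    1.\<close>
  define A where "A = 3 + cos (2 * pi * r)"
  have cr: "0 \<le> cos (2 * pi * r)" "cos (2 * pi * r) < 1"
  proof -
    have pr: "0 < 2 * pi * r" "2 * pi * r \<le> pi / 2" using r(1) mult_left_mono[OF r(2), of pi] by auto
    show "0 \<le> cos (2 * pi * r)" using pr pi_gt_zero by (intro cos_ge_zero) linarith+
    have "cos (2 * pi * r) < cos 0" using pr pi_gt_zero by (intro cos_monotone_0_pi) linarith+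
    then show "cos (2 * pi * r) < 1" by simp
  qed
  then have A: "3 \<le> A" "A < 4" by (auto simp: A_def)
  define q where "q y = (cos (2 * pi * fst y) + cos (2 * pi * snd y) + 2) / A" for y :: pt
  have q0: "q y \<ge> 0" for y
    unfolding q_def using A cos_ge_minus_one[of "2 * pi * fst y"] cos_ge_minus_one[of "2 * pi * snd y"]
    by (intro divide_nonneg_pos) linarith+
  have cosle: "cos (2 * pi * a) \<le> cos (2 * pi * r)" if "\<bar>a\<bar> \<ge> r" "\<bar>a\<bar> \<le> 1/2" for a :: real
  proof -
    have "cos (2 * pi * \<bar>a\<bar>) \<le> cos (2 * pi * r)"
      using r(1) mult_left_mono[OF that(1), of "2 * pi"] mult_left_mono[OF that(2), of "2 * pi"]
      by (intro cos_monotone_0_pi_le) auto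
    moreover have "cos (2 * pi * \<bar>a\<bar>) = cos (2 * pi * a)" by (auto simp: abs_if)
    ultimately show ?thesis by simp
  qed
  have q1: "q y \<le> 1" if "y \<in> Qcell" "\<not> (\<bar>fst y\<bar> < r \<and> \<bar>snd y\<bar> < r)" for y
  proof -
    have "\<bar>fst y\<bar> \<le> 1/2" "\<bar>snd y\<bar> \<le> 1/2" using that(1) by (auto simp: Qcell_def mem_Times_iff)
    then have "cos (2 * pi * fst y) + cos (2 * pi * snd y) \<le> 1 + cos (2 * pi * r)"
      using that(2) cosle[of "fst y"] cosle[of "snd y"] cos_le_one[of "2 * pi * fst y"] cos_le_one[of "2 * pi * snd y"] by linarith
    then show ?thesis unfolding q_def A_def using A by (simp add: divide_le_eq A_def)
  qed
  have mq[measurable]: "q \<in> borel_measurable borel" unfolding q_def[abs_def] using A by (intro borel_measurable_continuous_onI continuous_intros) auto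
  have qb: "\<bar>q y\<bar> \<le> 4 / A" for y
  proof -
    have "cos (2 * pi * fst y) + cos (2 * pi * snd y) + 2 \<le> 4"
      using cos_le_one[of "2 * pi * fst y"] cos_le_one[of "2 * pi * snd y"] by linarith
    then have "q y \<le> 4 / A" unfolding q_def using A by (intro divide_right_mono) auto
    then show ?thesis using q0[of y] by simp
  qed
  \<comment> \<open>The midpoint between 1 and \<open>q 0\<close>, so that \<open>q\<close> exceeds
    it on a smaller square around the origin.\<close>
  define \<rho> where "\<rho> = (1 + 4 / A) / 2"
  have \<rho>: "\<rho> > 1" "\<rho> < 4 / A" using A by (auto simp: \<rho>_def field_simps)
  have "isCont q 0" unfolding q_def[abs_def] using A by (intro continuous_intros) auto
  moreover have "q 0 = 4 / A" by (simp add: q_def)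
  ultimately obtain e where e: "e > 0" "\<And>x. dist x 0 < e \<Longrightarrow> dist (q x) (4 / A) < 4 / A - \<rho>"
    using \<rho>(2) unfolding continuous_at_eps_delta by (metis dist_commute diff_gt_0_iff_gt)
  define r' where "r' = min (e / 2) r"
  have r': "0 < r'" "r' \<le> r" "r' \<le> e / 2" using e r by (auto simp: r'_def)
  have qnear: "q y \<ge> \<rho>" if "\<bar>fst y\<bar> < r'" "\<bar>snd y\<bar> < r'" for y
  proof -
    have "norm y \<le> \<bar>fst y\<bar> + \<bar>snd y\<bar>" using sqrt_sum_squares_le_sum_abs by (simp add: norm_prod_def)
    then have "dist y 0 < e" using that r' by simp
    then show ?thesis using e(2)[of y] by (simp add: dist_real_def)
  qed
  \<comment> \<open>Multiplication by \<open>q\<close> only combines shifts of the frequency. The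
    vanishing of all coefficients of \<open>h\<close> therefore passes to \<open>h * q ^ n\<close>,
    by an induction that must be general in \<open>k\<close>.\<close>
  have qek: "complex_of_real (q y) = (2 + (ek (1,0) y + ek (-1,0) y + ek (0,1) y + ek (0,-1) y) / 2) / A" for y
  proof -
    have c: "complex_of_real (cos a) = (cis a + cis (- a)) / 2" for a
      by (simp add: complex_eq_iff)
    show ?thesis unfolding q_def of_real_divide of_real_add c by (simp add: ek_def ip_def algebra_simps add_divide_distrib)
  qed
  let ?H = "\<lambda>n k y. complex_of_real (h y) * (complex_of_real (q y) ^ n * ek k y)"
  have intH: "set_integrable lborel Qcell (?H n k)" for n k
  proof (rule set_integrable_mult_ek[OF set_integrable_of_real[OF int], where B = "(4 / A) ^ n"])
    show "cmod (complex_of_real (q x) ^ n * ek k x) \<le> (4 / A) ^ n" for x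
      using power_mono[OF qb, of x n] by (simp add: norm_mult norm_power)
  qed measurable
  have zero: "(LINT y:Qcell|lborel. ?H n k y) = 0" for n k
  proof (induction n arbitrary: k)
    case 0
    show ?case using z[of "- k"] by (simp add: fcoef_ek ek_uminus)
  next
    case (Suc n)
    have "?H (Suc n) k y = (2 / A) * ?H n k y + (1 / (2 * A)) * ?H n (k + (1,0)) y + (1 / (2 * A)) * ?H n (k + (-1,0)) y
        + (1 / (2 * A)) * ?H n (k + (0,1)) y + (1 / (2 * A)) * ?H n (k + (0,-1)) y" for y
      using A by (simp add: qek ek_add field_simps)
    then have "(LINT y:Qcell|lborel. ?H (Suc n) k y) = (LINT y:Qcell|lborel. (2 / A) * ?H n k y + (1 / (2 * A)) * ?H n (k + (1,0)) y + (1 / (2 * A)) * ?H n (k + (-1,0)) y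
        + (1 / (2 * A)) * ?H n (k + (0,1)) y + (1 / (2 * A)) * ?H n (k + (0,-1)) y)" by simp
    also have "\<dots> = (2 / A) * (LINT y:Qcell|lborel. ?H n k y) + (1 / (2 * A)) * (LINT y:Qcell|lborel. ?H n (k + (1,0)) y) + (1 / (2 * A)) * (LINT y:Qcell|lborel. ?H n (k + (-1,0)) y)
        + (1 / (2 * A)) * (LINT y:Qcell|lborel. ?H n (k + (0,1)) y) + (1 / (2 * A)) * (LINT y:Qcell|lborel. ?H n (k + (0,-1)) y)"
      by (simp only: set_integral_add intH set_integral_mult_right set_integrable_mult_right)
    also have "\<dots> = 0" unfolding Suc.IH by simp
    finally show ?case .
  qed
  have zr: "(LINT y:Qcell|lborel. h y * q y ^ n) = 0" for n
    using zero[of n 0] set_integral_complex_of_real[of lborel Qcell "\<lambda>y. h y * q y ^ n"] by simp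
  have intr: "set_integrable lborel Qcell (\<lambda>y. h y * q y ^ n)" for n
    using intH[of n 0] set_integrable_def integrable_Re[of lborel "\<lambda>y. indicator Qcell y *\<^sub>R ?H n 0 y"] 
    unfolding set_integrable_def by (simp flip: of_real_power of_real_mult)
  define U where "U = {-r'<..<r'} \<times> {-r'<..<r'}"
  have "emeasure (lborel \<Otimes>\<^sub>M lborel) U = ennreal (4 * r'^2)"
    unfolding U_def using r' by (subst lborel.emeasure_pair_measure_Times) (auto simp: ennreal_mult[symmetric] power2_eq_square)
  then have eU: "emeasure lborel U = ennreal (4 * r'^2)" by (simp add: lborel_prod)
  then have mU: "measure lborel U = 4 * r'^2" by (simp add: measure_def)
  have Ub[measurable]: "U \<in> sets borel" unfolding U_def by (intro borel_Times) auto
  have UQ: "U \<subseteq> Qcell" using r r' by (auto simp: U_def Qcell_def)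
  have nh: "set_integrable lborel Qcell (\<lambda>y. \<bar>h y\<bar>)" using int by (rule set_integrable_abs)
  define N where "N = (LINT y:Qcell|lborel. \<bar>h y\<bar>)"
  \<comment> \<open>Three regions: on \<open>U\<close> the integrand is at least
    \<open>\<delta> * \<rho> ^ n\<close>; on the rest of the square where \<open>h\<close> is
    positive it is nonnegative; elsewhere \<open>q\<close> is at most 1, which costs at most the
    integral \<open>N\<close> of the absolute value. As the total is 0 for every \<open>n\<close>,
    the growth of \<open>\<rho> ^ n\<close> is contradictory.\<close>
  have low: "\<delta> * \<rho> ^ n * (4 * r'^2) \<le> N" for n
  proof -
    have "\<delta> * \<rho> ^ n * (4 * r'^2) - N = (\<integral>y. indicator U y *\<^sub>R (\<delta> * \<rho> ^ n) \<partial>lborel) - (\<integral>y. indicator Qcell y *\<^sub>R \<bar>h y\<bar> \<partial>lborel)"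
      by (simp add: N_def set_lebesgue_integral_def mU)
    also have "\<dots> = (\<integral>y. indicator U y *\<^sub>R (\<delta> * \<rho> ^ n) - indicator Qcell y *\<^sub>R \<bar>h y\<bar> \<partial>lborel)"
      using nh eU unfolding set_integrable_def
      by (intro Bochner_Integration.integral_diff[symmetric] integrable_scaleR_left) (auto simp: integrable_indicator_iff)
    also have "\<dots> \<le> (\<integral>y. indicator Qcell y *\<^sub>R (h y * q y ^ n) \<partial>lborel)"
    proof (rule integral_mono)
      show "integrable lborel (\<lambda>y. indicator U y *\<^sub>R (\<delta> * \<rho> ^ n) - indicator Qcell y *\<^sub>R \<bar>h y\<bar>)"
        using nh eU unfolding set_integrable_def
        by (intro Bochner_Integration.integrable_diff integrable_scaleR_left) (auto simp: integrable_indicator_iff)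
      show "integrable lborel (\<lambda>y. indicator Qcell y *\<^sub>R (h y * q y ^ n))" using intr by (simp add: set_integrable_def)
      fix y :: pt
      consider "y \<in> U" | "y \<in> Qcell - U" "\<bar>fst y\<bar> < r" "\<bar>snd y\<bar> < r" | "y \<in> Qcell - U" "\<not> (\<bar>fst y\<bar> < r \<and> \<bar>snd y\<bar> < r)"
        | "y \<notin> Qcell" using UQ by blast
      then show "indicator U y *\<^sub>R (\<delta> * \<rho> ^ n) - indicator Qcell y *\<^sub>R \<bar>h y\<bar> \<le> indicator Qcell y *\<^sub>R (h y * q y ^ n)"
      proof cases
        case 1
        then have b: "\<bar>fst y\<bar> < r'" "\<bar>snd y\<bar> < r'" by (auto simp: U_def abs_less_iff)
        have "\<delta> * \<rho> ^ n \<le> h y * q y ^ n"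
          using near[of y] b r' qnear[OF b] \<rho> \<delta> by (intro mult_mono power_mono) auto
        then show ?thesis using 1 UQ by auto
      next
        case 2
        then have "h y > 0" using near[of y] \<delta> by simp
        then have "- h y \<le> 0" "0 \<le> h y * q y ^ n" using q0[of y] by simp_all
        then show ?thesis using 2 \<open>h y > 0\<close> by auto
      next
        case 3
        have "q y ^ n \<le> 1" using q0[of y] q1[of y] 3 by (intro power_le_one) auto
        then have "\<bar>h y\<bar> * q y ^ n \<le> \<bar>h y\<bar> * 1" by (intro mult_left_mono) auto
        then have "\<bar>h y * q y ^ n\<bar> \<le> \<bar>h y\<bar>" using q0[of y] by (simp add: abs_mult)
        then show ?thesis using 3 by auto
      next
        case 4
        then have "y \<notin> U" using UQ by blast
        then show ?thesis using 4 by simp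
      qed
    qed
    also have "\<dots> = 0" using zr[of n] by (simp add: set_lebesgue_integral_def)
    finally show ?thesis by simp
  qed
  obtain n where "N / (\<delta> * (4 * r'^2)) < \<rho> ^ n" using real_arch_pow[OF \<rho>(1)] by blast
  then have "N < \<delta> * \<rho> ^ n * (4 * r'^2)" using \<delta> r' by (simp add: divide_less_eq mult_ac)
  then show False using low[of n] by simp
qed

text \<open>Translating \<open>x\<close> to the origin and multiplying by the sign of
  \<open>h x\<close> reduces a nonzero value to the situation of
  \<open>fourier_vanish_aux\<close>.\<close>

lemma fourier_vanish:
  fixes h :: "pt \<Rightarrow> real"
  assumes p: "periodic h" and int: "set_integrable lborel Qcell h"
    and z: "\<And>k. fcoef h k = 0" and cont: "isCont h x"
  shows "h x = 0"
proof (rule ccontr)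
  assume nz: "h x \<noteq> 0"
  define s where "s = sgn (h x)"
  have m: "h \<in> borel_measurable borel" by (rule periodic_measurable[OF p int])
  let ?g = "\<lambda>y. s * h (y + x)"
  show False
  proof (rule fourier_vanish_aux[of ?g])
    show "?g \<in> borel_measurable borel" using m by measurable
    show "set_integrable lborel Qcell ?g"
      by (intro set_integrable_mult_right set_integrable_Qcell_shift m p int)
    have "fcoef ?g k = s * fcoef (\<lambda>y. h (y + x)) k" for k
      unfolding fcoef_ek by (simp add: mult.assoc set_integral_mult_right)
    then show "fcoef ?g k = 0" for k using periodic_fcoef_shift(2)[OF p int, of x k] z by simp
    show "?g 0 > 0" using nz by (simp add: s_def sgn_mult_self_eq abs_sgn_eq zero_less_mult_iff sgn_if)
    have "isCont (\<lambda>y. h (y + x)) 0"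
      by (rule isCont_o2[where g = h]) (use cont in \<open>auto intro!: continuous_intros\<close>)
    then show "isCont ?g 0" by (intro continuous_intros)
  qed
qed

section \<open>Inversion, and kernels with equal coefficients\<close>

lemma fcoef_diff:
  assumes "set_integrable lborel Qcell u" "u \<in> borel_measurable borel" "set_integrable lborel Qcell v" "v \<in> borel_measurable borel"
  shows "fcoef (\<lambda>x. u x - v x) k = fcoef u k - fcoef v k"
proof -
  have "set_integrable lborel Qcell (\<lambda>x. complex_of_real (w x) * cnj (ek k x))"
    if "set_integrable lborel Qcell w" "w \<in> borel_measurable borel" for w
    by (rule set_integrable_mult_ek[OF set_integrable_of_real[OF that(1)], where B = 1]) (use that(2) in auto)
  then show ?thesis unfolding fcoef_ek using assms by (simp add: algebra_simps)
qed

lemma fourier_inversion: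
  fixes u :: "pt \<Rightarrow> real"
  assumes p: "periodic u" and c: "continuous_on UNIV u" and s: "acs (fcoef u)"
  shows "u x = Re (fser (fcoef u) x)"
proof -
  let ?v = "\<lambda>x. Re (fser (fcoef u) x)"
  have cv: "continuous_on UNIV ?v" by (intro continuous_intros continuous_fser s)
  have pv: "periodic ?v" by (rule periodic_compose[OF periodic_fser])
  have "u x - ?v x = 0"
  proof (rule fourier_vanish)
    show "periodic (\<lambda>x. u x - ?v x)" using p pv unfolding periodic_def by simp
    then show "set_integrable lborel Qcell (\<lambda>x. u x - ?v x)"
      by (intro set_integrable_Qcell_continuous continuous_intros c cv)
    show "fcoef (\<lambda>x. u x - ?v x) k = 0" for k
      by (subst fcoef_diff) (auto intro!: set_integrable_Qcell_continuous p c pv cv borel_measurable_continuous_onI simp: fcoef_Re_fser[OF s herm_fcoef])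
    have "continuous_on UNIV (\<lambda>x. u x - ?v x)" by (intro continuous_intros c cv)
    then show "isCont (\<lambda>x. u x - ?v x) x" 
      using continuous_on_eq_continuous_at[OF open_UNIV] by blast
  qed
  then show ?thesis by simp
qed

text \<open>Uniqueness applied to the difference minus its mean. Continuity is asked only at the
  point \<open>x\<close>, because an admissible kernel may be singular on the lattice.\<close>

lemma kernel_const_diff:
  assumes p1: "periodic K1" and i1: "set_integrable lborel Qcell K1" and p2: "periodic K2" and i2: "set_integrable lborel Qcell K2"
    and eq: "\<And>k. k \<noteq> 0 \<Longrightarrow> fcoef K1 k = fcoef K2 k" and c: "isCont K1 x" "isCont K2 x"
  shows "K1 x - K2 x = Re (fcoef K1 0 - fcoef K2 0)"
proof -
  note m1 = periodic_measurable[OF p1 i1] and m2 = periodic_measurable[OF p2 i2]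
  define r where "r = Re (fcoef K1 0 - fcoef K2 0)"
  \<comment> \<open>At frequency zero hermitian symmetry says that the coefficient is real.\<close>
  have r: "fcoef K1 0 - fcoef K2 0 = complex_of_real r"
  proof -
    have "Im (fcoef u 0) = 0" for u using herm_fcoef[of u] unfolding herm_def by (metis add.inverse_neutral cnj.sel(2) equal_neg_zero)
    then show ?thesis by (simp add: r_def complex_eq_iff)
  qed
  have ic: "set_integrable lborel Qcell (\<lambda>_. r)" by (rule set_integrable_Qcell_bounded) auto
  have i12: "set_integrable lborel Qcell (\<lambda>y. K1 y - K2 y)" using i1 i2 by (rule set_integral_diff)
  have "K1 x - K2 x - r = 0"
  proof (rule fourier_vanish[of "\<lambda>y. K1 y - K2 y - r"])
    show "periodic (\<lambda>y. K1 y - K2 y - r)" using p1 p2 unfolding periodic_def by simp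
    show "set_integrable lborel Qcell (\<lambda>y. K1 y - K2 y - r)" using i12 ic by (rule set_integral_diff)
    show "isCont (\<lambda>y. K1 y - K2 y - r) x" using c by (intro continuous_intros)
    fix k
    have "fcoef (\<lambda>y. r) k = r * cnj (LINT x:Qcell|lborel. ek k x)"
    proof -
      have "fcoef (\<lambda>y. r) k = r * (LINT x:Qcell|lborel. ek (-k) x)"
        unfolding fcoef_ek ek_uminus by (rule set_integral_mult_right)
      then show ?thesis by (simp add: set_integral_ek)
    qed
    then have "fcoef (\<lambda>y. r) k = (if k = 0 then r else 0)" by (simp add: set_integral_ek)
    moreover have "fcoef (\<lambda>y. K1 y - K2 y) k = fcoef K1 k - fcoef K2 k" by (rule fcoef_diff[OF i1 m1 i2 m2])
    moreover have "fcoef (\<lambda>y. K1 y - K2 y - r) k = fcoef (\<lambda>y. K1 y - K2 y) k - fcoef (\<lambda>y. r) k"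
      by (rule fcoef_diff[OF i12 _ ic]) (use m1 m2 in measurable)
    ultimately show "fcoef (\<lambda>y. K1 y - K2 y - r) k = 0"
      using eq[of k] r by (cases "k = 0") auto
  qed
  then show ?thesis by (simp add: r_def)
qed

lemma countable_lat: "countable (range lat)"
  by simp

lemma conv_diff_const:
  assumes p1: "periodic K1" and i1: "set_integrable lborel Qcell K1" and p2: "periodic K2" and i2: "set_integrable lborel Qcell K2"
    and eq: "\<And>x. x \<notin> range lat \<Longrightarrow> K1 x - K2 x = r" and g: "periodic g" "continuous_on UNIV g"
  shows "conv K1 g x = conv K2 g x + r * (LINT y:Qcell|lborel. g y)"
proof -
  obtain B where B: "\<And>x. norm (g x) \<le> B" "B \<ge> 0" using periodic_continuous_bounded[OF g] by blast
  have mg[measurable]: "g \<in> borel_measurable borel" using g(2) by (rule borel_measurable_continuous_onI)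
  have int: "set_integrable lborel Qcell (\<lambda>y. K (x - y) * g y)" if K: "periodic K" "set_integrable lborel Qcell K" for K
  proof -
    note [measurable] = periodic_measurable[OF K]
    have i: "set_integrable lborel Qcell (\<lambda>y. K (x - y))" by (rule set_integrable_Qcell_shift(2)[OF periodic_measurable[OF K] K])
    show ?thesis unfolding set_integrable_def
    proof (rule Bochner_Integration.integrable_bound)
      show "integrable lborel (\<lambda>y. B *\<^sub>R (indicator Qcell y *\<^sub>R K (x - y)))"
        using i unfolding set_integrable_def by (rule integrable_scaleR_right)
      have "\<bar>K (x - y)\<bar> * \<bar>g y\<bar> \<le> \<bar>K (x - y)\<bar> * B" for y using B by (intro mult_left_mono) auto
      then show "AE y in lborel. norm (indicator Qcell y *\<^sub>R (K (x - y) * g y)) \<le> norm (B *\<^sub>R (indicator Qcell y *\<^sub>R K (x - y)))"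
        using B(2) by (intro AE_I2) (auto simp: indicator_def abs_mult mult.commute)
    qed measurable
  qed
  note [measurable] = periodic_measurable[OF p1 i1] periodic_measurable[OF p2 i2]
  have "conv K1 g x - conv K2 g x = (LINT y:Qcell|lborel. K1 (x - y) * g y - K2 (x - y) * g y)"
    unfolding conv_def by (rule set_integral_diff(2)[symmetric]) (intro int p1 i1 p2 i2)+
  also have "\<dots> = (LINT y:Qcell|lborel. r * g y)"
    unfolding set_lebesgue_integral_def
  proof (rule integral_cong_AE)
    \<comment> \<open>The points \<open>y\<close> at which a kernel is evaluated on the lattice form
      a countable, hence null, set.\<close>
    have "{y. x - y \<in> range lat} \<subseteq> (\<lambda>z. x - z) ` range lat" by (force simp: algebra_simps)
    then have "countable {y. x - y \<in> range lat}" using countable_subset countable_image countable_lat by metis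
    then have "AE y in lborel. y \<notin> {y. x - y \<in> range lat}"
      by (intro AE_not_in countable_imp_null_set_lborel)
    then show "AE y in lborel. indicator Qcell y *\<^sub>R (K1 (x - y) * g y - K2 (x - y) * g y) = indicator Qcell y *\<^sub>R (r * g y)"
    proof eventually_elim
      case (elim y)
      then show ?case using eq[of "x - y"] by (simp add: left_diff_distrib[symmetric])
    qed
  qed measurable
  finally show ?thesis by (simp add: set_integral_mult_right)
qed

text \<open>Both functions have the same set of derivatives, possibly empty, and
  \<open>deriv\<close> is a choice from that set. This covers convolutions whose differentiability
  is not at hand.\<close>

lemma deriv_add_const: "deriv (\<lambda>x. f x + c) a = deriv f a"
proof -
  have "((\<lambda>x. f x + c) has_field_derivative D) (at a) \<longleftrightarrow> (f has_field_derivative D) (at a)" for D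
    using DERIV_add[of f D a UNIV "\<lambda>_. c" 0] DERIV_add[of "\<lambda>x. f x + c" D a UNIV "\<lambda>_. - c" 0] by auto
  then show ?thesis unfolding deriv_def by simp
qed

lemma Rop_eq_of_const_diff:
  assumes "\<And>x. conv K1 g x = conv K2 g x + c"
  shows "Rop K1 g x = Rop K2 g x"
proof -
  have "conv K1 g = (\<lambda>x. conv K2 g x + c)" using assms by blast
  then show ?thesis unfolding Rop_def pd_def by (simp add: deriv_add_const)
qed

section \<open>Decay of Fourier coefficients\<close>

text \<open>The integral of \<open>w (x + t *\<^sub>R v)\<close> over the cell does not depend on \<open>t\<close>, so its derivative
in \<open>t\<close> vanishes. This replaces integration by parts.\<close>

lemma set_integral_directional_derivative:
  fixes w :: "pt \<Rightarrow> complex"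
  assumes pw: "periodic w" and cw: "continuous_on UNIV w" and pw': "periodic w'" and cw': "continuous_on UNIV w'"
    and d: "\<And>x. ((\<lambda>t. w (x + t *\<^sub>R v)) has_vector_derivative w' x) (at 0)"
  shows "(LINT x:Qcell|lborel. w' x) = 0"
proof -
  obtain B where B: "\<And>x. norm (w' x) \<le> B" "B \<ge> 0" using periodic_continuous_bounded[OF pw' cw'] by blast
  have mw[measurable]: "w \<in> borel_measurable borel" "w' \<in> borel_measurable borel" using cw cw' by (simp_all add: borel_measurable_continuous_onI)
  have iw: "set_integrable lborel Qcell w" using pw cw by (rule set_integrable_Qcell_continuous)
  have dt: "((\<lambda>t. w (x + t *\<^sub>R v)) has_vector_derivative w' (x + s *\<^sub>R v)) (at s)" for x s
  proof -
    have "((\<lambda>t. w ((x + s *\<^sub>R v) + t *\<^sub>R v)) has_vector_derivative w' (x + s *\<^sub>R v)) (at (s - s))" using d by simp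
    moreover have "((\<lambda>t. t - s) has_vector_derivative 1) (at s)" by (auto intro!: derivative_eq_intros)
    ultimately have "((\<lambda>t. w ((x + s *\<^sub>R v) + t *\<^sub>R v)) \<circ> (\<lambda>t. t - s) has_vector_derivative 1 *\<^sub>R w' (x + s *\<^sub>R v)) (at s)"
      using vector_diff_chain_at[of "\<lambda>t. t - s" 1 s] by blast
    then show ?thesis by (simp add: o_def algebra_simps)
  qed
  \<comment> \<open>The Lipschitz bound dominates the difference quotients, as dominated convergence
    requires.\<close>
  have lip: "norm (w (x + t *\<^sub>R v) - w x) \<le> B * t" if "t \<ge> 0" for x t
  proof -
    have "norm (w (x + t *\<^sub>R v) - w (x + 0 *\<^sub>R v)) \<le> B * norm (t - 0)"
    proof (rule differentiable_bound[of UNIV _ "\<lambda>s h. h *\<^sub>R w' (x + s *\<^sub>R v)"])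
      show "((\<lambda>t. w (x + t *\<^sub>R v)) has_derivative (\<lambda>h. h *\<^sub>R w' (x + s *\<^sub>R v))) (at s)" for s
        using dt[of x s] by (simp add: has_vector_derivative_def)
      show "onorm (\<lambda>h. h *\<^sub>R w' (x + s *\<^sub>R v)) \<le> B" for s
      proof (rule onorm_le)
        fix h :: real
        show "norm (h *\<^sub>R w' (x + s *\<^sub>R v)) \<le> B * norm h"
          using mult_left_mono[OF B(1)[of "x + s *\<^sub>R v"], of "\<bar>h\<bar>"] by (simp add: mult.commute)
      qed
    qed auto
    then show ?thesis using that by simp
  qed
  define e where "e n = inverse (real (Suc n))" for n
  have e: "e n > 0" for n by (simp add: e_def)
  let ?s = "\<lambda>n x. (1 / e n) *\<^sub>R (w (x + e n *\<^sub>R v) - w x)"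
  have z: "(LINT x:Qcell|lborel. ?s n x) = 0" for n
  proof -
    have sh: "set_integrable lborel Qcell (\<lambda>x. w (x + e n *\<^sub>R v))" by (rule set_integrable_Qcell_shift(1)[OF mw(1) pw iw])
    have "(LINT x:Qcell|lborel. ?s n x) = (1 / e n) *\<^sub>R (LINT x:Qcell|lborel. w (x + e n *\<^sub>R v) - w x)"
      by (rule set_integral_scaleR_right)
    also have "(LINT x:Qcell|lborel. w (x + e n *\<^sub>R v) - w x) = 0"
      using set_integral_Qcell_shift(1)[OF mw(1) pw iw, of "e n *\<^sub>R v"] set_integral_diff(2)[OF sh iw] by simp
    finally show ?thesis by simp
  qed
  have "(\<lambda>n. \<integral>x. indicator Qcell x *\<^sub>R ?s n x \<partial>lborel) \<longlonglongrightarrow> (\<integral>x. indicator Qcell x *\<^sub>R w' x \<partial>lborel)"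
  proof (rule integral_dominated_convergence[where w = "\<lambda>x. indicator Qcell x *\<^sub>R B"])
    show "integrable lborel (\<lambda>x. indicator Qcell x *\<^sub>R B)"
      using Qcell_measure by (intro integrable_scaleR_left) (auto simp: integrable_indicator_iff)
    show "AE x in lborel. (\<lambda>n. indicator Qcell x *\<^sub>R ?s n x) \<longlonglongrightarrow> indicator Qcell x *\<^sub>R w' x"
    proof (intro AE_I2 tendsto_intros)
      fix x
      have "((\<lambda>h. norm (w (x + (0 + h) *\<^sub>R v) - w (x + 0 *\<^sub>R v) - h *\<^sub>R w' x) / norm h) \<longlongrightarrow> 0) (at 0)"
        using d[of x] unfolding has_vector_derivative_def has_derivative_at by simp
      moreover have "filterlim e (at 0) sequentially"
        unfolding e_def using filterlim_atI[OF LIMSEQ_inverse_real_of_nat] by auto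
      ultimately have "(\<lambda>n. norm (w (x + (0 + e n) *\<^sub>R v) - w (x + 0 *\<^sub>R v) - e n *\<^sub>R w' x) / norm (e n)) \<longlonglongrightarrow> 0"
        by (rule filterlim_compose)
      moreover have "norm (w (x + (0 + e n) *\<^sub>R v) - w (x + 0 *\<^sub>R v) - e n *\<^sub>R w' x) / norm (e n) = norm (?s n x - w' x)" for n
      proof -
        have "?s n x - w' x = (1 / e n) *\<^sub>R (w (x + e n *\<^sub>R v) - w x - e n *\<^sub>R w' x)"
          using e[of n] by (simp add: algebra_simps)
        then show ?thesis using e[of n] by simp
      qed
      ultimately have "(\<lambda>n. norm (?s n x - w' x)) \<longlonglongrightarrow> 0" by simp
      then show "(\<lambda>n. ?s n x) \<longlonglongrightarrow> w' x" by (simp only: tendsto_norm_zero_iff LIM_zero_iff)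
    qed
    show "AE x in lborel. norm (indicator Qcell x *\<^sub>R ?s n x) \<le> indicator Qcell x *\<^sub>R B" for n
    proof (rule AE_I2)
      fix x
      have "norm (?s n x) = (1 / e n) * norm (w (x + e n *\<^sub>R v) - w x)" using e[of n] by simp
      also have "\<dots> \<le> (1 / e n) * (B * e n)" using e[of n] by (intro mult_left_mono lip) auto
      also have "\<dots> = B" using e[of n] by simp
      finally show "norm (indicator Qcell x *\<^sub>R ?s n x) \<le> indicator Qcell x *\<^sub>R B" by (simp add: indicator_def)
    qed
  qed measurable
  then have "(\<lambda>n. 0) \<longlonglongrightarrow> (LINT x:Qcell|lborel. w' x)" 
    using z unfolding set_lebesgue_integral_def by (simp only:)
  then show ?thesis using LIMSEQ_unique tendsto_const by blast
qed

section \<open>Differentiation on the Fourier side\<close>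

lemma pd_has_real_derivative:
  assumes "u differentiable (at x)"
  shows "((\<lambda>t. u (x + t *\<^sub>R v)) has_real_derivative pd v u x) (at 0)"
proof -
  obtain u' where u': "(u has_derivative u') (at x)" using assms unfolding differentiable_def by blast
  show ?thesis using has_derivative_directional[OF u', of v] by (simp add: pd_eqI[OF u'])
qed

lemma ek_has_vector_derivative: "((\<lambda>t. ek k (x + t *\<^sub>R v)) has_vector_derivative dsym v k * ek k x) (at 0)"
proof -
  have "((\<lambda>t. exp (dsym v k * t)) has_field_derivative dsym v k) (at (of_real 0))"
    by (auto intro!: derivative_eq_intros)
  then have "((\<lambda>t. exp (dsym v k * of_real t)) has_vector_derivative dsym v k) (at 0)"
    by (rule has_vector_derivative_real_field)
  then have "((\<lambda>t. ek k x * exp (dsym v k * of_real t)) has_vector_derivative ek k x * dsym v k) (at 0)"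
    by (rule has_vector_derivative_mult_right)
  moreover have "ek k x * exp (dsym v k * of_real t) = ek k (x + t *\<^sub>R v)" for t
    unfolding ek_add_right by (simp add: ek_def dsym_def cis_conv_exp ip_def algebra_simps)
  ultimately show ?thesis by (simp add: mult.commute)
qed

lemma pd_has_real_derivative_at:
  assumes "u differentiable (at (x + s *\<^sub>R v))"
  shows "((\<lambda>t. u (x + t *\<^sub>R v)) has_real_derivative pd v u (x + s *\<^sub>R v)) (at s)"
proof -
  have "((\<lambda>t. u ((x + s *\<^sub>R v) + t *\<^sub>R v)) has_real_derivative pd v u (x + s *\<^sub>R v)) (at 0)"
    by (rule pd_has_real_derivative[OF assms])
  then have "((\<lambda>t. u (x + (t + s) *\<^sub>R v)) has_real_derivative pd v u (x + s *\<^sub>R v)) (at 0)"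
    by (simp add: algebra_simps)
  then show ?thesis using DERIV_shift[of "\<lambda>t. u (x + t *\<^sub>R v)" _ 0 s] by simp
qed

lemma periodic_pd: "periodic u \<Longrightarrow> periodic (pd v u)"
proof -
  assume p: "periodic u"
  have "u (x + lat k + t *\<^sub>R v) = u (x + t *\<^sub>R v)" for x k t
    using periodicD[OF p, of "x + t *\<^sub>R v" k] by (simp add: algebra_simps)
  then show ?thesis unfolding periodic_def pd_def by simp
qed

text \<open>The product of \<open>u\<close> with the conjugate character has an integral of zero
  after differentiation. Since \<open>dsym v k\<close> is purely imaginary, the derivative of the
  character contributes the term with \<open>- dsym v k\<close>.\<close>

lemma fcoef_pd:
  assumes p: "periodic u" and d: "\<And>x. u differentiable (at x)" and c: "continuous_on UNIV (pd v u)"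
  shows "fcoef (pd v u) k = dsym v k * fcoef u k"
proof -
  have cu: "continuous_on UNIV u" by (rule differentiable_imp_continuous_on) (simp add: differentiable_on_def d)
  let ?w = "\<lambda>x. complex_of_real (u x) * cnj (ek k x)"
  let ?w' = "\<lambda>x. complex_of_real (pd v u x) * cnj (ek k x) - dsym v k * ?w x"
  have ek_per: "ek k (x + lat l) = ek k x" for x l by (rule periodicD[OF periodic_ek])
  have "(LINT x:Qcell|lborel. ?w' x) = 0"
  proof (rule set_integral_directional_derivative[of ?w])
    show "periodic ?w" "periodic ?w'" using p periodic_pd[OF p, of v] ek_per unfolding periodic_def by simp_all
    show "continuous_on UNIV ?w" "continuous_on UNIV ?w'" by (intro continuous_intros c cu)+
    fix x
    have 1: "((\<lambda>t. cnj (ek k (x + t *\<^sub>R v))) has_vector_derivative cnj (dsym v k * ek k x)) (at 0)"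
      by (rule bounded_linear.has_vector_derivative[OF bounded_linear_cnj ek_has_vector_derivative])
    have cd: "cnj (dsym v k) = - dsym v k" by (simp add: dsym_def)
    have 2: "((\<lambda>t. complex_of_real (u (x + t *\<^sub>R v))) has_vector_derivative complex_of_real (pd v u x)) (at 0)"
      by (rule has_vector_derivative_of_real[OF pd_has_real_derivative[OF d]])
    show "((\<lambda>t. ?w (x + t *\<^sub>R v)) has_vector_derivative ?w' x) (at 0)"
      using has_vector_derivative_mult[OF 2 1] by (simp add: cd algebra_simps)
  qed
  moreover have "set_integrable lborel Qcell (\<lambda>x. complex_of_real (pd v u x) * cnj (ek k x))" "set_integrable lborel Qcell ?w"
    using p periodic_pd[OF p, of v] ek_per unfolding periodic_def
    by (intro set_integrable_Qcell_continuous continuous_intros c cu; simp add: periodic_def)+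
  ultimately show ?thesis unfolding fcoef_ek by simp
qed

lemma smooth_on_differentiable: "smooth_on UNIV u \<Longrightarrow> set vs \<subseteq> Basis \<Longrightarrow> iter_pd vs u differentiable (at x)"
  unfolding smooth_on_def differentiable_on_def by auto

lemma smooth_on_continuous: "smooth_on UNIV u \<Longrightarrow> set vs \<subseteq> Basis \<Longrightarrow> continuous_on UNIV (iter_pd vs u)"
  unfolding smooth_on_def using differentiable_imp_continuous_on by blast

lemma periodic_iter_pd: "periodic u \<Longrightarrow> periodic (iter_pd vs u)"
  by (induction vs) (auto intro: periodic_pd)

lemma fcoef_iter_pd:
  assumes s: "smooth_on UNIV u" and p: "periodic u" and v: "v \<in> Basis"
  shows "fcoef (iter_pd (replicate n v) u) k = dsym v k ^ n * fcoef u k"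
proof (induction n)
  case (Suc n)
  have sub: "set (replicate m v) \<subseteq> Basis" for m using v by auto
  have "fcoef (pd v (iter_pd (replicate n v) u)) k = dsym v k * fcoef (iter_pd (replicate n v) u) k"
    by (rule fcoef_pd[OF periodic_iter_pd[OF p] smooth_on_differentiable[OF s sub]])
      (use smooth_on_continuous[OF s sub[of "Suc n"]] in simp)
  then show ?case using Suc by simp
qed simp

lemma Basis_pt: "(Basis :: pt set) = {(1, 0), (0, 1)}"
  by (auto simp: Basis_prod_def)

text \<open>Pure derivatives along the two axes are enough, because the larger coordinate of
  \<open>k\<close> controls \<open>jb k\<close> up to a constant. Decay of order \<open>N\<close> in
  \<open>jb\<close> takes \<open>2 * N\<close> derivatives.\<close>

lemma fcoef_dec:
  assumes s: "smooth_on UNIV u" and p: "periodic u"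
    and B: "\<And>v x. v \<in> {(1,0),(0,1)} \<Longrightarrow> \<bar>iter_pd (replicate (2 * N) v) u x\<bar> \<le> B" "\<And>x. \<bar>u x\<bar> \<le> B"
  shows "dec (real N) (3 ^ N * (3 * B)) (fcoef u)"
  unfolding dec_def
proof
  fix k
  have fb: "cmod (fcoef h k) \<le> B" if "continuous_on UNIV h" "\<And>x. \<bar>h x\<bar> \<le> B" for h
    unfolding fcoef_ek
  proof (rule set_integral_Qcell_norm_le)
    show "(\<lambda>x. complex_of_real (h x) * cnj (ek k x)) \<in> borel_measurable borel"
      by (intro borel_measurable_continuous_onI continuous_intros that)
  qed (use that in \<open>simp add: norm_mult\<close>)
  have b1: "cmod (dsym v k) ^ (2 * N) * cmod (fcoef u k) \<le> B" if v: "v \<in> {(1,0),(0,1)}" for v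
  proof -
    have vB: "v \<in> Basis" using v by (simp add: Basis_pt)
    have "cmod (fcoef (iter_pd (replicate (2 * N) v) u) k) \<le> B"
      by (rule fb[OF smooth_on_continuous[OF s] B(1)[OF v]]) (use vB in auto)
    then show ?thesis unfolding fcoef_iter_pd[OF s p vB] by (simp add: norm_mult norm_power)
  qed
  have b2: "cmod (fcoef u k) \<le> B" using fb[of u] B(2) smooth_on_continuous[OF s, of "[]"] by simp
  have le: "real_of_int a ^ (2 * N) \<le> cmod (2 * pi * \<i> * real_of_int a) ^ (2 * N)" for a :: int
  proof -
    have "1 * \<bar>real_of_int a\<bar> \<le> (2 * pi) * \<bar>real_of_int a\<bar>" using pi_gt3 by (intro mult_right_mono) auto
    then have "\<bar>real_of_int a\<bar> ^ (2 * N) \<le> cmod (2 * pi * \<i> * real_of_int a) ^ (2 * N)"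
      by (intro power_mono) (auto simp: norm_mult)
    then show ?thesis by (simp add: power_even_abs)
  qed
  define a b where "a = (real_of_int (fst k))\<^sup>2" and "b = (real_of_int (snd k))\<^sup>2"
  have ab: "a \<ge> 0" "b \<ge> 0" by (auto simp: a_def b_def)
  \<comment> \<open>Each of the three summands of \<open>jb k\<close> is at most the maximum, and
    the power of a maximum is bounded by the sum of the powers.\<close>
  have "jb k \<le> 3 * max 1 (max a b)" unfolding jb_def knorm_sq a_def[symmetric] b_def[symmetric] by (auto simp: max_def)
  then have "jb k ^ N \<le> (3 * max 1 (max a b)) ^ N" by (intro power_mono) auto
  also have "\<dots> \<le> 3 ^ N * (1 + a ^ N + b ^ N)"
    unfolding power_mult_distrib using ab by (intro mult_left_mono) (auto simp: max_def)
  finally have "jb k ^ N * cmod (fcoef u k) \<le> 3 ^ N * (1 + a ^ N + b ^ N) * cmod (fcoef u k)"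
    by (intro mult_right_mono) auto
  also have "\<dots> = 3 ^ N * (cmod (fcoef u k) + a ^ N * cmod (fcoef u k) + b ^ N * cmod (fcoef u k))" by (simp add: algebra_simps)
  also have "\<dots> \<le> 3 ^ N * (B + B + B)"
  proof (intro mult_left_mono add_mono b2)
    have "a ^ N * cmod (fcoef u k) \<le> cmod (dsym (1,0) k) ^ (2 * N) * cmod (fcoef u k)"
      using le[of "fst k"] by (intro mult_right_mono) (simp_all add: a_def dsym_def ip_def power_mult)
    also have "\<dots> \<le> B" by (rule b1) simp
    finally show "a ^ N * cmod (fcoef u k) \<le> B" .
    have "b ^ N * cmod (fcoef u k) \<le> cmod (dsym (0,1) k) ^ (2 * N) * cmod (fcoef u k)"
      using le[of "snd k"] by (intro mult_right_mono) (simp_all add: b_def dsym_def ip_def power_mult)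
    also have "\<dots> \<le> B" by (rule b1) simp
    finally show "b ^ N * cmod (fcoef u k) \<le> B" .
  qed simp
  finally show "cmod (fcoef u k) \<le> 3 ^ N * (3 * B) * jb k powr - real N"
    by (simp add: powr_minus powr_realpow field_simps)
qed

section \<open>Time slices of functions of space and time\<close>

lemma iter_pd_slice: "iter_pd (map (\<lambda>v. (v, 0)) vs) (\<phi> :: 'a::real_normed_vector \<times> real \<Rightarrow> real) (x, t) = iter_pd vs (\<lambda>x. \<phi> (x, t)) x"
proof (induction vs arbitrary: x)
  case (Cons v vs)
  then show ?case by (simp add: pd_def)
qed simp

lemma smooth_slice:
  fixes \<phi> :: "'a::euclidean_space \<times> real \<Rightarrow> real"
  assumes "smooth_on UNIV \<phi>"
  shows "smooth_on UNIV (\<lambda>x. \<phi> (x, t))"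
  unfolding smooth_on_def
proof (intro allI impI)
  fix vs :: "'a list" assume vs: "set vs \<subseteq> Basis"
  have "set (map (\<lambda>v. (v, 0::real)) vs) \<subseteq> Basis" using vs by (auto simp: Basis_prod_def)
  then have "iter_pd (map (\<lambda>v. (v, 0)) vs) \<phi> differentiable (at z)" for z
    by (rule smooth_on_differentiable[OF assms])
  then have "(\<lambda>x. iter_pd (map (\<lambda>v. (v, 0)) vs) \<phi> (x, t)) differentiable (at x)" for x
    using differentiable_chain_at[of "\<lambda>x. (x, t)" x "iter_pd (map (\<lambda>v. (v, 0)) vs) \<phi>"] 
    by (simp add: o_def differentiable_Pair)
  then show "iter_pd vs (\<lambda>x. \<phi> (x, t)) differentiable_on UNIV"
    unfolding iter_pd_slice differentiable_on_def by simp
qed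

text \<open>Compactness of the closed cell times the time interval. This is what makes the decay
  constants of the slices uniform in time.\<close>

lemma periodic_slice_bounded:
  fixes F :: "pt \<times> real \<Rightarrow> real"
  assumes "\<And>t. periodic (\<lambda>x. F (x, t))" "continuous_on UNIV F"
  obtains B where "\<And>x t. t \<in> {a..b} \<Longrightarrow> \<bar>F (x, t)\<bar> \<le> B"
proof -
  have "compact (F ` (cbox (-1/2, -1/2) (1/2, 1/2) \<times> {a..b}))"
    by (intro compact_continuous_image continuous_on_subset[OF assms(2)] compact_Times) auto
  then obtain B where B: "\<And>z. z \<in> cbox (-1/2, -1/2) (1/2, 1/2) \<times> {a..b} \<Longrightarrow> norm (F z) \<le> B"
    by (meson bounded_iff compact_imp_bounded imageI)
  have "\<bar>F (x, t)\<bar> \<le> B" if "t \<in> {a..b}" for x t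
  proof -
    obtain k where "x + lat k \<in> Qcell" using Qcell_shift_into by blast
    then have "(x + lat k, t) \<in> cbox (-1/2, -1/2) (1/2, 1/2) \<times> {a..b}" using that Qcell_subset_cbox by blast
    from B[OF this] show ?thesis using periodicD[OF assms(1)[of t], of x k] by simp
  qed
  then show ?thesis using that by blast
qed

lemma fcoef_slice_dec:
  fixes \<phi> :: "pt \<times> real \<Rightarrow> real"
  assumes s: "smooth_on UNIV \<phi>" and p: "\<And>t. periodic (\<lambda>x. \<phi> (x, t))"
  shows "\<exists>C. \<forall>t\<in>{a..b}. dec (real N) C (fcoef (\<lambda>x. \<phi> (x, t)))"
proof -
  have "\<exists>B. \<forall>x. \<forall>t\<in>{a..b}. \<bar>iter_pd vs (\<lambda>x. \<phi> (x, t)) x\<bar> \<le> B" if vs: "set vs \<subseteq> Basis" for vs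
  proof -
    have sub: "set (map (\<lambda>v. (v, 0::real)) vs) \<subseteq> Basis" using vs by (auto simp: Basis_prod_def)
    obtain B where "\<And>x t. t \<in> {a..b} \<Longrightarrow> \<bar>iter_pd (map (\<lambda>v. (v, 0)) vs) \<phi> (x, t)\<bar> \<le> B"
      by (rule periodic_slice_bounded[of "iter_pd (map (\<lambda>v. (v, 0)) vs) \<phi>" a b])
        (use smooth_on_continuous[OF s sub] periodic_iter_pd[OF p] in \<open>auto simp: iter_pd_slice\<close>)
    then show ?thesis unfolding iter_pd_slice by blast
  qed
  note bd = this
  have bs: "set (replicate m (1,0)) \<subseteq> (Basis :: pt set)" "set (replicate m (0,1)) \<subseteq> (Basis :: pt set)" for m
    by (auto simp: Basis_pt)
  obtain B1 where B1: "\<forall>x. \<forall>t\<in>{a..b}. \<bar>iter_pd (replicate (2 * N) (1, 0)) (\<lambda>x. \<phi> (x, t)) x\<bar> \<le> B1"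
    using bd[OF bs(1)] by blast
  obtain B2 where B2: "\<forall>x. \<forall>t\<in>{a..b}. \<bar>iter_pd (replicate (2 * N) (0, 1)) (\<lambda>x. \<phi> (x, t)) x\<bar> \<le> B2"
    using bd[OF bs(2)] by blast
  obtain B3 where B3: "\<forall>x. \<forall>t\<in>{a..b}. \<bar>\<phi> (x, t)\<bar> \<le> B3" using bd[of "[]"] by auto
  have "dec (real N) (3 ^ N * (3 * max B1 (max B2 B3))) (fcoef (\<lambda>x. \<phi> (x, t)))" if t: "t \<in> {a..b}" for t
  proof (rule fcoef_dec[OF smooth_slice[OF s] p])
    fix v :: pt and x :: pt
    assume "v \<in> {(1,0),(0,1)}"
    then show "\<bar>iter_pd (replicate (2 * N) v) (\<lambda>x. \<phi> (x, t)) x\<bar> \<le> max B1 (max B2 B3)"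
      using B1[rule_format, OF t, of x] B2[rule_format, OF t, of x] by (auto simp: le_max_iff_disj)
  next
    show "\<bar>\<phi> (x, t)\<bar> \<le> max B1 (max B2 B3)" for x using B3[rule_format, OF t, of x] by (auto simp: le_max_iff_disj)
  qed
  then show ?thesis by blast
qed

lemma rapid_fcoef:
  assumes s: "smooth_on UNIV u" and p: "periodic u"
  shows "rapid (fcoef u)"
  unfolding rapid_def
proof
  fix s' :: real
  obtain N where N: "s' \<le> real N" using real_arch_simple by blast
  have "\<exists>B. \<forall>x. \<bar>iter_pd vs u x\<bar> \<le> B" if "set vs \<subseteq> Basis" for vs
    using periodic_continuous_bounded[OF periodic_iter_pd[OF p] smooth_on_continuous[OF s that]] by (metis real_norm_def)
  note bd = this
  have bs: "set (replicate m (1,0)) \<subseteq> (Basis :: pt set)" "set (replicate m (0,1)) \<subseteq> (Basis :: pt set)" for m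
    by (auto simp: Basis_pt)
  obtain B1 where B1: "\<forall>x. \<bar>iter_pd (replicate (2 * N) (1, 0)) u x\<bar> \<le> B1"
    using bd[OF bs(1)] by blast
  obtain B2 where B2: "\<forall>x. \<bar>iter_pd (replicate (2 * N) (0, 1)) u x\<bar> \<le> B2"
    using bd[OF bs(2)] by blast
  obtain B3 where B3: "\<forall>x. \<bar>u x\<bar> \<le> B3" using bd[of "[]"] by auto
  have d: "dec (real N) (3 ^ N * (3 * max B1 (max B2 B3))) (fcoef u)"
  proof (rule fcoef_dec[OF s p])
    fix v :: pt and x :: pt
    assume "v \<in> {(1,0),(0,1)}"
    then show "\<bar>iter_pd (replicate (2 * N) v) u x\<bar> \<le> max B1 (max B2 B3)"
      using B1[rule_format, of x] B2[rule_format, of x] by (auto simp: le_max_iff_disj)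
  next
    show "\<bar>u x\<bar> \<le> max B1 (max B2 B3)" for x using B3[rule_format, of x] by (auto simp: le_max_iff_disj)
  qed
  show "\<exists>C. dec s' C (fcoef u)" using dec_mono[OF d order_refl N dec_nonneg[OF d]] by blast
qed

text \<open>The cell and its closure differ by a negligible set. The integral over a closed box is
  the form to which the Leibniz rule in \<open>fcoef_has_vector_derivative\<close> applies.\<close>

lemma set_integral_Qcell_eq_integral:
  fixes h :: "pt \<Rightarrow> complex"
  assumes "periodic h" "continuous_on UNIV h"
  shows "(LINT x:Qcell|lborel. h x) = integral (cbox (-1/2, -1/2) (1/2, 1/2)) h"
proof -
  have "(LINT x:Qcell|lborel. h x) = integral Qcell h"
    by (rule set_borel_integral_eq_integral(2)[OF set_integrable_Qcell_continuous[OF assms]])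
  also have "\<dots> = integral (cbox (-1/2, -1/2) (1/2, 1/2)) h"
  proof (rule integral_subset_negligible[OF Qcell_subset_cbox])
    have "negligible ({x::pt. x \<bullet> (1,0) = 1/2} \<union> {x. x \<bullet> (0,1) = 1/2})"
      by (intro negligible_Un negligible_standard_hyperplane) (auto simp: Basis_pt)
    then show "negligible (cbox (-1/2, -1/2) (1/2, 1/2) - Qcell)"
      by (rule negligible_subset) (auto simp: Qcell_def cbox_Pair_eq)
  qed
  finally show ?thesis .
qed

text \<open>Here \<open>(0, 1)\<close> is the time direction in space times time, its first entry
  being the zero of \<open>pt\<close>. Differentiation under the integral over the compact
  cell.\<close>

lemma fcoef_has_vector_derivative:
  fixes \<phi> :: "pt \<times> real \<Rightarrow> real"
  assumes s: "smooth_on UNIV \<phi>" and p: "\<And>t. periodic (\<lambda>x. \<phi> (x, t))"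
  shows "((\<lambda>t. fcoef (\<lambda>x. \<phi> (x, t)) k) has_vector_derivative fcoef (\<lambda>x. pd (0, 1) \<phi> (x, t)) k) (at t)"
proof -
  let ?\<psi> = "pd (0, 1) \<phi>"
  have b: "set [(0, 1) :: pt \<times> real] \<subseteq> Basis" by (simp add: Basis_prod_def)
  have c1: "continuous_on UNIV \<phi>" and c2: "continuous_on UNIV ?\<psi>"
    using smooth_on_continuous[OF s, of "[]"] smooth_on_continuous[OF s b] by simp_all
  have p2: "periodic (\<lambda>x. ?\<psi> (x, t))" for t
    using periodicD[OF p] unfolding periodic_def pd_def by simp
  have ek_per: "ek k (x + lat l) = ek k x" for x l by (rule periodicD[OF periodic_ek])
  have cs: "continuous_on UNIV (\<lambda>x. F (x, t))" if "continuous_on UNIV F" for F :: "pt \<times> real \<Rightarrow> real" and t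
    by (rule continuous_on_compose2[OF that]) (auto intro!: continuous_intros)
  have eq: "fcoef (\<lambda>x. F (x, t)) k = integral (cbox (-1/2, -1/2) (1/2, 1/2)) (\<lambda>x. complex_of_real (F (x, t)) * cnj (ek k x))"
    if "continuous_on UNIV F" "\<And>t. periodic (\<lambda>x. F (x, t))" for F :: "pt \<times> real \<Rightarrow> real" and t
    unfolding fcoef_ek
  proof (rule set_integral_Qcell_eq_integral)
    show "periodic (\<lambda>x. complex_of_real (F (x, t)) * cnj (ek k x))"
      using that(2)[of t] ek_per unfolding periodic_def by simp
    show "continuous_on UNIV (\<lambda>x. complex_of_real (F (x, t)) * cnj (ek k x))"
      by (intro continuous_intros cs[OF that(1)])
  qed
  show ?thesis unfolding eq[OF c1 p] eq[OF c2 p2]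
  proof (rule leibniz_rule_vector_derivative[where U = UNIV])
    fix t :: real and x :: pt
    have "\<phi> differentiable (at ((x, 0) + t *\<^sub>R (0, 1)))" using smooth_on_differentiable[OF s, of "[]"] by simp
    from pd_has_real_derivative_at[OF this]
    have "((\<lambda>t. \<phi> (x, t)) has_real_derivative ?\<psi> (x, t)) (at t)" by simp
    then show "((\<lambda>t. complex_of_real (\<phi> (x, t)) * cnj (ek k x)) has_vector_derivative complex_of_real (?\<psi> (x, t)) * cnj (ek k x)) (at t within UNIV)"
      by (intro has_vector_derivative_mult_left has_vector_derivative_of_real) simp
  next
    show "(\<lambda>x. complex_of_real (\<phi> (x, t)) * cnj (ek k x)) integrable_on cbox (- 1 / 2, - 1 / 2) (1 / 2, 1 / 2)" for t
    proof (rule integrable_continuous, rule continuous_on_subset)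
      show "continuous_on UNIV (\<lambda>x. complex_of_real (\<phi> (x, t)) * cnj (ek k x))"
        by (intro continuous_intros cs[OF c1])
    qed simp
    have "continuous_on UNIV (\<lambda>z. complex_of_real (?\<psi> (snd z, fst z)) * cnj (ek k (snd z)))"
      by (intro continuous_intros continuous_on_compose2[OF c2]) auto
    then show "continuous_on (UNIV \<times> cbox (- 1 / 2, - 1 / 2) (1 / 2, 1 / 2)) (\<lambda>(t, x). complex_of_real (?\<psi> (x, t)) * cnj (ek k x))"
      unfolding case_prod_unfold by (rule continuous_on_subset) simp
  qed auto
qed

section \<open>The Duhamel operator\<close>

lemma jb_neq_0 [simp]: "jb k \<noteq> 0"
  using jb_pos[of k] by linarith

text \<open>Variation of constants: the solution of \<open>c' = h - l c\<close> with value 0 at time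
  0.\<close>

definition duh :: "real \<Rightarrow> (real \<Rightarrow> complex) \<Rightarrow> real \<Rightarrow> complex" where
  "duh l h t = exp (- l * t) *\<^sub>R integral {0..t} (\<lambda>s. exp (l * s) *\<^sub>R h s)"

lemma duh_0 [simp]: "duh l h 0 = 0"
  by (simp add: duh_def)

lemma duh_derivative:
  assumes h: "continuous_on {0..T} h" and t: "t \<in> {0..T}"
  shows "(duh l h has_vector_derivative (h t - l *\<^sub>R duh l h t)) (at t within {0..T})"
proof -
  have 1: "((\<lambda>u. integral {0..u} (\<lambda>s. exp (l * s) *\<^sub>R h s)) has_vector_derivative exp (l * t) *\<^sub>R h t) (at t within {0..T})"
    by (rule integral_has_vector_derivative[OF _ t]) (intro continuous_intros h)
  have 2: "((\<lambda>t. exp (- l * t)) has_real_derivative - l * exp (- l * t)) (at t within {0..T})"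
    by (auto intro!: derivative_eq_intros)
  have e: "exp (- l * t) * exp (l * t) = 1" by (simp flip: exp_add)
  show ?thesis
    using has_vector_derivative_scaleR[OF 2 1] e unfolding duh_def[abs_def] by (simp add: algebra_simps)
qed

lemma duh_continuous: "continuous_on {0..T} h \<Longrightarrow> continuous_on {0..T} (duh l h)"
  by (rule continuous_on_vector_derivative[OF duh_derivative])

lemma duh_cong: assumes "\<And>s. s \<in> {0..t} \<Longrightarrow> h s = h' s" shows "duh l h t = duh l h' t"
proof -
  have "integral {0..t} (\<lambda>s. exp (l * s) *\<^sub>R h s) = integral {0..t} (\<lambda>s. exp (l * s) *\<^sub>R h' s)"
    by (rule Henstock_Kurzweil_Integration.integral_cong) (use assms in simp)
  then show ?thesis by (simp add: duh_def)
qed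

lemma duh_diff:
  assumes "continuous_on {0..T} h" "continuous_on {0..T} h'" "t \<in> {0..T}"
  shows "duh l (\<lambda>s. h s - h' s) t = duh l h t - duh l h' t"
proof -
  have "(\<lambda>s. exp (l * s) *\<^sub>R g s) integrable_on {0..t}" if "continuous_on {0..T} g" for g :: "real \<Rightarrow> complex"
    by (intro integrable_continuous_real continuous_intros continuous_on_subset[OF that]) (use assms in auto)
  then show ?thesis unfolding duh_def using assms
    by (simp add: scaleR_diff_right Henstock_Kurzweil_Integration.integral_diff)
qed

lemma duh_cnj:
  assumes "continuous_on {0..T} h" "t \<in> {0..T}"
  shows "duh l (\<lambda>s. cnj (h s)) t = cnj (duh l h t)"
proof -
  have "(\<lambda>s. exp (l * s) *\<^sub>R h s) integrable_on {0..t}"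
    by (intro integrable_continuous_real continuous_intros continuous_on_subset[OF assms(1)]) (use assms in auto)
  from integral_linear[OF this bounded_linear_cnj]
  show ?thesis unfolding duh_def by (simp add: o_def)
qed

text \<open>The bound \<open>B / l\<close> is the smoothing of the heat flow, which later absorbs
  the lost derivative. The bound \<open>B * T\<close> covers the mode with \<open>l = 0\<close> and
  suffices for the source term.\<close>

lemma duh_bound:
  assumes h: "continuous_on {0..T} h" and t: "t \<in> {0..T}" and B: "\<And>s. s \<in> {0..T} \<Longrightarrow> cmod (h s) \<le> B"
  shows "l \<ge> 0 \<Longrightarrow> cmod (duh l h t) \<le> B * T" "l > 0 \<Longrightarrow> cmod (duh l h t) \<le> B / l"
proof -
  have t0: "0 \<le> t" "t \<le> T" using t by auto
  have B0: "B \<ge> 0" using B[OF t] norm_ge_zero order_trans by blast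
  have ci: "(\<lambda>s. exp (l * s) *\<^sub>R h s) integrable_on {0..t}"
    by (intro integrable_continuous_real continuous_intros continuous_on_subset[OF h]) (use t0 in auto)
  have le: "norm (exp (l * s) *\<^sub>R h s) \<le> exp (l * s) * B" if "s \<in> {0..t}" for s
    using B[of s] that t0 by simp
  have "cmod (duh l h t) = exp (- l * t) * norm (integral {0..t} (\<lambda>s. exp (l * s) *\<^sub>R h s))"
    by (simp add: duh_def)
  note eq = this
  { assume l: "l > 0"
    have I: "((\<lambda>s. exp (l * s) * B) has_integral (exp (l * t) * B / l - exp (l * 0) * B / l)) {0..t}"
      by (rule fundamental_theorem_of_calculus)
        (use t0 l in \<open>auto intro!: derivative_eq_intros simp flip: has_real_derivative_iff_has_vector_derivative\<close>)
    have "norm (integral {0..t} (\<lambda>s. exp (l * s) *\<^sub>R h s)) \<le> integral {0..t} (\<lambda>s. exp (l * s) * B)"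
      by (rule Henstock_Kurzweil_Integration.integral_norm_bound_integral[OF ci _ le]) (use I in blast)
    also have "\<dots> = exp (l * t) * B / l - B / l" using integral_unique[OF I] by simp
    also have "\<dots> \<le> exp (l * t) * (B / l)" using B0 l by simp
    finally have "cmod (duh l h t) \<le> exp (- l * t) * (exp (l * t) * (B / l))"
      unfolding eq by (intro mult_left_mono) auto
    then show "cmod (duh l h t) \<le> B / l" by (simp flip: mult.assoc exp_add) }
  { assume l: "l \<ge> 0"
    have le': "norm (exp (l * s) *\<^sub>R h s) \<le> exp (l * t) * B" if s: "s \<in> {0..t}" for s
    proof -
      have "exp (l * s) * B \<le> exp (l * t) * B" using s l B0 by (intro mult_right_mono) (auto intro: mult_left_mono)
      then show ?thesis using le[OF s] by linarith
    qed
    have "norm (integral {0..t} (\<lambda>s. exp (l * s) *\<^sub>R h s)) \<le> integral {0..t} (\<lambda>s. exp (l * t) * B)"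
      by (rule Henstock_Kurzweil_Integration.integral_norm_bound_integral[OF ci _ le']) auto
    also have "\<dots> = exp (l * t) * (B * t)" using t0 by simp
    finally have "cmod (duh l h t) \<le> exp (- l * t) * (exp (l * t) * (B * t))"
      unfolding eq by (intro mult_left_mono) auto
    then have "cmod (duh l h t) \<le> B * t" by (simp flip: mult.assoc exp_add)
    also have "\<dots> \<le> B * T" using t0 B0 by (intro mult_left_mono)
    finally show "cmod (duh l h t) \<le> B * T" . }
qed

section \<open>Fixed point for the Fourier coefficients\<close>

text \<open>The index set is discrete, so a family of continuous functions of time is one continuous
  function of index and time. A whole coefficient family thereby becomes a single element of a space
  of bounded continuous functions.\<close>

lemma continuous_on_index_times:
  fixes f :: "(int \<times> int) \<times> 'a::topological_space \<Rightarrow> 'b::topological_space"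
  assumes "\<And>k. continuous_on UNIV (\<lambda>t. f (k, t))"
  shows "continuous_on UNIV f"
proof -
  have "continuous_on (\<Union>k\<in>UNIV. {k} \<times> UNIV) f"
  proof (rule continuous_on_open_UN)
    fix k :: "int \<times> int"
    have "open ({fst k} \<times> {snd k})" by (intro open_Times open_discrete)
    then show "open ({k} \<times> (UNIV :: 'a set))" by (simp add: open_Times)
    have "continuous_on ({k} \<times> UNIV) (\<lambda>z. f (k, snd z))"
      by (rule continuous_on_compose2[OF assms]) (auto intro!: continuous_intros)
    then show "continuous_on ({k} \<times> UNIV) f"
      by (rule continuous_on_eq) auto
  qed
  moreover have "(\<Union>k\<in>UNIV. {k} \<times> UNIV) = (UNIV :: ((int \<times> int) \<times> 'a) set)" by auto
  ultimately show ?thesis by simp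
qed

lemma continuous_apply_bcontfun: "continuous_on UNIV (\<lambda>F. apply_bcontfun F z)"
proof (rule continuous_onI)
  fix F e assume "(e::real) > 0"
  then show "\<exists>d>0. \<forall>F'\<in>UNIV. dist F' F < d \<longrightarrow> dist (apply_bcontfun F' z) (apply_bcontfun F z) \<le> e"
    by (intro exI[of _ e]) (meson dist_bounded less_imp_le order_trans)
qed

text \<open>The library has the completeness of \<open>bcontfun\<close> only over metric domains, and the type of
integers carries no metric.\<close>

lemma complete_closed_bcontfun:
  fixes X :: "('a::topological_space \<Rightarrow>\<^sub>C 'b::complete_space) set"
  assumes "closed X"
  shows "complete X"
proof (rule completeI)
  fix f assume f: "\<forall>n. f n \<in> X" and C: "Cauchy f"
  have "\<forall>e>0. \<exists>N. \<forall>m n x. N \<le> m \<and> N \<le> n \<and> True \<longrightarrow> dist (apply_bcontfun (f m) x) (apply_bcontfun (f n) x) < e"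
    using C unfolding Cauchy_def by (meson dist_bounded le_less_trans)
  then obtain g where "\<forall>e>0. \<exists>N. \<forall>n x. N \<le> n \<and> True \<longrightarrow> dist (apply_bcontfun (f n) x) (g x) < e"
    unfolding uniformly_convergent_eq_cauchy[symmetric] by blast
  then have "uniform_limit UNIV (\<lambda>n. apply_bcontfun (f n)) g sequentially"
    unfolding uniform_limit_sequentially_iff by blast
  from uniform_limit_bcontfunE[OF this] obtain l where "f \<longlonglongrightarrow> l" by auto
  moreover have "l \<in> X" using closed_sequentially[OF assms _ \<open>f \<longlonglongrightarrow> l\<close>] f by blast
  ultimately show "\<exists>l\<in>X. f \<longlonglongrightarrow> l" by blast
qed

lemma continuous_infsum:
  fixes f :: "'i \<Rightarrow> 'a::topological_space \<Rightarrow> complex"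
  assumes "\<And>i. continuous_on S (f i)" "\<And>i t. t \<in> S \<Longrightarrow> cmod (f i t) \<le> M i" "M summable_on UNIV"
  shows "continuous_on S (\<lambda>t. \<Sum>\<^sub>\<infinity>i. f i t)"
proof (rule uniform_limit_theorem)
  show "uniform_limit S (\<lambda>X t. \<Sum>i\<in>X. f i t) (\<lambda>t. \<Sum>\<^sub>\<infinity>i. f i t) (finite_subsets_at_top UNIV)"
    by (rule Weierstrass_m_test_general[OF _ assms(3)]) (auto simp: assms)
  show "\<forall>\<^sub>F X in finite_subsets_at_top UNIV. continuous_on S (\<lambda>t. \<Sum>i\<in>X. f i t)"
    by (intro always_eventually allI continuous_intros assms)
qed simp

text \<open>A quadratic system of modes with decay rates \<open>lam\<close> and interaction symbol
  \<open>sig\<close>. The symbol costs a factor \<open>knorm k\<close>; by \<open>lam_gain\<close>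
  division by \<open>lam k\<close> repays it and leaves the surplus
  \<open>jb k powr (- \<delta>)\<close>. The two conditions on \<open>- k\<close> preserve the
  symmetry of coefficients of real functions.\<close>

locale duhamel_system =
  fixes lam :: "int \<times> int \<Rightarrow> real" and sig :: "int \<times> int \<Rightarrow> int \<times> int \<Rightarrow> complex" and T S G \<delta> :: real
  assumes T: "T > 0" and S: "S \<ge> 0" and G: "G \<ge> 0" and \<delta>: "\<delta> > 0"
    and lam_nonneg: "\<And>k. lam k \<ge> 0" and lam_uminus: "\<And>k. lam (- k) = lam k"
    and lam_gain: "\<And>k. k \<noteq> 0 \<Longrightarrow> knorm k \<le> G * jb k powr (- \<delta>) * lam k"
    and sig_bound: "\<And>k l. cmod (sig k l) \<le> S * knorm k" and sig_uminus: "\<And>k l. sig (- k) (- l) = cnj (sig k l)"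
begin

text \<open>Kept bilinear, so that a difference of two quadratic terms splits into terms linear in
  the difference.\<close>

definition Nl :: "(int \<times> int \<Rightarrow> real \<Rightarrow> complex) \<Rightarrow> (int \<times> int \<Rightarrow> real \<Rightarrow> complex) \<Rightarrow> int \<times> int \<Rightarrow> real \<Rightarrow> complex" where
  "Nl c d k s = (\<Sum>\<^sub>\<infinity>l. sig k l * c l s * d (k - l) s)"

text \<open>Clamping time to \<open>[0, T]\<close> lets the coefficients be functions on the whole real line.\<close>

definition cl :: "real \<Rightarrow> real" where
  "cl t = max 0 (min T t)"

definition Cv :: "real \<Rightarrow> real" where
  "Cv s = 4 powr s * 2 * (\<Sum>\<^sub>\<infinity>l. jb l powr (- 2))"

lemma Cv_nonneg: "Cv s \<ge> 0"
  unfolding Cv_def by (intro mult_nonneg_nonneg infsum_nonneg) auto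

lemma cl_in: "cl t \<in> {0..T}" and cl_id: "t \<in> {0..T} \<Longrightarrow> cl t = t"
  using T by (auto simp: cl_def)

lemma continuous_cl: "continuous_on UNIV cl"
  unfolding cl_def[abs_def] by (intro continuous_intros)

lemma lam_pos: "k \<noteq> 0 \<Longrightarrow> lam k > 0"
  using lam_gain[of k] knorm_ge1[of k] lam_nonneg[of k] by (cases "lam k = 0") auto

lemma Nl_summable:
  assumes "s \<ge> 2" "\<And>l. cmod (c l t) \<le> M * jb l powr (- s)" "\<And>l. cmod (d l t) \<le> M' * jb l powr (- s)"
  shows "(\<lambda>l. cmod (sig k l * c l t * d (k - l) t)) summable_on UNIV"
    "cmod (sig k l * c l t * d (k - l) t) \<le> S * knorm k * M * M' * (jb l powr (- s) * jb (k - l) powr (- s))"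
    "cmod (Nl c d k t) \<le> S * knorm k * M * M' * Cv s * jb k powr (- s)"
proof -
  have M: "M \<ge> 0" "M' \<ge> 0"
    using dec_nonneg[of s M "\<lambda>l. c l t"] dec_nonneg[of s M' "\<lambda>l. d l t"] assms by (simp_all add: dec_def)
  have b: "cmod (sig k l * c l t * d (k - l) t) \<le> S * knorm k * M * M' * (jb l powr (- s) * jb (k - l) powr (- s))" for l
  proof -
    have "cmod (sig k l) * cmod (c l t) * cmod (d (k - l) t) \<le> (S * knorm k) * (M * jb l powr (- s)) * (M' * jb (k - l) powr (- s))"
      using S M by (intro mult_mono sig_bound assms mult_nonneg_nonneg) auto
    then show ?thesis by (simp add: norm_mult mult_ac)
  qed
  then show "cmod (sig k l * c l t * d (k - l) t) \<le> S * knorm k * M * M' * (jb l powr (- s) * jb (k - l) powr (- s))" .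
  have sm: "(\<lambda>l. S * knorm k * M * M' * (jb l powr (- s) * jb (k - l) powr (- s))) summable_on UNIV"
    by (intro summable_on_cmult_right conv_weight_sum(1) assms)
  show s: "(\<lambda>l. cmod (sig k l * c l t * d (k - l) t)) summable_on UNIV"
    by (rule summable_on_comparison_test[OF sm b]) auto
  have "cmod (Nl c d k t) \<le> (\<Sum>\<^sub>\<infinity>l. cmod (sig k l * c l t * d (k - l) t))"
    unfolding Nl_def by (rule norm_infsum_bound) (rule s)
  also have "\<dots> \<le> (\<Sum>\<^sub>\<infinity>l. S * knorm k * M * M' * (jb l powr (- s) * jb (k - l) powr (- s)))"
    by (rule infsum_mono[OF s sm b])
  also have "\<dots> = S * knorm k * M * M' * (\<Sum>\<^sub>\<infinity>l. (jb l powr (- s) * jb (k - l) powr (- s)))"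
    by (rule infsum_cmult_right')
  also have "\<dots> \<le> S * knorm k * M * M' * (Cv s * jb k powr (- s))"
    unfolding Cv_def using S M by (intro mult_left_mono conv_weight_sum(2) assms) auto
  finally show "cmod (Nl c d k t) \<le> S * knorm k * M * M' * Cv s * jb k powr (- s)" by (simp add: mult_ac)
qed

lemma Nl_continuous:
  assumes "s \<ge> 2" "\<And>l t. t \<in> A \<Longrightarrow> cmod (c l t) \<le> M * jb l powr (- s)" "\<And>l t. t \<in> A \<Longrightarrow> cmod (d l t) \<le> M' * jb l powr (- s)"
    "\<And>l. continuous_on A (c l)" "\<And>l. continuous_on A (d l)"
  shows "continuous_on A (Nl c d k)"
  unfolding Nl_def[abs_def]
proof (rule continuous_infsum)
  show "continuous_on A (\<lambda>t. sig k l * c l t * d (k - l) t)" for l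
    by (intro continuous_intros assms)
  show "(\<lambda>l. S * knorm k * M * M' * (jb l powr (- s) * jb (k - l) powr (- s))) summable_on UNIV"
    by (intro summable_on_cmult_right conv_weight_sum(1) assms)
  show "cmod (sig k l * c l t * d (k - l) t) \<le> S * knorm k * M * M' * (jb l powr (- s) * jb (k - l) powr (- s))" if "t \<in> A" for l t
    by (rule Nl_summable(2)[OF assms(1)]) (use assms that in auto)
qed

text \<open>The estimate behind both contraction and regularity: the factor \<open>knorm k\<close>
  from \<open>sig\<close> is paid by \<open>1 / lam k\<close>, and the surplus raises the order of
  decay from \<open>s\<close> to \<open>s + \<delta>\<close>.\<close>

lemma duh_Nl_bound:
  assumes "s \<ge> 2" "\<And>l t. t \<in> {0..T} \<Longrightarrow> cmod (c l t) \<le> M * jb l powr (- s)" "\<And>l t. t \<in> {0..T} \<Longrightarrow> cmod (d l t) \<le> M' * jb l powr (- s)"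
    "\<And>l. continuous_on {0..T} (c l)" "\<And>l. continuous_on {0..T} (d l)" "t \<in> {0..T}"
  shows "cmod (duh (lam k) (Nl c d k) t) \<le> S * G * Cv s * M * M' * jb k powr (- (s + \<delta>))"
proof -
  have M: "M \<ge> 0" "M' \<ge> 0"
    using dec_nonneg[of s M "\<lambda>l. c l t"] dec_nonneg[of s M' "\<lambda>l. d l t"] assms by (simp_all add: dec_def)
  have cN: "continuous_on {0..T} (Nl c d k)" by (rule Nl_continuous[OF assms(1-5)])
  have b: "cmod (Nl c d k t) \<le> S * knorm k * M * M' * Cv s * jb k powr (- s)" if "t \<in> {0..T}" for t
    by (rule Nl_summable(3)[OF assms(1)]) (use assms that in auto)
  have nn: "0 \<le> S * M * M' * Cv s * jb k powr (- s)" using S M Cv_nonneg[of s] by simp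
  show ?thesis
  proof (cases "k = 0")
    \<comment> \<open>At frequency zero there is no decay to use, but the bound on the interaction
      carries the factor \<open>knorm 0 = 0\<close>.\<close>
    case True
    have "cmod (duh (lam k) (Nl c d k) t) \<le> (S * knorm k * M * M' * Cv s * jb k powr (- s)) * T"
      by (rule duh_bound(1)[OF cN assms(6) b lam_nonneg])
    also have "\<dots> = 0" using True by simp
    also have "0 \<le> S * G * Cv s * M * M' * jb k powr (- (s + \<delta>))" using S G M Cv_nonneg[of s] by simp
    finally show ?thesis .
  next
    case False
    have l: "lam k > 0" by (rule lam_pos[OF False])
    have "cmod (duh (lam k) (Nl c d k) t) \<le> (S * knorm k * M * M' * Cv s * jb k powr (- s)) / lam k"
      by (rule duh_bound(2)[OF cN assms(6) b l])
    also have "\<dots> = (S * M * M' * Cv s * jb k powr (- s)) * (knorm k / lam k)" by simp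
    also have "\<dots> \<le> (S * M * M' * Cv s * jb k powr (- s)) * (G * jb k powr (- \<delta>))"
      using lam_gain[OF False] l by (intro mult_left_mono nn) (simp add: divide_le_eq)
    also have "\<dots> = S * G * Cv s * M * M' * jb k powr (- (s + \<delta>))"
      by (simp add: powr_diff powr_minus field_simps powr_add)
    finally show ?thesis .
  qed
qed

lemma duh_Nl_bound2:
  assumes "\<And>l t. t \<in> {0..T} \<Longrightarrow> cmod (c l t) \<le> M * jb l powr (- 2)" "\<And>l t. t \<in> {0..T} \<Longrightarrow> cmod (d l t) \<le> M' * jb l powr (- 2)"
    "\<And>l. continuous_on {0..T} (c l)" "\<And>l. continuous_on {0..T} (d l)" "t \<in> {0..T}"
  shows "cmod (duh (lam k) (Nl c d k) t) \<le> S * G * Cv 2 * M * M' * jb k powr (- 2)"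
proof -
  have M: "M \<ge> 0" "M' \<ge> 0"
    using dec_nonneg[of 2 M "\<lambda>l. c l t"] dec_nonneg[of 2 M' "\<lambda>l. d l t"] assms by (simp_all add: dec_def)
  have "cmod (duh (lam k) (Nl c d k) t) \<le> S * G * Cv 2 * M * M' * jb k powr (- (2 + \<delta>))"
    by (rule duh_Nl_bound) (use assms in auto)
  also have "\<dots> \<le> S * G * Cv 2 * M * M' * jb k powr (- 2)"
    using S G M Cv_nonneg[of 2] \<delta> jb_ge1[of k] by (intro mult_left_mono powr_mono) auto
  finally show ?thesis .
qed

lemma Nl_diff:
  assumes "s \<ge> 2" "\<And>l. cmod (c l t) \<le> M * jb l powr (- s)" "\<And>l. cmod (d l t) \<le> M' * jb l powr (- s)"
  shows "Nl c c k t - Nl d d k t = Nl (\<lambda>l t. c l t - d l t) c k t + Nl d (\<lambda>l t. c l t - d l t) k t"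
proof -
  have a: "(\<lambda>l. sig k l * c l t * c (k - l) t) summable_on UNIV" by (rule abs_summable_summable[OF Nl_summable(1)[of s c t M c M, OF assms(1,2,2)]])
  have b: "(\<lambda>l. sig k l * d l t * d (k - l) t) summable_on UNIV" by (rule abs_summable_summable[OF Nl_summable(1)[of s d t M' d M', OF assms(1,3,3)]])
  have e: "(\<lambda>l. sig k l * d l t * c (k - l) t) summable_on UNIV" by (rule abs_summable_summable[OF Nl_summable(1)[of s d t M' c M, OF assms(1,3,2)]])
  have "Nl (\<lambda>l t. c l t - d l t) c k t = Nl c c k t + - (\<Sum>\<^sub>\<infinity>l. sig k l * d l t * c (k - l) t)"
    unfolding Nl_def infsum_uminus[symmetric]
    by (subst infsum_add[symmetric]) (use a e in \<open>auto simp: summable_on_uminus algebra_simps\<close>)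
  moreover have "Nl d (\<lambda>l t. c l t - d l t) k t = (\<Sum>\<^sub>\<infinity>l. sig k l * d l t * c (k - l) t) + - Nl d d k t"
    unfolding Nl_def infsum_uminus[symmetric]
    by (subst infsum_add[symmetric]) (use b e in \<open>auto simp: summable_on_uminus algebra_simps\<close>)
  ultimately show ?thesis by simp
qed

lemma Nl_herm:
  assumes "herm (\<lambda>k. c k t)" "herm (\<lambda>k. d k t)"
  shows "Nl c d (- k) t = cnj (Nl c d k t)"
proof -
  have "Nl c d (- k) t = (\<Sum>\<^sub>\<infinity>l. sig (- k) (- l) * c (- l) t * d (- k - (- l)) t)"
    unfolding Nl_def by (rule infsum_uminus_index[symmetric])
  also have "\<dots> = (\<Sum>\<^sub>\<infinity>l. cnj (sig k l * c l t * d (k - l) t))"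
  proof (rule infsum_cong)
    fix l
    have "d (- k - (- l)) t = cnj (d (k - l) t)" using assms(2) unfolding herm_def by (metis minus_diff_minus)
    moreover have "c (- l) t = cnj (c l t)" using assms(1) unfolding herm_def by blast
    ultimately show "sig (- k) (- l) * c (- l) t * d (- k - (- l)) t = cnj (sig k l * c l t * d (k - l) t)"
      by (simp add: sig_uminus)
  qed
  finally show ?thesis unfolding Nl_def by (simp only: infsum_cnj)
qed

lemma Nl_lipschitz:
  assumes c: "\<And>l t. t \<in> {0..T} \<Longrightarrow> cmod (c l t) \<le> M * jb l powr (- 2)" and d: "\<And>l t. t \<in> {0..T} \<Longrightarrow> cmod (d l t) \<le> M * jb l powr (- 2)"
    and cd: "\<And>l t. t \<in> {0..T} \<Longrightarrow> cmod (c l t - d l t) \<le> D * jb l powr (- 2)"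
    and cc: "\<And>l. continuous_on {0..T} (c l)" and cont_d: "\<And>l. continuous_on {0..T} (d l)" and t: "t \<in> {0..T}"
  shows "cmod (duh (lam k) (Nl c c k) t - duh (lam k) (Nl d d k) t) \<le> 2 * (S * G * Cv 2) * M * D * jb k powr (- 2)"
proof -
  let ?e = "\<lambda>l t. c l t - d l t"
  have ce: "continuous_on {0..T} (?e l)" for l by (intro continuous_intros cc cont_d)
  have two: "(2::real) \<le> 2" by simp
  note C = Nl_continuous[of 2 "{0..T}", OF two]
  note C1 = C[of c M c M, OF c c cc cc] and C2 = C[of d M d M, OF d d cont_d cont_d]
    and C3 = C[of ?e D c M, OF cd c ce cc] and C4 = C[of d M ?e D, OF d cd cont_d ce]
  \<comment> \<open>The sum of \<open>Nl_diff\<close> is written as a difference with a negated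
    term, the form that \<open>duh_diff\<close> handles.\<close>
  have eq: "Nl c c k s - Nl d d k s = Nl ?e c k s - - Nl d ?e k s" if "s \<in> {0..T}" for s
    using Nl_diff[of 2 c s M d M, OF two c[OF that] d[OF that]] by simp
  have "duh (lam k) (Nl c c k) t - duh (lam k) (Nl d d k) t = duh (lam k) (\<lambda>s. Nl c c k s - Nl d d k s) t"
    by (rule duh_diff[symmetric, OF C1 C2 t])
  also have "\<dots> = duh (lam k) (\<lambda>s. Nl ?e c k s - - Nl d ?e k s) t"
    by (rule duh_cong) (use eq t in auto)
  also have "\<dots> = duh (lam k) (Nl ?e c k) t - duh (lam k) (\<lambda>s. - Nl d ?e k s) t"
    by (rule duh_diff[OF C3 continuous_on_minus[OF C4] t])
  also have "duh (lam k) (\<lambda>s. - Nl d ?e k s) t = - duh (lam k) (Nl d ?e k) t"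
    by (simp add: duh_def)
  finally have "cmod (duh (lam k) (Nl c c k) t - duh (lam k) (Nl d d k) t)
      \<le> cmod (duh (lam k) (Nl ?e c k) t) + cmod (duh (lam k) (Nl d ?e k) t)"
    by (simp add: norm_triangle_ineq)
  also have "\<dots> \<le> S * G * Cv 2 * D * M * jb k powr (- 2) + S * G * Cv 2 * M * D * jb k powr (- 2)"
    by (intro add_mono duh_Nl_bound2 c d cd cc cont_d ce t)
  finally show ?thesis by (simp add: mult_ac)
qed

text \<open>The bound of the bilinear Duhamel operator in the norm of \<open>dec 2\<close>, as given
  by \<open>duh_Nl_bound2\<close>.\<close>

definition Q :: real where "Q = S * G * Cv 2"

lemma Q_nonneg: "Q \<ge> 0"
  unfolding Q_def using S G Cv_nonneg[of 2] by simp

lemma jb_cancel: "cmod w \<le> r * jb k powr (- 2) \<longleftrightarrow> cmod (jb k powr 2 *\<^sub>R w) \<le> r"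
proof -
  have "jb k \<noteq> 0" using jb_pos[of k] by linarith
  then show ?thesis by (simp add: powr_minus field_simps)
qed

text \<open>Contraction on the ball of radius \<open>r = 2 * A * T\<close>. The source contributes
  at most \<open>r / 2\<close>, the quadratic term at most \<open>Q * r * r \<le> r / 4\<close>, and
  the Lipschitz constant is \<open>2 * Q * r \<le> 1/2\<close>; the last two are exactly the
  smallness assumption.\<close>

lemma fixpoint_exists:
  assumes gc: "\<And>k. continuous_on {0..T} (g k)" and gb: "\<And>k s. s \<in> {0..T} \<Longrightarrow> cmod (g k s) \<le> A * jb k powr (- 2)"
    and gh: "\<And>t. t \<in> {0..T} \<Longrightarrow> herm (\<lambda>k. g k t)" and A: "A \<ge> 0" and small: "4 * Q * (2 * A * T) \<le> 1"
  obtains c where "\<And>k. continuous_on UNIV (c k)" "\<And>k t. cmod (c k t) \<le> 2 * A * T * jb k powr (- 2)" "\<And>t. herm (\<lambda>k. c k t)"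
    "\<And>k t. c k t = duh (lam k) (g k) (cl t) - duh (lam k) (Nl c c k) (cl t)"
proof -
  define r where "r = 2 * A * T"
  have r: "r \<ge> 0" using A T by (simp add: r_def)
  \<comment> \<open>Rescaling by the weight makes the sup norm of bounded functions equal to the
    norm of \<open>dec 2\<close> on coefficients.\<close>
  define co :: "(((int \<times> int) \<times> real) \<Rightarrow>\<^sub>C complex) \<Rightarrow> int \<times> int \<Rightarrow> real \<Rightarrow> complex"
    where "co F k t = jb k powr (- 2) *\<^sub>R apply_bcontfun F (k, t)" for F k t
  \<comment> \<open>Hermitian symmetry is part of the complete set on which the map contracts, so
    that the fixed point belongs to a real function.\<close>
  define X where "X = {F :: ((int \<times> int) \<times> real) \<Rightarrow>\<^sub>C complex. F \<in> cball 0 r \<and> (\<forall>k t. apply_bcontfun F (- k, t) = cnj (apply_bcontfun F (k, t)))}"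
  have gh': "g (- k) s = cnj (g k s)" if "s \<in> {0..T}" for k s
    using gh[OF that] unfolding herm_def by blast
  have Xsub: "norm (apply_bcontfun F z) \<le> r" if "F \<in> X" for F z
    using norm_bounded[of F z] that by (auto simp: X_def)
  have cb: "cmod (co F k t) \<le> r * jb k powr (- 2)" if "F \<in> X" for F k t
    using mult_left_mono[OF Xsub[OF that, of "(k, t)"], of "jb k powr (- 2)"] by (simp add: co_def mult.commute)
  have cc: "continuous_on B (co F k)" for F k B
    unfolding co_def[abs_def] by (intro continuous_intros continuous_on_compose2[OF continuous_on_apply_bcontfun[of UNIV F]]) auto
  have ch: "herm (\<lambda>k. co F k t)" if "F \<in> X" for F t
    using that unfolding herm_def co_def X_def by simp
  have NC: "continuous_on {0..T} (Nl (co F) (co F) k)" if "F \<in> X" for F k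
    using Nl_continuous[of 2 "{0..T}" "co F" r "co F" r] cb[OF that] cc by simp
  have NB: "cmod (duh (lam k) (Nl (co F) (co F) k) (cl t)) \<le> Q * r * r * jb k powr (- 2)" if "F \<in> X" for F k t
    unfolding Q_def by (rule duh_Nl_bound2[OF cb[OF that] cb[OF that] cc cc cl_in])
  define ph where "ph F z = jb (fst z) powr 2 *\<^sub>R (duh (lam (fst z)) (g (fst z)) (cl (snd z)) - duh (lam (fst z)) (Nl (co F) (co F) (fst z)) (cl (snd z)))" for F z
  have gB: "cmod (duh (lam k) (g k) (cl t)) \<le> A * T * jb k powr (- 2)" for k t
    using duh_bound(1)[OF gc cl_in gb lam_nonneg] by (simp add: mult_ac)
  have small': "Q * r * r \<le> r / 4"
  proof -
    have "(4 * Q * r) * r \<le> 1 * r" using small r unfolding r_def by (intro mult_right_mono) (auto simp: mult_ac)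
    then show ?thesis by simp
  qed
  have ph_bound: "cmod (ph F z) \<le> r" if F: "F \<in> X" for F z
  proof -
    have "cmod (duh (lam (fst z)) (g (fst z)) (cl (snd z)) - duh (lam (fst z)) (Nl (co F) (co F) (fst z)) (cl (snd z)))
       \<le> A * T * jb (fst z) powr (- 2) + Q * r * r * jb (fst z) powr (- 2)"
      by (rule order_trans[OF norm_triangle_ineq4]) (intro add_mono gB NB F)
    also have "\<dots> = (A * T + Q * r * r) * jb (fst z) powr (- 2)" by (simp add: algebra_simps)
    also have "\<dots> \<le> r * jb (fst z) powr (- 2)" using small' r unfolding r_def[symmetric]
      by (intro mult_right_mono) (auto simp: r_def)
    finally show ?thesis unfolding ph_def jb_cancel .
  qed
  have ph_cont: "continuous_on UNIV (ph F)" if F: "F \<in> X" for F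
  proof (rule continuous_on_index_times)
    fix k
    have "continuous_on UNIV (\<lambda>t. duh (lam k) h (cl t))" if "continuous_on {0..T} h" for h
      by (rule continuous_on_compose2[OF duh_continuous[OF that] continuous_cl]) (use cl_in in auto)
    then show "continuous_on UNIV (\<lambda>t. ph F (k, t))"
      unfolding ph_def fst_conv snd_conv using gc NC[OF F] by (intro continuous_intros) blast+
  qed
  have ph_bc: "ph F \<in> bcontfun" if "F \<in> X" for F
    by (rule bcontfun_normI[OF ph_cont ph_bound]) (use that in auto)
  define Ph where "Ph F = Bcontfun (ph F)" for F
  have app: "apply_bcontfun (Ph F) = ph F" if "F \<in> X" for F
    unfolding Ph_def using ph_bc[OF that] by (rule Bcontfun_inverse)
  have PhX: "Ph F \<in> X" if F: "F \<in> X" for F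
    unfolding X_def
  proof (intro CollectI conjI allI)
    have "norm (Ph F) \<le> r" by (rule norm_bound) (simp add: app[OF F] ph_bound[OF F])
    then show "Ph F \<in> cball 0 r" by simp
    fix k t
    have "duh (lam (- k)) (g (- k)) (cl t) = duh (lam k) (\<lambda>s. cnj (g k s)) (cl t)"
      unfolding lam_uminus by (rule duh_cong) (use gh' cl_in[of t] in auto)
    moreover have "duh (lam (- k)) (Nl (co F) (co F) (- k)) (cl t) = duh (lam k) (\<lambda>s. cnj (Nl (co F) (co F) k s)) (cl t)"
      unfolding lam_uminus by (rule duh_cong) (use Nl_herm[OF ch[OF F] ch[OF F]] in auto)
    ultimately show "apply_bcontfun (Ph F) (- k, t) = cnj (apply_bcontfun (Ph F) (k, t))"
      unfolding app[OF F] ph_def using duh_cnj[OF gc cl_in] duh_cnj[OF NC[OF F] cl_in] by simp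
  qed
  have lip: "dist (Ph F) (Ph F') \<le> (1/2) * dist F F'" if F: "F \<in> X" "F' \<in> X" for F F'
  proof (rule dist_bound)
    fix z :: "(int \<times> int) \<times> real"
    obtain k t where z: "z = (k, t)" by (cases z)
    have cd: "cmod (co F l s - co F' l s) \<le> dist F F' * jb l powr (- 2)" for l s
      using mult_left_mono[OF dist_bounded[of F "(l, s)" F'], of "jb l powr (- 2)"]
      by (simp add: co_def dist_norm mult.commute flip: scaleR_diff_right)
    have "dist (apply_bcontfun (Ph F) z) (apply_bcontfun (Ph F') z)
      = cmod (jb k powr 2 *\<^sub>R (duh (lam k) (Nl (co F) (co F) k) (cl t) - duh (lam k) (Nl (co F') (co F') k) (cl t)))"
      unfolding app[OF F(1)] app[OF F(2)] ph_def z dist_norm fst_conv snd_conv scaleR_diff_right[symmetric]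
      by (simp add: norm_minus_commute)
    also have "\<dots> \<le> 2 * Q * r * dist F F'"
      unfolding jb_cancel[symmetric] Q_def
      by (rule Nl_lipschitz[OF cb[OF F(1)] cb[OF F(2)] cd cc cc cl_in])
    also have "\<dots> \<le> (1/2) * dist F F'"
      using small by (intro mult_right_mono) (auto simp: r_def)
    finally show "dist (apply_bcontfun (Ph F) z) (apply_bcontfun (Ph F') z) \<le> (1/2) * dist F F'" .
  qed
  have closedX: "closed X"
  proof -
    have "X = cball 0 r \<inter> (\<Inter>k. \<Inter>t. {F. apply_bcontfun F (- k, t) = cnj (apply_bcontfun F (k, t))})"
      by (auto simp: X_def)
    moreover have "closed {F. apply_bcontfun F (- k, t) = cnj (apply_bcontfun F (k, t))}" for k :: "int \<times> int" and t :: real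
      by (intro closed_Collect_eq continuous_intros continuous_apply_bcontfun)
    ultimately show ?thesis by (auto intro!: closed_Int closed_INT)
  qed
  have "\<exists>!F\<in>X. Ph F = F"
  proof (rule Banach_fix[of X "1/2"])
    show "complete X" using closedX by (rule complete_closed_bcontfun)
    have "0 \<in> X" using r by (simp add: X_def)
    then show "X \<noteq> {}" by blast
  qed (use PhX lip in auto)
  then obtain F where F: "F \<in> X" "Ph F = F" by blast
  show ?thesis
  proof (rule that[of "co F"])
    show "continuous_on UNIV (co F k)" for k by (rule cc)
    show "cmod (co F k t) \<le> 2 * A * T * jb k powr (- 2)" for k t using cb[OF F(1)] by (simp add: r_def)
    show "herm (\<lambda>k. co F k t)" for t by (rule ch[OF F(1)])
    fix k t
    have "co F k t = jb k powr (- 2) *\<^sub>R apply_bcontfun (Ph F) (k, t)" by (simp add: co_def F(2))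
    also have "\<dots> = jb k powr (- 2) *\<^sub>R ph F (k, t)" by (simp add: app[OF F(1)])
    also have "\<dots> = duh (lam k) (g k) (cl t) - duh (lam k) (Nl (co F) (co F) k) (cl t)"
      by (simp add: ph_def powr_minus)
    finally show "co F k t = duh (lam k) (g k) (cl t) - duh (lam k) (Nl (co F) (co F) k) (cl t)" .
  qed
qed

text \<open>Bootstrap: each pass through the equation raises the order of decay by
  \<open>\<delta>\<close>, starting from 2. The smallness of the source plays its part only in the
  existence of \<open>c\<close>, so every order is reached.\<close>

lemma fixpoint_regular:
  assumes cc: "\<And>k. continuous_on UNIV (c k)" and cb: "\<And>k t. cmod (c k t) \<le> M * jb k powr (- 2)"
    and eq: "\<And>k t. c k t = duh (lam k) (g k) (cl t) - duh (lam k) (Nl c c k) (cl t)"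
    and gc: "\<And>k. continuous_on {0..T} (g k)" and gr: "\<And>s. \<exists>C. \<forall>t\<in>{0..T}. dec s C (\<lambda>k. g k t)"
  shows "\<exists>C. \<forall>t. dec s C (\<lambda>k. c k t)"
proof -
  have step: "\<exists>C. \<forall>t. dec (2 + real n * \<delta>) C (\<lambda>k. c k t)" for n
  proof (induction n)
    case 0
    show ?case using cb by (intro exI[of _ M]) (simp add: dec_def)
  next
    case (Suc n)
    let ?s = "2 + real n * \<delta>"
    obtain M where M: "\<And>t. dec ?s M (\<lambda>k. c k t)" using Suc by blast
    obtain C where C: "\<And>t. t \<in> {0..T} \<Longrightarrow> dec (?s + \<delta>) C (\<lambda>k. g k t)" using gr by blast
    have s2: "?s \<ge> 2" using \<delta> by simp
    have cc': "continuous_on {0..T} (c l)" for l by (rule continuous_on_subset[OF cc]) simp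
    show ?case
    proof (intro exI allI)
      fix t
      show "dec (2 + real (Suc n) * \<delta>) (C * T + S * G * Cv ?s * M * M) (\<lambda>k. c k t)"
        unfolding dec_def
      proof
        fix k
        have "cmod (duh (lam k) (g k) (cl t)) \<le> (C * jb k powr (- (?s + \<delta>))) * T"
          by (rule duh_bound(1)[OF gc cl_in decD[OF C] lam_nonneg])
        moreover have "cmod (duh (lam k) (Nl c c k) (cl t)) \<le> S * G * Cv ?s * M * M * jb k powr (- (?s + \<delta>))"
          by (rule duh_Nl_bound[OF s2 decD[OF M] decD[OF M] cc' cc' cl_in])
        ultimately have "cmod (c k t) \<le> (C * jb k powr (- (?s + \<delta>))) * T + S * G * Cv ?s * M * M * jb k powr (- (?s + \<delta>))"
          unfolding eq[of k t] by (intro order_trans[OF norm_triangle_ineq4] add_mono)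
        also have "?s + \<delta> = 2 + real (Suc n) * \<delta>" by (simp add: algebra_simps)
        finally show "cmod (c k t) \<le> (C * T + S * G * Cv ?s * M * M) * jb k powr (- (2 + real (Suc n) * \<delta>))"
          by (simp add: algebra_simps)
      qed
    qed
  qed
  obtain n where "s / \<delta> \<le> real n" using real_arch_simple by blast
  then have n: "s \<le> 2 + real n * \<delta>" using \<delta> by (simp add: divide_le_eq)
  obtain C where C: "\<And>t. dec (2 + real n * \<delta>) C (\<lambda>k. c k t)" using step by blast
  then show ?thesis using dec_mono[OF C order_refl n dec_nonneg[OF C]] by blast
qed

text \<open>The remainder is the Duhamel integral of the quadratic term alone, hence quadratic in
  the size \<open>M\<close> of the solution.\<close>

lemma fixpoint_linearization:
  assumes cc: "\<And>k. continuous_on UNIV (c k)" and cb: "\<And>k t. cmod (c k t) \<le> M * jb k powr (- 2)"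
    and eq: "\<And>k t. c k t = duh (lam k) (g k) (cl t) - duh (lam k) (Nl c c k) (cl t)"
  shows "cmod (c k t - duh (lam k) (g k) (cl t)) \<le> Q * M * M * jb k powr (- 2)"
proof -
  have cc': "continuous_on {0..T} (c l)" for l by (rule continuous_on_subset[OF cc]) simp
  show ?thesis unfolding eq[of k t] Q_def using duh_Nl_bound2[OF cb cb cc' cc' cl_in] by simp
qed

lemma fixpoint_ode:
  assumes cc: "\<And>k. continuous_on UNIV (c k)" and cb: "\<And>k t. cmod (c k t) \<le> M * jb k powr (- 2)"
    and eq: "\<And>k t. c k t = duh (lam k) (g k) (cl t) - duh (lam k) (Nl c c k) (cl t)"
    and gc: "\<And>k. continuous_on {0..T} (g k)" and t: "t \<in> {0..T}"
  shows "(c k has_vector_derivative (g k t - Nl c c k t - lam k *\<^sub>R c k t)) (at t within {0..T})"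
proof -
  have cc': "continuous_on {0..T} (c l)" for l by (rule continuous_on_subset[OF cc]) simp
  have NC: "continuous_on {0..T} (Nl c c k)" using Nl_continuous[of 2 "{0..T}" c M c M] cb cc' by simp
  have "((\<lambda>t. duh (lam k) (g k) t - duh (lam k) (Nl c c k) t) has_vector_derivative
      ((g k t - lam k *\<^sub>R duh (lam k) (g k) t) - (Nl c c k t - lam k *\<^sub>R duh (lam k) (Nl c c k) t))) (at t within {0..T})"
    by (intro has_vector_derivative_diff duh_derivative gc NC t)
  moreover have "(g k t - lam k *\<^sub>R duh (lam k) (g k) t) - (Nl c c k t - lam k *\<^sub>R duh (lam k) (Nl c c k) t) = g k t - Nl c c k t - lam k *\<^sub>R c k t"
    unfolding eq[of k t] cl_id[OF t] by (simp add: algebra_simps)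
  ultimately have "((\<lambda>t. duh (lam k) (g k) t - duh (lam k) (Nl c c k) t) has_vector_derivative
      (g k t - Nl c c k t - lam k *\<^sub>R c k t)) (at t within {0..T})" by simp
  then show ?thesis
    by (rule has_vector_derivative_transform[OF t, rotated]) (use eq cl_id in metis)
qed

lemma fixpoint_0:
  assumes eq: "\<And>k t. c k t = duh (lam k) (g k) (cl t) - duh (lam k) (Nl c c k) (cl t)"
  shows "c k 0 = 0"
  using eq[of k 0] cl_id[of 0] T by simp

end

section \<open>Smooth bump functions\<close>

text \<open>A family of flat functions that is closed under differentiation.\<close>

definition flat :: "real poly \<Rightarrow> real \<Rightarrow> real" where
  "flat p x = (if x > 0 then poly p (inverse x) * exp (- inverse x) else 0)"

lemma poly_exp_tendsto_0: "((\<lambda>y::real. poly p y * exp (- y)) \<longlongrightarrow> 0) at_top"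
proof -
  have eq: "poly p y * exp (- y) = (\<Sum>i\<le>degree p. coeff p i * (y ^ i / exp y))" for y :: real
    by (simp add: poly_altdef exp_minus sum_distrib_right divide_inverse mult.assoc)
  have "((\<lambda>y. \<Sum>i\<le>degree p. coeff p i * (y ^ i / exp y)) \<longlongrightarrow> (\<Sum>i\<le>degree p. coeff p i * 0)) at_top"
    by (intro tendsto_intros tendsto_power_div_exp_0)
  then show ?thesis unfolding eq by simp
qed

text \<open>With \<open>y = 1 / x\<close>, the derivative of \<open>p(y) exp(-y)\<close> is
  \<open>y^2 (p - p')(y) exp(-y)\<close>, of the same form again. At 0 the right difference quotient
  is \<open>y p(y) exp(-y)\<close>, which tends to 0 as \<open>y\<close> grows.\<close>

lemma flat_has_derivative:
  "(flat p has_real_derivative flat (monom 1 2 * (p - pderiv p)) x) (at x)"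
proof -
  let ?q = "monom 1 2 * (p - pderiv p)"
  consider "x > 0" | "x < 0" | "x = 0" by linarith
  then show ?thesis
  proof cases
    case 1
    have i: "(inverse has_real_derivative - (inverse x ^ 2)) (at x)"
      using DERIV_inverse[of x UNIV] 1 by (simp add: numeral_2_eq_2)
    have d1: "((\<lambda>x. poly p (inverse x)) has_real_derivative poly (pderiv p) (inverse x) * (- (inverse x ^ 2))) (at x)"
      by (rule DERIV_chain2[OF poly_DERIV i])
    have d2: "((\<lambda>x. exp (- inverse x)) has_real_derivative exp (- inverse x) * (- (- (inverse x ^ 2)))) (at x)"
      by (rule DERIV_chain2[OF DERIV_exp DERIV_minus[OF i]])
    have "flat ?q x = poly p (inverse x) * (exp (- inverse x) * (- (- (inverse x ^ 2))))
        + poly (pderiv p) (inverse x) * (- (inverse x ^ 2)) * exp (- inverse x)"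
      using 1 by (simp add: flat_def poly_monom algebra_simps)
    then have "((\<lambda>x. poly p (inverse x) * exp (- inverse x)) has_real_derivative flat ?q x) (at x)"
      using DERIV_mult'[OF d1 d2] by simp
    then show ?thesis
      by (rule has_field_derivative_transform_within_open[where S = "{0<..}"]) (use 1 in \<open>auto simp: flat_def\<close>)
  next
    case 2
    have "((\<lambda>x. 0) has_real_derivative flat ?q x) (at x)" using 2 by (simp add: flat_def)
    then show ?thesis
      by (rule has_field_derivative_transform_within_open[where S = "{..<0}"]) (use 2 in \<open>auto simp: flat_def\<close>)
  next
    case 3
    have "((\<lambda>h. (flat p (0 + h) - flat p 0) / h) \<longlongrightarrow> 0) (at 0)"
    proof (rule filterlim_split_at)
      show "((\<lambda>h. (flat p (0 + h) - flat p 0) / h) \<longlongrightarrow> 0) (at_left 0)"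
        by (rule tendsto_eventually) (auto simp: flat_def eventually_at_filter)
      have "((\<lambda>h. poly (pCons 0 p) (inverse h) * exp (- inverse h)) \<longlongrightarrow> 0) (at_right (0::real))"
        by (rule filterlim_compose[OF poly_exp_tendsto_0 filterlim_inverse_at_top_right])
      then show "((\<lambda>h. (flat p (0 + h) - flat p 0) / h) \<longlongrightarrow> 0) (at_right 0)"
        by (rule Lim_transform_eventually) (auto simp: flat_def eventually_at_filter divide_inverse)
    qed
    then show ?thesis using 3 by (simp add: DERIV_def flat_def)
  qed
qed

text \<open>A class of expressions whose derivatives stay in the class, so that smoothness of the
  concrete sources follows from their syntactic form alone.\<close>

inductive_set smooth_expr :: "('a::euclidean_space \<Rightarrow> real) set" where
  const: "(\<lambda>_. c) \<in> smooth_expr"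
| coord: "(\<lambda>z. z \<bullet> b) \<in> smooth_expr"
| add: "u \<in> smooth_expr \<Longrightarrow> v \<in> smooth_expr \<Longrightarrow> (\<lambda>z. u z + v z) \<in> smooth_expr"
| mult: "u \<in> smooth_expr \<Longrightarrow> v \<in> smooth_expr \<Longrightarrow> (\<lambda>z. u z * v z) \<in> smooth_expr"
| cos: "u \<in> smooth_expr \<Longrightarrow> (\<lambda>z. cos (u z)) \<in> smooth_expr"
| sin: "u \<in> smooth_expr \<Longrightarrow> (\<lambda>z. sin (u z)) \<in> smooth_expr"
| flat: "u \<in> smooth_expr \<Longrightarrow> (\<lambda>z. flat p (u z)) \<in> smooth_expr"

lemma smooth_expr_chain:
  assumes f: "\<And>x. (f has_real_derivative f' x) (at x)" and "(\<lambda>z. f' (u z)) \<in> smooth_expr"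
    and u: "\<And>z. (u has_derivative u' z) (at z)" "\<And>v. (\<lambda>z. u' z v) \<in> smooth_expr"
  shows "\<exists>d. (\<forall>z. ((\<lambda>z. f (u z)) has_derivative d z) (at z)) \<and> (\<forall>v. (\<lambda>z. d z v) \<in> smooth_expr)"
proof (intro exI conjI allI)
  fix z
  show "((\<lambda>z. f (u z)) has_derivative (\<lambda>v. f' (u z) * u' z v)) (at z)"
    using has_derivative_compose[OF u(1) f[unfolded has_field_derivative_def]] .
next
  fix v
  show "(\<lambda>z. f' (u z) * u' z v) \<in> smooth_expr" by (intro smooth_expr.mult assms)
qed

lemma smooth_expr_derivative:
  assumes "u \<in> smooth_expr"
  shows "\<exists>u'. (\<forall>z. (u has_derivative u' z) (at z)) \<and> (\<forall>v. (\<lambda>z. u' z v) \<in> smooth_expr)"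
  using assms
proof (induction rule: smooth_expr.induct)
  case (const c)
  show ?case by (intro exI[of _ "\<lambda>z v. 0"]) (auto intro: smooth_expr.const)
next
  case (coord b)
  show ?case by (intro exI[of _ "\<lambda>z v. v \<bullet> b"]) (auto intro!: smooth_expr.const derivative_eq_intros)
next
  case (add u v)
  then obtain u' v' where *: "\<And>z. (u has_derivative u' z) (at z)" "\<And>w. (\<lambda>z. u' z w) \<in> smooth_expr"
    "\<And>z. (v has_derivative v' z) (at z)" "\<And>w. (\<lambda>z. v' z w) \<in> smooth_expr" by blast
  show ?case
    by (intro exI[of _ "\<lambda>z w. u' z w + v' z w"] conjI allI has_derivative_add smooth_expr.add *)
next
  case (mult u v)
  then obtain u' v' where *: "\<And>z. (u has_derivative u' z) (at z)" "\<And>w. (\<lambda>z. u' z w) \<in> smooth_expr"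
    "\<And>z. (v has_derivative v' z) (at z)" "\<And>w. (\<lambda>z. v' z w) \<in> smooth_expr" by blast
  show ?case
    by (intro exI[of _ "\<lambda>z w. u z * v' z w + u' z w * v z"] conjI allI has_derivative_mult smooth_expr.add smooth_expr.mult mult *)
next
  case (cos u)
  then obtain u' where *: "\<And>z. (u has_derivative u' z) (at z)" "\<And>w. (\<lambda>z. u' z w) \<in> smooth_expr" by blast
  have "(\<lambda>z. (-1) * sin (u z)) \<in> smooth_expr" by (intro smooth_expr.intros cos)
  then show ?case by (intro smooth_expr_chain[where f' = "\<lambda>x. - sin x", OF _ _ *]) (auto intro!: derivative_eq_intros)
next
  case (sin u)
  then obtain u' where *: "\<And>z. (u has_derivative u' z) (at z)" "\<And>w. (\<lambda>z. u' z w) \<in> smooth_expr" by blast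
  show ?case by (intro smooth_expr_chain[where f' = cos, OF _ _ *]) (auto intro!: derivative_eq_intros smooth_expr.cos sin)
next
  case (flat u p)
  then obtain u' where *: "\<And>z. (u has_derivative u' z) (at z)" "\<And>w. (\<lambda>z. u' z w) \<in> smooth_expr" by blast
  show ?case by (rule smooth_expr_chain[OF flat_has_derivative _ *]) (intro smooth_expr.flat flat)
qed

lemma smooth_expr_smooth: assumes "u \<in> smooth_expr" shows "smooth_on UNIV u"
proof -
  have "iter_pd vs u \<in> smooth_expr" for vs
  proof (induction vs)
    case (Cons v vs)
    obtain u' where u': "\<And>z. (iter_pd vs u has_derivative u' z) (at z)" "\<And>v. (\<lambda>z. u' z v) \<in> smooth_expr"
      using smooth_expr_derivative[OF Cons] by blast
    have "iter_pd (v # vs) u = (\<lambda>z. u' z v)" using pd_eqI[OF u'(1)] by auto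
    then show ?case using u'(2) by simp
  qed (simp add: assms)
  moreover have "w differentiable_on UNIV" if "w \<in> smooth_expr" for w :: "'a \<Rightarrow> real"
    using smooth_expr_derivative[OF that] unfolding differentiable_on_def differentiable_def by auto
  ultimately show ?thesis unfolding smooth_on_def by blast
qed

text \<open>For \<open>0 < r \<le> 1/2\<close>, the argument of \<open>flat\<close> is positive
  exactly when \<open>s\<close> is closer than \<open>r\<close> to an integer. Taking the cosine
  makes the bump smooth and periodic in one formula, with no gluing of translates.\<close>

definition bump1 :: "real \<Rightarrow> real \<Rightarrow> real" where
  "bump1 r s = flat 1 (cos (2 * pi * s) - cos (2 * pi * r))"

definition bump :: "real \<Rightarrow> pt \<Rightarrow> pt \<Rightarrow> real" where
  "bump r p x = bump1 r (fst x - fst p) * bump1 r (snd x - snd p)"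

lemma flat_1: "flat 1 x = (if x > 0 then exp (- inverse x) else 0)"
  by (simp add: flat_def)

lemma bump1_nonneg: "bump1 r s \<ge> 0"
  by (simp add: bump1_def flat_1)

lemma bump1_pos_iff: "bump1 r s > 0 \<longleftrightarrow> cos (2 * pi * s) > cos (2 * pi * r)"
  by (simp add: bump1_def flat_1)

lemma bump1_nonzero_iff: "bump1 r s \<noteq> 0 \<longleftrightarrow> cos (2 * pi * s) > cos (2 * pi * r)"
  by (simp add: bump1_def flat_1)

lemma cos_2pi_abs: "cos (2 * pi * \<bar>s\<bar>) = cos (2 * pi * s)"
proof -
  have "2 * pi * \<bar>s\<bar> = \<bar>2 * pi * s\<bar>" by (simp add: abs_mult)
  then show ?thesis by (simp only: cos_abs_real)
qed

lemma near_int_of_cos_ge: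
  assumes r: "0 < r" "r \<le> 1/2" and c: "cos (2 * pi * s) \<ge> cos (2 * pi * r)"
  obtains n :: int where "\<bar>s - of_int n\<bar> \<le> r"
proof -
  define n where "n = round s"
  have n: "\<bar>s - of_int n\<bar> \<le> 1/2" using of_int_round_abs_le[of s] by (simp add: n_def abs_minus_commute)
  have "cos (2 * pi * \<bar>s - of_int n\<bar>) = cos (2 * pi * (s - of_int n))" by (rule cos_2pi_abs)
  also have "\<dots> = cos (2 * pi * s - 2 * pi * of_int n)" by (simp add: right_diff_distrib)
  also have "\<dots> = cos (2 * pi * s)" by (simp add: cos_diff)
  finally have "cos (2 * pi * \<bar>s - of_int n\<bar>) \<ge> cos (2 * pi * r)" using c by simp
  then have "2 * pi * \<bar>s - of_int n\<bar> \<le> 2 * pi * r"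
    using r n pi_gt_zero by (subst (asm) cos_mono_le_eq) (auto simp: mult_le_cancel_left_pos algebra_simps)
  then show ?thesis using that by simp
qed

lemma periodic_bump: "periodic (bump r p)"
  unfolding periodic_def
proof (intro allI)
  fix x k
  have *: "bump1 r (a + of_int n - b) = bump1 r (a - b)" for a b :: real and n :: int
  proof -
    have "cos (2 * pi * (a + of_int n - b)) = cos (2 * pi * (a - b) + 2 * pi * of_int n)" by (simp add: algebra_simps)
    also have "\<dots> = cos (2 * pi * (a - b))" by (simp add: cos_add)
    finally show ?thesis by (simp add: bump1_def)
  qed
  show "bump r p (x + lat k) = bump r p x" unfolding bump_def lat_def by (simp add: *)
qed

lemma continuous_flat: "continuous_on A (flat p)"
  using flat_has_derivative DERIV_continuous_on by (metis DERIV_subset subset_UNIV)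

lemma continuous_bump: "continuous_on A (bump r p)"
  unfolding bump_def[abs_def] bump1_def
  by (intro continuous_intros continuous_on_compose2[OF continuous_flat[of UNIV]]) auto

text \<open>The inequalities are non-strict because \<open>source\<close> requires the closure of
  the support to lie in \<open>W\<close>.\<close>

lemma bump_support_in_open:
  assumes W: "open W" "periodic (\<lambda>x. x \<in> W)" and p: "p \<in> W"
  obtains r0 where "0 < r0" "\<And>r x. 0 < r \<Longrightarrow> r \<le> r0 \<Longrightarrow> cos (2 * pi * (fst x - fst p)) \<ge> cos (2 * pi * r) \<Longrightarrow>
     cos (2 * pi * (snd x - snd p)) \<ge> cos (2 * pi * r) \<Longrightarrow> x \<in> W"
proof -
  obtain e where e: "e > 0" "ball p e \<subseteq> W" using W(1) p open_contains_ball by blast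
  \<comment> \<open>The norm is at most the sum of the two coordinate distances, that is
    \<open>2 * r < e\<close>; the bound \<open>1/2\<close> is the range of
    \<open>near_int_of_cos_ge\<close>.\<close>
  show ?thesis
  proof (rule that[of "min (e / 3) (1/2)"])
    show "0 < min (e / 3) (1/2)" using e by simp
    fix r x assume r: "0 < r" "r \<le> min (e / 3) (1/2)"
      and c: "cos (2 * pi * (fst x - fst p)) \<ge> cos (2 * pi * r)" "cos (2 * pi * (snd x - snd p)) \<ge> cos (2 * pi * r)"
    obtain m n where mn: "\<bar>fst x - fst p - of_int m\<bar> \<le> r" "\<bar>snd x - snd p - of_int n\<bar> \<le> r"
      using near_int_of_cos_ge[OF r(1) _ c(1)] near_int_of_cos_ge[OF r(1) _ c(2)] r by (metis min.boundedE)
    have "norm (x - lat (m, n) - p) \<le> \<bar>fst (x - lat (m, n) - p)\<bar> + \<bar>snd (x - lat (m, n) - p)\<bar>"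
      using sqrt_sum_squares_le_sum_abs by (simp add: norm_prod_def)
    also have "\<dots> = \<bar>fst x - fst p - of_int m\<bar> + \<bar>snd x - snd p - of_int n\<bar>"
      by (simp add: lat_def algebra_simps)
    also have "\<dots> < e" using mn r e by (simp add: min_def split: if_splits)
    finally have "x - lat (m, n) \<in> ball p e" by (simp add: dist_norm norm_minus_commute)
    then have "x - lat (m, n) \<in> W" using e by blast
    then show "x \<in> W" using periodic_diffD[OF W(2)] by simp
  qed
qed

text \<open>After centring at 0, the real part of the coefficient integrates the bump against
  \<open>cos (2 * pi * ip k y)\<close>. On the support within the cell \<open>ip k y\<close> is
  below \<open>1/4\<close> in absolute value, so the cosine is positive and nothing cancels.\<close>

lemma fcoef_bump_nonzero:
  assumes r: "0 < r" "r \<le> 1/4" and k: "(\<bar>real_of_int (fst k)\<bar> + \<bar>real_of_int (snd k)\<bar>) * r < 1/4"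
  shows "fcoef (bump r p) k \<noteq> 0"
proof
  assume z: "fcoef (bump r p) k = 0"
  have per: "periodic (bump r p)" by (rule periodic_bump)
  have "fcoef (\<lambda>y. bump r p (y + p)) k = ek k p * fcoef (bump r p) k"
    by (rule periodic_fcoef_shift(2)[OF per set_integrable_Qcell_continuous[OF per continuous_bump]])
  moreover have "(\<lambda>y. bump r p (y + p)) = bump r 0" by (simp add: bump_def fun_eq_iff)
  ultimately have z0: "fcoef (bump r 0) k = 0" using z by simp
  let ?h = "\<lambda>y. bump r 0 y * cos (2 * pi * ip k y)"
  have ct: "continuous_on UNIV (\<lambda>y. complex_of_real (bump r 0 y) * cnj (ek k y))"
    by (intro continuous_intros continuous_bump)
  have "periodic (\<lambda>y. complex_of_real (bump r 0 y) * cnj (ek k y))"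
    using periodic_bump[of r 0] periodic_ek[of k] unfolding periodic_def by simp
  from set_integrable_Qcell_continuous[OF this ct]
  have intc: "set_integrable lborel Qcell (\<lambda>y. complex_of_real (bump r 0 y) * cnj (ek k y))" .
  have Re: "Re (indicator Qcell y *\<^sub>R (complex_of_real (bump r 0 y) * cnj (ek k y))) = indicator Qcell y * ?h y" for y
    by (simp add: ek_def)
  have int: "integrable lborel (\<lambda>y. indicator Qcell y * ?h y)"
    using integrable_Re[OF intc[unfolded set_integrable_def]] unfolding Re .
  have I0: "(\<integral>y. indicator Qcell y * ?h y \<partial>lborel) = 0"
    using z0 integral_Re[OF intc[unfolded set_integrable_def]] unfolding fcoef_ek set_lebesgue_integral_def Re by simp
  have cospos: "cos (2 * pi * ip k y) > 0" if "\<bar>fst y\<bar> \<le> r" "\<bar>snd y\<bar> \<le> r" for y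
  proof -
    have "\<bar>ip k y\<bar> \<le> \<bar>real_of_int (fst k)\<bar> * \<bar>fst y\<bar> + \<bar>real_of_int (snd k)\<bar> * \<bar>snd y\<bar>"
      unfolding ip_def by (metis abs_mult abs_triangle_ineq)
    also have "\<dots> \<le> \<bar>real_of_int (fst k)\<bar> * r + \<bar>real_of_int (snd k)\<bar> * r"
      using that by (intro add_mono mult_left_mono) auto
    also have "\<dots> < 1/4" using k by (simp add: algebra_simps)
    finally have "\<bar>ip k y\<bar> < 1/4" .
    then have "- (pi / 2) < 2 * pi * ip k y" "2 * pi * ip k y < pi / 2"
      using mult_strict_left_mono[of "ip k y" "1/4" "2 * pi"] mult_strict_left_mono[of "- (1/4)" "ip k y" "2 * pi"] by auto
    then show ?thesis by (intro cos_gt_zero_pi)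
  qed
  have nn: "indicator Qcell y * ?h y \<ge> 0" for y
  proof (cases "y \<in> Qcell \<and> bump r 0 y \<noteq> 0")
    case True
    then have c: "cos (2 * pi * fst y) \<ge> cos (2 * pi * r)" "cos (2 * pi * snd y) \<ge> cos (2 * pi * r)"
      using bump1_nonzero_iff by (auto simp: bump_def intro: less_imp_le)
    have q: "\<bar>fst y\<bar> \<le> 1/2" "\<bar>snd y\<bar> \<le> 1/2" using True by (auto simp: Qcell_def mem_Times_iff)
    have le: "\<bar>s\<bar> \<le> r" if "cos (2 * pi * s) \<ge> cos (2 * pi * r)" "\<bar>s\<bar> \<le> 1/2" for s :: real
    proof (rule ccontr)
      assume "\<not> \<bar>s\<bar> \<le> r"
      then have "cos (2 * pi * \<bar>s\<bar>) < cos (2 * pi * r)"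
        using r that(2) pi_gt_zero mult_left_mono[OF that(2), of "2 * pi"] by (intro cos_monotone_0_pi) auto
      moreover note cos_2pi_abs[of s]
      ultimately show False using that by simp
    qed
    have "cos (2 * pi * ip k y) > 0" by (intro cospos le c q)
    moreover have "bump r 0 y \<ge> 0" unfolding bump_def using bump1_nonneg by simp
    ultimately show ?thesis by (simp add: indicator_def)
  qed (auto simp: indicator_def)
  have "AE y in lborel. indicator Qcell y * ?h y = 0"
    using integral_nonneg_eq_0_iff_AE[OF int] nn I0 by simp
  then have ae: "AE y in lborel. y \<notin> {-r<..<r} \<times> {-r<..<r}"
  proof eventually_elim
    case (elim y)
    show ?case
    proof
      assume y: "y \<in> {-r<..<r} \<times> {-r<..<r}"
      then have a: "\<bar>fst y\<bar> < r" "\<bar>snd y\<bar> < r" by (auto simp: abs_less_iff)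
      have "cos (2 * pi * s) > cos (2 * pi * r)" if "\<bar>s\<bar> < r" for s :: real
      proof -
        have "cos (2 * pi * \<bar>s\<bar>) > cos (2 * pi * r)"
          using that r pi_gt_zero mult_left_mono[OF r(2), of "2 * pi"] by (intro cos_monotone_0_pi) auto
        moreover note cos_2pi_abs[of s]
        ultimately show ?thesis by simp
      qed
      then have "bump r 0 y > 0" unfolding bump_def using a bump1_pos_iff by (intro mult_pos_pos) auto
      moreover have "cos (2 * pi * ip k y) > 0" using a by (intro cospos) auto
      moreover have "y \<in> Qcell" using y r by (auto simp: Qcell_def)
      ultimately show False using elim by (simp add: indicator_def)
    qed
  qed
  have "emeasure (lborel \<Otimes>\<^sub>M lborel) ({-r<..<r} \<times> {-r<..<r}) = ennreal (4 * r^2)"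
    using r by (subst lborel.emeasure_pair_measure_Times) (auto simp: ennreal_mult[symmetric] power2_eq_square)
  then have "emeasure lborel ({-r<..<r} \<times> {-r<..<r}) = ennreal (4 * r^2)" by (simp add: lborel_prod)
  moreover have "emeasure lborel ({-r<..<r} \<times> {-r<..<r}) = 0"
  proof -
    have "{-r<..<r} \<times> {-r<..<r} \<in> sets (lborel :: pt measure)" by (simp add: borel_Times)
    then have "{-r<..<r} \<times> {-r<..<r} \<in> null_sets (lborel :: pt measure)" using ae by (simp only: AE_iff_null_sets)
    then show ?thesis by (rule null_setsD1)
  qed
  ultimately show False using r by simp
qed

section \<open>Solutions of the active scalar equation\<close>

lemma hermD: "herm c \<Longrightarrow> c (- k) = cnj (c k)"
  unfolding herm_def by blast

lemma cnj_fcoef: "cnj (fcoef u k) = (LINT x:Qcell|lborel. ek k x * complex_of_real (u x))"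
  by (subst hermD[OF herm_fcoef, symmetric]) (simp add: fcoef_ek ek_uminus mult.commute)

lemma parseval:
  assumes a: "acs a" and u: "periodic u" "continuous_on UNIV u"
  shows "set_integrable lborel Qcell (\<lambda>x. fser a x * complex_of_real (u x))"
    "(LINT x:Qcell|lborel. fser a x * complex_of_real (u x)) = (\<Sum>\<^sub>\<infinity>k. a k * cnj (fcoef u k))"
    "acs (\<lambda>k. a k * cnj (fcoef u k))"
proof -
  have i: "set_integrable lborel Qcell u" using u by (rule set_integrable_Qcell_continuous)
  have [measurable]: "u \<in> borel_measurable borel" using u(2) by (rule borel_measurable_continuous_onI)
  note P = set_integral_fser_mult[OF a set_integrable_of_real[OF i]]
  show "set_integrable lborel Qcell (\<lambda>x. fser a x * complex_of_real (u x))"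
    by (rule P(1)) measurable
  show "(LINT x:Qcell|lborel. fser a x * complex_of_real (u x)) = (\<Sum>\<^sub>\<infinity>k. a k * cnj (fcoef u k))"
    unfolding cnj_fcoef by (rule P(2)) measurable
  have "acs (\<lambda>k. cnj (fcoef u k) * a k)"
    by (rule acs_mult_bounded[OF a]) (use fcoef_bounded[OF i] in simp)
  then show "acs (\<lambda>k. a k * cnj (fcoef u k))" by (simp add: mult.commute)
qed

text \<open>The order \<open>s / 2 + 1\<close> is chosen so that the squared coefficient times the
  weight \<open>jb k powr s\<close> leaves \<open>jb k powr (-2)\<close>, which is summable.\<close>

lemma hs_bound:
  assumes d: "dec (s / 2 + 1) C (fcoef u)" and i: "set_integrable lborel Qcell u"
  shows "in_Hs s u" "hs_sq s u \<le> C\<^sup>2 * (\<Sum>\<^sub>\<infinity>k. jb k powr (- 2))"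
proof -
  have b: "hs_weight s u k \<le> C\<^sup>2 * jb k powr (- 2)" for k
  proof -
    have "(cmod (fcoef u k))\<^sup>2 \<le> (C * jb k powr (- (s / 2 + 1)))\<^sup>2"
      by (intro power_mono decD[OF d]) auto
    then have "jb k powr s * (cmod (fcoef u k))\<^sup>2 \<le> jb k powr s * (C * jb k powr (- (s / 2 + 1)))\<^sup>2"
      by (intro mult_left_mono) auto
    also have "\<dots> = C\<^sup>2 * (jb k powr s * (jb k powr (- (s / 2 + 1)) * jb k powr (- (s / 2 + 1))))"
      by (simp add: power2_eq_square)
    also have "\<dots> = C\<^sup>2 * jb k powr (- 2)" unfolding powr_add[symmetric] by simp
    finally show ?thesis by (simp add: hs_weight_def jb_def)
  qed
  have sm: "(\<lambda>k. C\<^sup>2 * jb k powr (- 2)) summable_on UNIV" by (intro summable_on_cmult_right summable_jb) simp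
  have hs: "hs_weight s u summable_on UNIV"
    by (rule summable_on_comparison_test[OF sm b]) (simp add: hs_weight_def)
  then show "in_Hs s u" using i by (simp add: in_Hs_def)
  show "hs_sq s u \<le> C\<^sup>2 * (\<Sum>\<^sub>\<infinity>k. jb k powr (- 2))"
    unfolding hs_sq_def infsum_cmult_right'[symmetric] by (rule infsum_mono[OF hs sm b])
qed

text \<open>The Fourier symbol of \<open>fraclap \<alpha>\<close>; it plays the role of the decay
  rates \<open>lam\<close>.\<close>

definition lamk :: "real \<Rightarrow> int \<times> int \<Rightarrow> real" where
  "lamk \<alpha> k = (2 * pi * knorm k) powr (2 * \<alpha>)"

text \<open>The symbol of the transport term in divergence form, which uses that the velocity is
divergence free. The factor \<open>fst k\<close>, \<open>snd k\<close> is the derivative that the Duhamel integral absorbs.\<close>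

definition sigk :: "(pt \<Rightarrow> real) \<Rightarrow> int \<times> int \<Rightarrow> int \<times> int \<Rightarrow> complex" where
  "sigk K k l = 4 * pi\<^sup>2 * (real_of_int (snd l) * real_of_int (fst k) - real_of_int (fst l) * real_of_int (snd k)) * fcoef K l"

text \<open>Used for test functions: with \<open>\<alpha> < 1\<close> the fractional Laplacian costs
  at most one power of \<open>jb\<close>.\<close>

lemma lamk_upper: "\<alpha> < 1 \<Longrightarrow> lamk \<alpha> k \<le> 4 * pi\<^sup>2 * jb k"
proof (cases "k = 0")
  case False
  assume "\<alpha> < 1"
  have "1 * 1 \<le> (2 * pi) * knorm k" using pi_gt3 knorm_ge1[OF False] by (intro mult_mono) auto
  then have "lamk \<alpha> k \<le> (2 * pi * knorm k) powr 2"
    unfolding lamk_def using \<open>\<alpha> < 1\<close> by (intro powr_mono) auto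
  also have "\<dots> = 4 * pi\<^sup>2 * (knorm k)\<^sup>2" by (simp add: powr_numeral power_mult_distrib)
  also have "\<dots> \<le> 4 * pi\<^sup>2 * jb k" by (intro mult_left_mono) (auto simp: jb_def)
  finally show ?thesis .
qed (simp add: lamk_def)

text \<open>The rate grows like \<open>knorm k\<close> to the power \<open>2 \<alpha>\<close>, which
  exceeds the first power by \<open>2 \<alpha> - 1\<close>, that is \<open>\<alpha> - 1/2\<close> in
  powers of \<open>jb\<close>. The constant comes from \<open>jb k \<le> 2 (knorm k)^2\<close> for
  nonzero \<open>k\<close>.\<close>

lemma lamk_gain:
  assumes a: "1/2 < \<alpha>" and k: "k \<noteq> 0"
  shows "knorm k \<le> 2 powr (\<alpha> - 1/2) * jb k powr (- (\<alpha> - 1/2)) * lamk \<alpha> k"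
proof -
  define n where "n = knorm k"
  have n: "n \<ge> 1" unfolding n_def by (rule knorm_ge1[OF k])
  have "jb k \<le> 2 * n\<^sup>2" using n power_mono[of 1 n 2] by (simp add: jb_def n_def)
  then have "jb k powr (\<alpha> - 1/2) \<le> (2 * n\<^sup>2) powr (\<alpha> - 1/2)" using a by (intro powr_mono2) auto
  also have "\<dots> = 2 powr (\<alpha> - 1/2) * (n powr 2) powr (\<alpha> - 1/2)" using n by (simp add: powr_mult powr_numeral)
  also have "\<dots> = 2 powr (\<alpha> - 1/2) * n powr (2 * \<alpha> - 1)" by (simp add: powr_powr algebra_simps)
  finally have 1: "jb k powr (\<alpha> - 1/2) \<le> 2 powr (\<alpha> - 1/2) * n powr (2 * \<alpha> - 1)" .
  have "n * jb k powr (\<alpha> - 1/2) \<le> n * (2 powr (\<alpha> - 1/2) * n powr (2 * \<alpha> - 1))"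
    using n 1 by (intro mult_left_mono) auto
  also have "\<dots> = 2 powr (\<alpha> - 1/2) * n powr (2 * \<alpha>)" using n by (simp add: powr_diff)
  also have "\<dots> \<le> 2 powr (\<alpha> - 1/2) * lamk \<alpha> k"
  proof (intro mult_left_mono)
    have "1 * n \<le> (2 * pi) * n" using pi_gt3 n by (intro mult_right_mono) auto
    then show "n powr (2 * \<alpha>) \<le> lamk \<alpha> k" unfolding lamk_def n_def[symmetric] using a n by (intro powr_mono2) auto
  qed simp
  finally have "n * jb k powr (\<alpha> - 1/2) \<le> 2 powr (\<alpha> - 1/2) * lamk \<alpha> k" .
  then have "n * jb k powr (\<alpha> - 1/2) * jb k powr (- (\<alpha> - 1/2)) \<le> 2 powr (\<alpha> - 1/2) * lamk \<alpha> k * jb k powr (- (\<alpha> - 1/2))"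
    by (intro mult_right_mono) auto
  moreover have "n * jb k powr (\<alpha> - 1/2) * jb k powr (- (\<alpha> - 1/2)) = n"
    unfolding mult.assoc powr_add[symmetric] by simp
  ultimately have "n \<le> 2 powr (\<alpha> - 1/2) * lamk \<alpha> k * jb k powr (- (\<alpha> - 1/2))" by (simp only:)
  then show ?thesis by (simp only: n_def mult_ac)
qed

locale active_scalar =
  fixes K :: "pt \<Rightarrow> real" and \<alpha> T CK :: real
  assumes pK: "periodic K" and iK: "set_integrable lborel Qcell K" and a1: "1/2 < \<alpha>" and a2: "\<alpha> < 1" and T0: "0 < T"
    and CK: "CK \<ge> 0" "\<And>k. k \<noteq> 0 \<Longrightarrow> cmod (fcoef K k) \<le> CK / knorm k"

text \<open>The determinant in \<open>sigk\<close> is at most \<open>2 * knorm l * knorm k\<close>.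
  The decay \<open>CK / knorm l\<close> of the kernel cancels the factor \<open>knorm l\<close>,
  which together with \<open>4 pi^2\<close> gives the constant and leaves only
  \<open>knorm k\<close>.\<close>

sublocale active_scalar \<subseteq> duhamel_system "lamk \<alpha>" "sigk K" T "8 * pi\<^sup>2 * CK" "2 powr (\<alpha> - 1/2)" "\<alpha> - 1/2"
proof
  show "lamk \<alpha> (- k) = lamk \<alpha> k" for k by (simp add: lamk_def)
  show "lamk \<alpha> k \<ge> 0" for k by (simp add: lamk_def)
  show "knorm k \<le> 2 powr (\<alpha> - 1/2) * jb k powr (- (\<alpha> - 1/2)) * lamk \<alpha> k" if "k \<noteq> 0" for k
    by (rule lamk_gain[OF a1 that])
  show "sigk K (- k) (- l) = cnj (sigk K k l)" for k l
    using hermD[OF herm_fcoef[of K], of l] by (simp add: sigk_def)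
  show "cmod (sigk K k l) \<le> 8 * pi\<^sup>2 * CK * knorm k" for k l
  proof (cases "l = 0")
    case False
    have l: "knorm l \<ge> 1" by (rule knorm_ge1[OF False])
    let ?d = "real_of_int (snd l) * real_of_int (fst k) - real_of_int (fst l) * real_of_int (snd k)"
    have "\<bar>?d\<bar> \<le> \<bar>real_of_int (snd l)\<bar> * \<bar>real_of_int (fst k)\<bar> + \<bar>real_of_int (fst l)\<bar> * \<bar>real_of_int (snd k)\<bar>"
      by (metis abs_mult abs_triangle_ineq4)
    also have "\<dots> \<le> knorm l * knorm k + knorm l * knorm k"
      by (intro add_mono mult_mono fst_le_jb snd_le_jb) auto
    finally have d: "\<bar>?d\<bar> \<le> 2 * knorm l * knorm k" by (simp add: mult_ac)
    have "cmod (sigk K k l) = 4 * pi\<^sup>2 * (\<bar>?d\<bar> * cmod (fcoef K l))"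
      unfolding sigk_def by (simp only: norm_mult norm_of_real flip: of_real_mult of_real_diff) (simp add: norm_mult norm_power abs_mult)
    also have "\<dots> \<le> 4 * pi\<^sup>2 * (2 * knorm l * knorm k * (CK / knorm l))"
      by (intro mult_left_mono mult_mono d CK False) auto
    also have "\<dots> = 8 * pi\<^sup>2 * CK * knorm k" using l by simp
    finally show ?thesis .
  qed (use CK in \<open>simp add: sigk_def\<close>)
qed (use a1 T0 CK in auto)

context active_scalar
begin

text \<open>Products become convolutions, and for \<open>k = (k1, k2)\<close> and
  \<open>l = (l1, l2)\<close> the symbols combine to
  \<open>l2 (k1 - l1) - l1 (k2 - l2) = l2 k1 - l1 k2\<close>. The cancellation of
  \<open>l1 l2\<close> expresses that the velocity is divergence free; a factor linear in the output
  frequency \<open>k\<close> remains.\<close>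

lemma transport_term:
  assumes c: "rapid (\<lambda>k. c k t)"
  shows "fser (\<lambda>k. - dsym (0,1) k * fcoef K k * c k t) x * fser (\<lambda>k. dsym (1,0) k * c k t) x
       + fser (\<lambda>k. dsym (1,0) k * fcoef K k * c k t) x * fser (\<lambda>k. dsym (0,1) k * c k t) x
       = fser (\<lambda>k. Nl c c k t) x"
    "acs (\<lambda>k. Nl c c k t)"
proof -
  have fK: "cmod (fcoef K k) \<le> (LINT x:Qcell|lborel. \<bar>K x\<bar>)" for k by (rule fcoef_bounded[OF iK])
  have r1: "rapid (\<lambda>k. dsym v k * c k t)" for v by (rule rapid_dsym[OF c])
  have r2: "rapid (\<lambda>k. dsym v k * fcoef K k * c k t)" for v
    using rapid_mult_bounded[OF r1[of v], of "fcoef K", OF fK] by (simp add: mult_ac)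
  have r3: "rapid (\<lambda>k. - dsym v k * fcoef K k * c k t)" for v
    using rapid_mult_bounded[OF r2[of v], of "\<lambda>_. -1" 1] by (simp add: mult_ac)
  let ?m1 = "\<lambda>k. - dsym (0,1) k * fcoef K k * c k t" and ?d1 = "\<lambda>k. dsym (1,0) k * c k t"
  let ?m2 = "\<lambda>k. dsym (1,0) k * fcoef K k * c k t" and ?d2 = "\<lambda>k. dsym (0,1) k * c k t"
  have cc_acs: "acs (cconv a b)" if ra: "rapid a" and rb: "rapid b" for a b
  proof -
    obtain A where A: "dec 2 A a" using ra unfolding rapid_def by blast
    obtain B where B: "dec 2 B b" using rb unfolding rapid_def by blast
    have "dec 2 (A * B * Cv 2) (cconv a b)"
      unfolding dec_def
    proof
      fix k
      have b: "cmod (a l * b (k - l)) \<le> A * B * (jb l powr (- 2) * jb (k - l) powr (- 2))" for l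
      proof -
        have "cmod (a l) * cmod (b (k - l)) \<le> (A * jb l powr (- 2)) * (B * jb (k - l) powr (- 2))"
          using dec_nonneg[OF A] by (intro mult_mono decD[OF A] decD[OF B]) auto
        then show ?thesis by (simp add: norm_mult mult_ac)
      qed
      have sm: "(\<lambda>l. A * B * (jb l powr (- 2) * jb (k - l) powr (- 2))) summable_on UNIV"
        by (intro summable_on_cmult_right conv_weight_sum) simp
      have s: "(\<lambda>l. cmod (a l * b (k - l))) summable_on UNIV"
        by (rule summable_on_comparison_test[OF sm b]) auto
      have "cmod (cconv a b k) \<le> (\<Sum>\<^sub>\<infinity>l. cmod (a l * b (k - l)))"
        unfolding cconv_def by (rule norm_infsum_bound[OF s])
      also have "\<dots> \<le> (\<Sum>\<^sub>\<infinity>l. A * B * (jb l powr (- 2) * jb (k - l) powr (- 2)))"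
        by (rule infsum_mono[OF s sm b])
      also have "\<dots> = A * B * (\<Sum>\<^sub>\<infinity>l. jb l powr (- 2) * jb (k - l) powr (- 2))" by (rule infsum_cmult_right')
      also have "\<dots> \<le> A * B * (Cv 2 * jb k powr (- 2))"
        unfolding Cv_def using dec_nonneg[OF A] dec_nonneg[OF B] by (intro mult_left_mono conv_weight_sum) auto
      finally show "cmod (cconv a b k) \<le> A * B * Cv 2 * jb k powr - 2" by (simp add: mult_ac)
    qed
    then show ?thesis by (rule acs_dec) simp
  qed
  have conv_s: "(\<lambda>l. a l * b (k - l)) summable_on UNIV" if ra: "rapid a" and rb: "rapid b" for a b k
  proof -
    obtain B where B: "dec 2 B b" using rb unfolding rapid_def by blast
    have "cmod (b (k - l)) \<le> B" for l
    proof -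
      have "B * jb (k - l) powr (- 2) \<le> B * 1"
        using dec_nonneg[OF B] powr_mono[of "-2" 0 "jb (k - l)"] jb_ge1[of "k - l"] by (intro mult_left_mono) auto
      then show ?thesis using decD[OF B, of "k - l"] by simp
    qed
    then have "acs (\<lambda>l. b (k - l) * a l)" by (rule acs_mult_bounded[OF rapid_acs[OF ra]])
    then show ?thesis using abs_summable_summable[of "\<lambda>l. b (k - l) * a l"] by (simp add: mult.commute)
  qed
  have eq: "cconv ?m1 ?d1 k + cconv ?m2 ?d2 k = Nl c c k t" for k
  proof -
    have "cconv ?m1 ?d1 k + cconv ?m2 ?d2 k = (\<Sum>\<^sub>\<infinity>l. ?m1 l * ?d1 (k - l) + ?m2 l * ?d2 (k - l))"
      unfolding cconv_def by (rule infsum_add[symmetric]) (intro conv_s r1 r2 r3)+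
    also have "\<dots> = Nl c c k t"
      unfolding Nl_def
    proof (rule infsum_cong)
      fix l
      have ii: "\<i> * (\<i> * z) = - z" for z by (simp flip: mult.assoc)
      show "?m1 l * ?d1 (k - l) + ?m2 l * ?d2 (k - l) = sigk K k l * c l t * c (k - l) t"
        unfolding dsym_def ip_def sigk_def by (simp add: power2_eq_square algebra_simps ii)
    qed
    finally show ?thesis .
  qed
  have "fser ?m1 x * fser ?d1 x + fser ?m2 x * fser ?d2 x = fser (cconv ?m1 ?d1) x + fser (cconv ?m2 ?d2) x"
    by (simp only: fser_mult rapid_acs r1 r2 r3)
  also have "\<dots> = fser (\<lambda>k. cconv ?m1 ?d1 k + cconv ?m2 ?d2 k) x"
    by (rule fser_add[symmetric]) (intro cc_acs r1 r2 r3)+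
  finally show "fser ?m1 x * fser ?d1 x + fser ?m2 x * fser ?d2 x = fser (\<lambda>k. Nl c c k t) x" unfolding eq .
  have "acs (\<lambda>k. cconv ?m1 ?d1 k + cconv ?m2 ?d2 k)" by (intro acs_add cc_acs r1 r2 r3)
  then show "acs (\<lambda>k. Nl c c k t)" unfolding eq .
qed

end

section \<open>The function with the fixed point as coefficients solves the equation\<close>

locale active_scalar_solution = active_scalar +
  fixes f :: "pt \<times> real \<Rightarrow> real" and c :: "int \<times> int \<Rightarrow> real \<Rightarrow> complex" and M :: real
  assumes fs: "smooth_on UNIV f" and fp: "\<And>t. periodic (\<lambda>x. f (x, t))"
    and cc: "\<And>k. continuous_on UNIV (c k)" and cb: "\<And>k t. cmod (c k t) \<le> M * jb k powr (- 2)" and ch: "\<And>t. herm (\<lambda>k. c k t)"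
    and eq: "\<And>k t. c k t = duh (lamk \<alpha> k) (\<lambda>t. fcoef (\<lambda>x. f (x, t)) k) (cl t) - duh (lamk \<alpha> k) (Nl c c k) (cl t)"
begin

abbreviation gk :: "int \<times> int \<Rightarrow> real \<Rightarrow> complex" where
  "gk k t \<equiv> fcoef (\<lambda>x. f (x, t)) k"

definition \<theta> :: "pt \<times> real \<Rightarrow> real" where
  "\<theta> z = Re (fser (\<lambda>k. c k (snd z)) (fst z))"

lemma slice_continuous:
  assumes "smooth_on UNIV (\<phi> :: pt \<times> real \<Rightarrow> real)" "\<And>t. periodic (\<lambda>x. \<phi> (x, t))"
  shows "continuous_on A (\<lambda>t. fcoef (\<lambda>x. \<phi> (x, t)) k)"
  by (rule continuous_on_vector_derivative[OF has_vector_derivative_at_within[OF fcoef_has_vector_derivative[OF assms]]])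

lemma slice_dec:
  assumes "smooth_on UNIV (\<phi> :: pt \<times> real \<Rightarrow> real)" "\<And>t. periodic (\<lambda>x. \<phi> (x, t))"
  shows "\<exists>C. \<forall>t\<in>{0..T}. dec s C (fcoef (\<lambda>x. \<phi> (x, t)))"
proof -
  obtain N where N: "s \<le> real N" using real_arch_simple by blast
  obtain C where C: "\<forall>t\<in>{0..T}. dec (real N) C (fcoef (\<lambda>x. \<phi> (x, t)))" using fcoef_slice_dec[OF assms] by blast
  have "dec s C (fcoef (\<lambda>x. \<phi> (x, t)))" if "t \<in> {0..T}" for t
    using dec_mono[OF C[rule_format, OF that] order_refl N dec_nonneg[OF C[rule_format, OF that]]] .
  then show ?thesis by blast
qed

lemma c_dec: "\<exists>C. \<forall>t. dec s C (\<lambda>k. c k t)"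
  by (rule fixpoint_regular[OF cc cb eq slice_continuous[OF fs fp]]) (use slice_dec[OF fs fp] in simp)

lemma c_rapid: "rapid (\<lambda>k. c k t)"
  unfolding rapid_def using c_dec by blast

text \<open>A multiplier growing like \<open>jb k powr r\<close> is paid for by decay of order
  \<open>2 + r\<close>, which \<open>c_dec\<close> provides uniformly in time.\<close>

lemma continuous_fser_c:
  assumes "\<And>k. cmod (m k) \<le> D * jb k powr r"
  shows "continuous_on A (\<lambda>z. fser (\<lambda>k. m k * c k (snd z)) (fst z))"
proof -
  obtain C where C: "\<And>t. dec (2 + r) C (\<lambda>k. c k t)" using c_dec by blast
  have "0 \<le> D * jb 0 powr r" using assms[of 0] norm_ge_zero order_trans by blast
  then have D: "D \<ge> 0" using jb_pos[of 0] by (simp add: zero_le_mult_iff)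
  have "continuous_on (UNIV \<times> UNIV) (\<lambda>z. fser (\<lambda>k. m k * c k (snd z)) (fst z))"
  proof (rule continuous_fser_param)
    show "continuous_on UNIV (\<lambda>t. m k * c k t)" for k by (intro continuous_intros cc)
    show "cmod (m k * c k t) \<le> D * C * jb k powr (- 2)" for k t
      using decD[OF dec_mult[OF C assms D], of k t] by simp
    show "(\<lambda>k. D * C * jb k powr (- 2)) summable_on UNIV" by (intro summable_on_cmult_right summable_jb) simp
  qed
  then show ?thesis by (rule continuous_on_subset) auto
qed

lemma \<theta>_fser: "complex_of_real (\<theta> (x, t)) = fser (\<lambda>k. c k t) x"
  unfolding \<theta>_def by (simp add: of_real_Re_fser[OF ch])

lemma \<theta>_slice: "(\<lambda>x. \<theta> (x, t)) = (\<lambda>x. Re (fser (\<lambda>k. c k t) x))"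
  by (simp add: \<theta>_def)

lemma \<theta>_continuous: "continuous_on A \<theta>"
  using continuous_fser_c[of "\<lambda>_. 1" 1 0 A] unfolding \<theta>_def[abs_def] by (auto intro!: continuous_intros)

lemma \<theta>_periodic: "periodic (\<lambda>x. \<theta> (x, t))"
  unfolding \<theta>_slice by (rule periodic_compose[OF periodic_fser])

lemma fcoef_\<theta>: "fcoef (\<lambda>x. \<theta> (x, t)) = (\<lambda>k. c k t)"
  unfolding \<theta>_slice by (rule fcoef_Re_fser[OF rapid_acs[OF c_rapid] ch])

lemma Rop_\<theta>: "Rop K (\<lambda>x. \<theta> (x, t)) x = (Re (fser (\<lambda>k. - dsym (0,1) k * fcoef K k * c k t) x), Re (fser (\<lambda>k. dsym (1,0) k * fcoef K k * c k t) x))"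
  unfolding \<theta>_slice by (rule Rop_Re_fser[OF pK iK c_rapid ch])

lemma pd_\<theta>: "pd v (\<lambda>x. \<theta> (x, t)) x = Re (fser (\<lambda>k. dsym v k * c k t) x)"
  unfolding \<theta>_slice by (simp add: pd_Re_fser[OF c_rapid])

lemma \<theta>_sobolev: "\<exists>M. \<forall>t. in_Hs s (\<lambda>x. \<theta> (x, t)) \<and> hs_sq s (\<lambda>x. \<theta> (x, t)) \<le> M"
proof -
  obtain C where C: "\<And>t. dec (s / 2 + 1) C (\<lambda>k. c k t)" using c_dec by blast
  have i: "set_integrable lborel Qcell (\<lambda>x. \<theta> (x, t))" for t
    by (intro set_integrable_Qcell_continuous \<theta>_periodic continuous_on_compose2[OF \<theta>_continuous[of UNIV]] continuous_intros) auto
  show ?thesis using hs_bound[of s C "\<lambda>x. \<theta> (x, t)" for t, unfolded fcoef_\<theta>, OF C i] by blast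
qed

lemma transport_\<theta>:
  "complex_of_real (fst (Rop K (\<lambda>y. \<theta> (y, t)) x) * pd (1, 0) (\<lambda>y. \<theta> (y, t)) x
     + snd (Rop K (\<lambda>y. \<theta> (y, t)) x) * pd (0, 1) (\<lambda>y. \<theta> (y, t)) x) = fser (\<lambda>k. Nl c c k t) x"
proof -
  have neg: "herm (\<lambda>k. - dsym v k)" for v using hermD[OF herm_dsym] by (simp add: herm_def)
  note h = herm_mult[OF herm_mult[OF neg herm_fcoef] ch] herm_mult[OF herm_mult[OF herm_dsym herm_fcoef] ch] herm_mult[OF herm_dsym ch]
  show ?thesis
    unfolding Rop_\<theta> pd_\<theta> fst_conv snd_conv of_real_add of_real_mult of_real_Re_fser[OF h(1)] of_real_Re_fser[OF h(2)] of_real_Re_fser[OF h(3)]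
    by (rule transport_term(1)[where c = c and t = t, OF c_rapid])
qed

lemma fraclap_fser:
  "fraclap \<alpha> u x = Re (fser (\<lambda>k. complex_of_real (lamk \<alpha> k) * fcoef u k) x)"
  unfolding fraclap_def fser_def lamk_def ek_def by simp

end

lemma iter_pd_snoc: "iter_pd (vs @ [v]) u = iter_pd vs (pd v u)"
  by (induction vs) auto

lemma smooth_pd: "smooth_on UNIV u \<Longrightarrow> v \<in> Basis \<Longrightarrow> smooth_on UNIV (pd v u)"
  unfolding smooth_on_def iter_pd_snoc[symmetric] by auto

lemma fser_at_0: "fser a 0 = (\<Sum>\<^sub>\<infinity>k. a k)"
  by (simp add: fser_def ek_def ip_def)

context active_scalar_solution
begin

text \<open>The bracket is the contribution of mode \<open>k\<close> to the integrand of the weak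
  formulation. By Parseval the weak identity thus becomes a sum of integrals of exact time
  derivatives.\<close>

lemma product_mode_derivative:
  assumes "smooth_on UNIV \<phi>" "\<And>t. periodic (\<lambda>x. \<phi> (x, t))" "t \<in> {0..T}"
  shows "((\<lambda>t. c k t * cnj (fcoef (\<lambda>x. \<phi> (x, t)) k)) has_vector_derivative
      - (Nl c c k t * cnj (fcoef (\<lambda>x. \<phi> (x, t)) k) + c k t * cnj (complex_of_real (lamk \<alpha> k) * fcoef (\<lambda>x. \<phi> (x, t)) k)
        - c k t * cnj (fcoef (\<lambda>x. pd (0, 1) \<phi> (x, t)) k) - gk k t * cnj (fcoef (\<lambda>x. \<phi> (x, t)) k))) (at t within {0..T})"
proof -
  have 1: "(c k has_vector_derivative (gk k t - Nl c c k t - lamk \<alpha> k *\<^sub>R c k t)) (at t within {0..T})"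
    by (rule fixpoint_ode[OF cc cb eq slice_continuous[OF fs fp] assms(3)])
  have 2: "((\<lambda>t. cnj (fcoef (\<lambda>x. \<phi> (x, t)) k)) has_vector_derivative cnj (fcoef (\<lambda>x. pd (0, 1) \<phi> (x, t)) k)) (at t within {0..T})"
    by (rule bounded_linear.has_vector_derivative[OF bounded_linear_cnj has_vector_derivative_at_within[OF fcoef_has_vector_derivative[OF assms(1,2)]]])
  show ?thesis using has_vector_derivative_mult[OF 1 2] by (simp add: algebra_simps scaleR_conv_of_real)
qed

text \<open>Parseval in space turns the inner integral into a sum over modes; after the exchange of
  this sum with the time integral, each mode integrates a total derivative.\<close>

lemma weak_form:
  assumes \<phi>s: "smooth_on UNIV \<phi>" and \<phi>p: "\<And>t. periodic (\<lambda>x. \<phi> (x, t))"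
    and b: "b < T" and \<phi>0: "\<And>x t. b \<le> t \<Longrightarrow> \<phi> (x, t) = 0"
  defines "g \<equiv> \<lambda>z. - \<theta> z * pd ((0, 0), 1) \<phi> z
                   + (fst (Rop K (\<lambda>y. \<theta> (y, snd z)) (fst z)) * pd (1, 0) (\<lambda>y. \<theta> (y, snd z)) (fst z)
                    + snd (Rop K (\<lambda>y. \<theta> (y, snd z)) (fst z)) * pd (0, 1) (\<lambda>y. \<theta> (y, snd z)) (fst z))
                     * \<phi> z
                   + \<theta> z * fraclap \<alpha> (\<lambda>y. \<phi> (y, snd z)) (fst z)
                   - f z * \<phi> z"
  shows "set_integrable lborel (Qcell \<times> {0<..<T}) g" "(LINT z:(Qcell \<times> {0<..<T})|lborel. g z) = 0"
proof -
  define \<psi> where "\<psi> = pd ((0, 0), 1) \<phi>"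
  have bas: "((0,0), 1) \<in> (Basis :: (pt \<times> real) set)" by (simp add: Basis_prod_def zero_prod_def)
  have \<psi>s: "smooth_on UNIV \<psi>" unfolding \<psi>_def by (rule smooth_pd[OF \<phi>s bas])
  have \<psi>p: "periodic (\<lambda>x. \<psi> (x, t))" for t
    using periodicD[OF \<phi>p] unfolding \<psi>_def periodic_def pd_def by (simp add: zero_prod_def[symmetric])
  define \<Phi> \<Psi> where "\<Phi> k t = fcoef (\<lambda>x. \<phi> (x, t)) k" and "\<Psi> k t = fcoef (\<lambda>x. \<psi> (x, t)) k" for k t
  have c\<Phi>: "continuous_on A (\<Phi> k)" and c\<Psi>: "continuous_on A (\<Psi> k)" for A k
    unfolding \<Phi>_def[abs_def] \<Psi>_def[abs_def] using slice_continuous[OF \<phi>s \<phi>p] slice_continuous[OF \<psi>s \<psi>p] by auto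
  have cont: "continuous_on A \<phi>" "continuous_on A \<psi>" "continuous_on A f" for A
    using smooth_on_continuous[OF \<phi>s, of "[]"] smooth_on_continuous[OF \<psi>s, of "[]"] smooth_on_continuous[OF fs, of "[]"]
    by (auto intro: continuous_on_subset)
  \<comment> \<open>Order 3 for the test function: one power of \<open>jb\<close> pays for
    \<open>lamk\<close>, and the other two make the series of its fractional Laplacian absolutely
    convergent.\<close>
  obtain C3 where C3: "\<And>t. t \<in> {0..T} \<Longrightarrow> dec 3 C3 (\<lambda>k. \<Phi> k t)"
    using slice_dec[OF \<phi>s \<phi>p] unfolding \<Phi>_def[abs_def] by blast
  obtain C0 where C0: "\<And>t. t \<in> {0..T} \<Longrightarrow> dec 0 C0 (\<lambda>k. \<Psi> k t)"
    using slice_dec[OF \<psi>s \<psi>p] unfolding \<Psi>_def[abs_def] by blast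
  obtain Cg where Cg: "\<And>t. t \<in> {0..T} \<Longrightarrow> dec 0 Cg (\<lambda>k. gk k t)"
    using slice_dec[OF fs fp] by blast
  have nn: "C3 \<ge> 0" "C0 \<ge> 0" "Cg \<ge> 0"
    using dec_nonneg[OF C3, of 0] dec_nonneg[OF C0, of 0] dec_nonneg[OF Cg, of 0] T by auto
  have M0: "M \<ge> 0" using dec_nonneg[of 2 M "\<lambda>k. c k 0"] cb by (simp add: dec_def)
  define lf where "lf z = fraclap \<alpha> (\<lambda>y. \<phi> (y, snd z)) (fst z)" for z
  have lb: "cmod (complex_of_real (lamk \<alpha> k)) \<le> 4 * pi\<^sup>2 * jb k powr 1" for k
    using lamk_upper[OF a2, of k] lam_nonneg[of k] by simp
  have lPhi: "dec 2 (4 * pi\<^sup>2 * C3) (\<lambda>k. complex_of_real (lamk \<alpha> k) * \<Phi> k t)" if "t \<in> {0..T}" for t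
    using dec_mult[OF C3[OF that] lb] by simp
  have lherm: "herm (\<lambda>k. complex_of_real (lamk \<alpha> k) * \<Phi> k t)" for t
    by (rule herm_mult) (auto simp: herm_def lam_uminus \<Phi>_def hermD[OF herm_fcoef] simp del: split_paired_All)
  have lf_fser: "lf (x, t) = Re (fser (\<lambda>k. complex_of_real (lamk \<alpha> k) * \<Phi> k t) x)" for x t
    by (simp add: lf_def fraclap_fser \<Phi>_def)
  have lf_cont: "continuous_on (UNIV \<times> {0..T}) lf"
  proof -
    have "continuous_on (UNIV \<times> {0..T}) (\<lambda>z. fser (\<lambda>k. complex_of_real (lamk \<alpha> k) * \<Phi> k (snd z)) (fst z))"
    proof (rule continuous_fser_param)
      show "continuous_on {0..T} (\<lambda>t. complex_of_real (lamk \<alpha> k) * \<Phi> k t)" for k by (intro continuous_intros c\<Phi>)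
      show "cmod (complex_of_real (lamk \<alpha> k) * \<Phi> k t) \<le> 4 * pi\<^sup>2 * C3 * jb k powr (- 2)" if "t \<in> {0..T}" for k t
        using decD[OF lPhi[OF that], of k] .
      show "(\<lambda>k. 4 * pi\<^sup>2 * C3 * jb k powr (- 2)) summable_on UNIV" by (intro summable_on_cmult_right summable_jb) simp
    qed
    then have "continuous_on (UNIV \<times> {0..T}) (\<lambda>z. Re (fser (\<lambda>k. complex_of_real (lamk \<alpha> k) * \<Phi> k (snd z)) (fst z)))"
      by (intro continuous_intros)
    then show ?thesis by (rule continuous_on_eq) (use lf_fser in auto)
  qed
  define N where "N z = fst (Rop K (\<lambda>y. \<theta> (y, snd z)) (fst z)) * pd (1, 0) (\<lambda>y. \<theta> (y, snd z)) (fst z)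
                    + snd (Rop K (\<lambda>y. \<theta> (y, snd z)) (fst z)) * pd (0, 1) (\<lambda>y. \<theta> (y, snd z)) (fst z)" for z
  have m1: "cmod (dsym v k * fcoef K k) \<le> 4 * pi * norm v * (LINT x:Qcell|lborel. \<bar>K x\<bar>) * jb k powr (1/2)" for v k
  proof -
    have "cmod (dsym v k) * cmod (fcoef K k) \<le> (4 * pi * norm v * jb k powr (1/2)) * (LINT x:Qcell|lborel. \<bar>K x\<bar>)"
      by (intro mult_mono cmod_dsym_le fcoef_bounded[OF iK]) auto
    then show ?thesis by (simp add: norm_mult mult_ac)
  qed
  have m2: "cmod (- dsym v k * fcoef K k) \<le> 4 * pi * norm v * (LINT x:Qcell|lborel. \<bar>K x\<bar>) * jb k powr (1/2)" for v k
    using m1[of v k] by (simp add: norm_mult)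
  have N_cont: "continuous_on A N" for A
    unfolding N_def[abs_def] Rop_\<theta> pd_\<theta> fst_conv snd_conv
    by (intro continuous_intros continuous_fser_c[OF m1] continuous_fser_c[OF m2] continuous_fser_c[OF cmod_dsym_le])
  have N_fser: "complex_of_real (N (x, t)) = fser (\<lambda>k. Nl c c k t) x" for x t
    unfolding N_def fst_conv snd_conv by (rule transport_\<theta>)
  have g_alt: "g = (\<lambda>z. - \<theta> z * \<psi> z + N z * \<phi> z + \<theta> z * lf z - f z * \<phi> z)"
    by (simp add: g_def N_def lf_def \<psi>_def)
  have g_cont: "continuous_on (UNIV \<times> {0..T}) g"
    unfolding g_alt by (intro continuous_intros cont lf_cont N_cont \<theta>_continuous)
  have QT: "Qcell \<times> {0<..<T} \<in> sets (borel :: (pt \<times> real) measure)" by (intro borel_Times) auto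
  have "set_integrable lborel (cbox (-1/2, -1/2) (1/2, 1/2) \<times> {0..T}) g"
    unfolding set_integrable_def
    by (rule borel_integrable_compact) (auto intro!: compact_Times continuous_on_subset[OF g_cont])
  then show gi: "set_integrable lborel (Qcell \<times> {0<..<T}) g"
    by (rule set_integrable_subset) (use QT Qcell_subset_cbox in auto)
  define p where "p k t = Nl c c k t * cnj (\<Phi> k t) + c k t * cnj (complex_of_real (lamk \<alpha> k) * \<Phi> k t)
        - c k t * cnj (\<Psi> k t) - gk k t * cnj (\<Phi> k t)" for k t
  have inner: "complex_of_real (LINT x:Qcell|lborel. g (x, t)) = (\<Sum>\<^sub>\<infinity>k. p k t)" if t: "t \<in> {0..T}" for t
  proof -
    have cs: "continuous_on UNIV (\<lambda>x. F (x, t))" if "continuous_on (UNIV \<times> {0..T}) F" for F :: "pt \<times> real \<Rightarrow> real"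
      by (rule continuous_on_compose2[OF that]) (use t in \<open>auto intro!: continuous_intros\<close>)
    have lfp: "periodic (\<lambda>x. lf (x, t))" unfolding lf_fser by (rule periodic_compose[OF periodic_fser])
    have lfc: "fcoef (\<lambda>x. lf (x, t)) = (\<lambda>k. complex_of_real (lamk \<alpha> k) * \<Phi> k t)"
      unfolding lf_fser by (rule fcoef_Re_fser[OF acs_dec[OF lPhi[OF t]] lherm]) simp
    have facs: "acs (\<lambda>k. gk k t)" by (rule rapid_acs[OF rapid_fcoef[OF smooth_slice[OF fs] fp]])
    have f_fser: "complex_of_real (f (x, t)) = fser (\<lambda>k. gk k t) x" for x
      using fourier_inversion[OF fp cs[OF cont(3)] facs, of x] of_real_Re_fser[OF herm_fcoef, of "\<lambda>x. f (x, t)" x] by simp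
    note P1 = parseval[OF transport_term(2)[where c = c and t = t, OF c_rapid] \<phi>p[of t] cs[OF cont(1)]]
      and P2 = parseval[OF rapid_acs[OF c_rapid[of t]] lfp cs[OF lf_cont]]
      and P3 = parseval[OF rapid_acs[OF c_rapid[of t]] \<psi>p[of t] cs[OF cont(2)]]
      and P4 = parseval[OF facs \<phi>p[of t] cs[OF cont(1)]]
    have "complex_of_real (LINT x:Qcell|lborel. g (x, t)) = (LINT x:Qcell|lborel. complex_of_real (g (x, t)))"
      by (rule set_integral_complex_of_real[symmetric])
    also have "\<dots> = (LINT x:Qcell|lborel. fser (\<lambda>k. Nl c c k t) x * complex_of_real (\<phi> (x, t)) + fser (\<lambda>k. c k t) x * complex_of_real (lf (x, t))
        - fser (\<lambda>k. c k t) x * complex_of_real (\<psi> (x, t)) - fser (\<lambda>k. gk k t) x * complex_of_real (\<phi> (x, t)))"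
      unfolding g_alt N_fser[symmetric] \<theta>_fser[symmetric] f_fser[symmetric] by (simp add: algebra_simps)
    also have "\<dots> = (LINT x:Qcell|lborel. fser (\<lambda>k. Nl c c k t) x * complex_of_real (\<phi> (x, t))) + (LINT x:Qcell|lborel. fser (\<lambda>k. c k t) x * complex_of_real (lf (x, t)))
        - (LINT x:Qcell|lborel. fser (\<lambda>k. c k t) x * complex_of_real (\<psi> (x, t))) - (LINT x:Qcell|lborel. fser (\<lambda>k. gk k t) x * complex_of_real (\<phi> (x, t)))"
      by (simp only: set_integral_diff set_integral_add P1(1) P2(1) P3(1) P4(1))
    also have "\<dots> = (\<Sum>\<^sub>\<infinity>k. Nl c c k t * cnj (\<Phi> k t)) + (\<Sum>\<^sub>\<infinity>k. c k t * cnj (complex_of_real (lamk \<alpha> k) * \<Phi> k t))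
        - (\<Sum>\<^sub>\<infinity>k. c k t * cnj (\<Psi> k t)) - (\<Sum>\<^sub>\<infinity>k. gk k t * cnj (\<Phi> k t))"
      unfolding P1(2) P2(2) P3(2) P4(2) lfc \<Phi>_def \<Psi>_def ..
    also have "\<dots> = (\<Sum>\<^sub>\<infinity>k. p k t)"
      unfolding p_def fser_at_0[symmetric] 
      using P1(3) P2(3) P3(3) P4(3) unfolding lfc unfolding \<Phi>_def[symmetric] \<Psi>_def[symmetric]
      by (simp only: fser_add fser_diff acs_add acs_diff)
    finally show ?thesis .
  qed
  have p_cont: "continuous_on {0..T} (p k)" for k
  proof -
    have cc': "continuous_on {0..T} (c l)" for l by (rule continuous_on_subset[OF cc]) simp
    have "continuous_on {0..T} (Nl c c k)" using Nl_continuous[of 2 "{0..T}" c M c M] cb cc' by simp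
    then show ?thesis unfolding p_def[abs_def]
      by (intro continuous_intros cc' c\<Phi> c\<Psi> slice_continuous[OF fs fp])
  qed
  define L where "L = 8 * pi\<^sup>2 * CK * M * M * Cv 2 * C3 + M * (4 * pi\<^sup>2 * C3) + M * C0 + Cg * C3"
  have p_bound: "cmod (p k t) \<le> L * jb k powr (- 2)" if t: "t \<in> {0..T}" for k t
  proof -
    have small: "jb k powr (- s) \<le> 1" if "s \<ge> 0" for s
      using powr_mono[of "- s" 0 "jb k"] jb_ge1[of k] that by simp
    have \<Phi>3: "cmod (\<Phi> k t) \<le> C3 * jb k powr (- 3)" by (rule decD[OF C3[OF t]])
    have b1: "cmod (Nl c c k t * cnj (\<Phi> k t)) \<le> 8 * pi\<^sup>2 * CK * M * M * Cv 2 * C3 * jb k powr (- 2)"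
    proof -
      have "cmod (Nl c c k t) * cmod (\<Phi> k t) \<le> (8 * pi\<^sup>2 * CK * knorm k * M * M * Cv 2 * jb k powr (- 2)) * (C3 * jb k powr (- 3))"
        using Nl_summable(3)[of 2 c t M c M k] cb CK M0 Cv_nonneg[of 2] by (intro mult_mono \<Phi>3) auto
      also have "\<dots> = 8 * pi\<^sup>2 * CK * M * M * Cv 2 * C3 * jb k powr (- 2) * (knorm k * jb k powr (- 3))" by (simp add: mult_ac)
      also have "\<dots> \<le> 8 * pi\<^sup>2 * CK * M * M * Cv 2 * C3 * jb k powr (- 2) * 1"
      proof (intro mult_left_mono)
        have "knorm k * jb k powr (- 3) \<le> jb k powr 1 * jb k powr (- 3)"
          using knorm_le_jb[of k] by (intro mult_right_mono) auto
        also have "\<dots> = jb k powr (- 2)" unfolding powr_add[symmetric] by simp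
        also have "\<dots> \<le> 1" by (rule small) simp
        finally show "knorm k * jb k powr (- 3) \<le> 1" .
      qed (use CK M0 Cv_nonneg[of 2] nn in auto)
      finally show ?thesis by (simp add: norm_mult)
    qed
    have b2: "cmod (c k t * cnj (complex_of_real (lamk \<alpha> k) * \<Phi> k t)) \<le> M * (4 * pi\<^sup>2 * C3) * jb k powr (- 2)"
    proof -
      have "cmod (complex_of_real (lamk \<alpha> k) * \<Phi> k t) \<le> 4 * pi\<^sup>2 * C3 * jb k powr (- 2)" by (rule decD[OF lPhi[OF t]])
      also have "\<dots> \<le> 4 * pi\<^sup>2 * C3 * 1" using nn by (intro mult_left_mono small) auto
      finally have "cmod (c k t) * cmod (complex_of_real (lamk \<alpha> k) * \<Phi> k t) \<le> (M * jb k powr (- 2)) * (4 * pi\<^sup>2 * C3)"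
        using M0 by (intro mult_mono cb) auto
      then show ?thesis by (simp add: norm_mult mult_ac)
    qed
    have b3: "cmod (c k t * cnj (\<Psi> k t)) \<le> M * C0 * jb k powr (- 2)"
    proof -
      have "cmod (\<Psi> k t) \<le> C0" using decD[OF C0[OF t], of k] by simp
      then have "cmod (c k t) * cmod (\<Psi> k t) \<le> (M * jb k powr (- 2)) * C0" using M0 by (intro mult_mono cb) auto
      then show ?thesis by (simp add: norm_mult mult_ac)
    qed
    have b4: "cmod (gk k t * cnj (\<Phi> k t)) \<le> Cg * C3 * jb k powr (- 2)"
    proof -
      have "cmod (gk k t) \<le> Cg" using decD[OF Cg[OF t], of k] by simp
      moreover have "cmod (\<Phi> k t) \<le> C3 * jb k powr (- 2)"
        by (rule order_trans[OF \<Phi>3]) (use nn jb_ge1[of k] in \<open>intro mult_left_mono powr_mono, auto\<close>)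
      ultimately have "cmod (gk k t) * cmod (\<Phi> k t) \<le> Cg * (C3 * jb k powr (- 2))" using nn by (intro mult_mono) auto
      then show ?thesis by (simp add: norm_mult mult_ac)
    qed
    have tri: "cmod (u + v - w - y) \<le> cmod u + cmod v + cmod w + cmod y" for u v w y
      using norm_triangle_ineq4[of "u + v - w" y] norm_triangle_ineq4[of "u + v" w] norm_triangle_ineq[of u v] by linarith
    show ?thesis unfolding p_def
      by (rule order_trans[OF tri]) (use b1 b2 b3 b4 in \<open>simp add: L_def distrib_right\<close>)
  qed
  \<comment> \<open>The boundary terms vanish, at time 0 by the initial condition of
    \<open>c\<close> and at time \<open>T\<close> because the test function is zero there.\<close>
  have p_zero: "(LINT t:{0<..<T}|lborel. p k t) = 0" for k
  proof -
    have pi0: "set_integrable lborel {0..T} (p k)" by (rule borel_integrable_atLeastAtMost'[OF p_cont])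
    then have "set_integrable lborel {0<..<T} (p k)" by (rule set_integrable_subset) auto
    then have "(LINT t:{0<..<T}|lborel. p k t) = integral {0<..<T} (p k)" by (rule set_borel_integral_eq_integral)
    also have "\<dots> = integral {0..T} (p k)" by (rule integral_open_interval_real[symmetric])
    also have "\<dots> = 0"
    proof (rule integral_unique)
      have "((\<lambda>t. - p k t) has_integral (c k T * cnj (\<Phi> k T) - c k 0 * cnj (\<Phi> k 0))) {0..T}"
      proof (rule fundamental_theorem_of_calculus)
        show "((\<lambda>t. c k t * cnj (\<Phi> k t)) has_vector_derivative - p k t) (at t within {0..T})" if "t \<in> {0..T}" for t
          using product_mode_derivative[OF \<phi>s \<phi>p that, of k] unfolding p_def \<Phi>_def \<Psi>_def \<psi>_def by (simp add: zero_prod_def)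
      qed (use T in simp)
      moreover have "\<Phi> k T = 0" unfolding \<Phi>_def fcoef_def using \<phi>0[of T] b by (simp add: set_lebesgue_integral_def)
      moreover have "c k 0 = 0" by (rule fixpoint_0[OF eq])
      ultimately have "((\<lambda>t. - p k t) has_integral 0) {0..T}" by simp
      from has_integral_neg[OF this] show "(p k has_integral 0) {0..T}" by simp
    qed
    finally show ?thesis .
  qed
  have sumint: "(LINT t:{0<..<T}|lborel. (\<Sum>\<^sub>\<infinity>k. p k t)) = (\<Sum>\<^sub>\<infinity>k. LINT t:{0<..<T}|lborel. p k t)"
  proof -
    let ?F = "\<lambda>k t. indicator {0<..<T} t *\<^sub>R p k t"
    have L0: "L \<ge> 0" unfolding L_def using CK M0 Cv_nonneg[of 2] nn by (intro add_nonneg_nonneg mult_nonneg_nonneg) auto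
    have "(\<integral>t. (\<Sum>\<^sub>\<infinity>k. ?F k t) \<partial>lborel) = (\<Sum>\<^sub>\<infinity>k. \<integral>t. ?F k t \<partial>lborel)"
    proof (rule infsum_integral(3))
      have "(\<lambda>t. indicator {0<..<T} t *\<^sub>R p k t) \<in> borel_measurable borel" for k
        by (rule borel_measurable_continuous_on_indicator) (auto intro: continuous_on_subset[OF p_cont])
      then show "?F k \<in> borel_measurable lborel" for k by simp
      show "cmod (?F k t) \<le> (L * jb k powr (- 2)) * indicator {0<..<T} t" for k t
        using p_bound[of t k] by (auto simp: indicator_def)
      show "(\<lambda>k. L * jb k powr (- 2)) summable_on UNIV" by (intro summable_on_cmult_right summable_jb) simp
      show "integrable lborel (indicat_real {0<..<T})" using T by (simp add: integrable_indicator_iff)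
    qed (use L0 in auto)
    then show ?thesis unfolding set_lebesgue_integral_def by (simp only: infsum_scaleR_right)
  qed
  have ind: "indicator (Qcell \<times> {0<..<T}) (x, t) *\<^sub>R g (x, t) = indicator {0<..<T} t *\<^sub>R (indicator Qcell x *\<^sub>R g (x, t))" for x t
    by (auto simp: indicator_def)
  have "(LINT z:(Qcell \<times> {0<..<T})|lborel. g z) = (\<integral>z. indicator (Qcell \<times> {0<..<T}) z *\<^sub>R g z \<partial>(lborel \<Otimes>\<^sub>M lborel))"
    unfolding set_lebesgue_integral_def by (simp add: lborel_prod)
  also have "\<dots> = (\<integral>t. (\<integral>x. indicator (Qcell \<times> {0<..<T}) (x, t) *\<^sub>R g (x, t) \<partial>lborel) \<partial>lborel)"
    using lborel_pair.integral_snd[of "\<lambda>x t. indicator (Qcell \<times> {0<..<T}) (x, t) *\<^sub>R g (x, t)"] gi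
    unfolding set_integrable_def by (simp add: case_prod_beta' lborel_prod)
  also have "\<dots> = (LINT t:{0<..<T}|lborel. (LINT x:Qcell|lborel. g (x, t)))"
    unfolding ind set_lebesgue_integral_def by simp
  finally have F: "(LINT z:(Qcell \<times> {0<..<T})|lborel. g z) = (LINT t:{0<..<T}|lborel. (LINT x:Qcell|lborel. g (x, t)))" .
  have "complex_of_real (LINT z:(Qcell \<times> {0<..<T})|lborel. g z) = (LINT t:{0<..<T}|lborel. complex_of_real (LINT x:Qcell|lborel. g (x, t)))"
    unfolding F by (rule set_integral_complex_of_real[symmetric])
  also have "\<dots> = (LINT t:{0<..<T}|lborel. (\<Sum>\<^sub>\<infinity>k. p k t))"
    by (rule set_lebesgue_integral_cong) (use inner in auto)
  also have "\<dots> = 0" unfolding sumint p_zero by simp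
  finally show "(LINT z:(Qcell \<times> {0<..<T})|lborel. g z) = 0" by simp
qed

lemma solution: "is_solution K \<alpha> T f \<theta>"
  unfolding is_solution_def Let_def
proof (intro conjI allI impI)
  show "\<theta> \<in> borel_measurable borel" by (intro borel_measurable_continuous_onI \<theta>_continuous)
  show "periodic (\<lambda>x. \<theta> (x, t))" for t by (rule \<theta>_periodic)
  show "AE t in lborel. t \<in> {0<..<T} \<longrightarrow> smooth_on UNIV (\<lambda>x. \<theta> (x, t))"
    unfolding \<theta>_slice using smooth_Re_fser[OF c_rapid] by simp
next
  fix s :: real assume "0 < s"
  show "\<exists>M. AE t in lborel. t \<in> {0<..<T} \<longrightarrow> in_Hs s (\<lambda>x. \<theta> (x, t)) \<and> hs_sq s (\<lambda>x. \<theta> (x, t)) \<le> M"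
    using \<theta>_sobolev[of s] by auto
  obtain B where B: "\<And>t. in_Hs (s + \<alpha>) (\<lambda>x. \<theta> (x, t)) \<and> hs_sq (s + \<alpha>) (\<lambda>x. \<theta> (x, t)) \<le> B"
    using \<theta>_sobolev[of "s + \<alpha>"] by auto
  then show "AE t in lborel. t \<in> {0<..<T} \<longrightarrow> in_Hs (s + \<alpha>) (\<lambda>x. \<theta> (x, t))" by simp
  have "(\<integral>\<^sup>+ t\<in>{0<..<T}. ennreal (hs_sq (s + \<alpha>) (\<lambda>x. \<theta> (x, t))) \<partial>lborel) \<le> (\<integral>\<^sup>+ t. ennreal B * indicator {0<..<T} t \<partial>lborel)"
    using B by (intro nn_integral_mono mult_right_mono ennreal_leI) auto
  also have "\<dots> = ennreal B * ennreal T" using T by (simp add: nn_integral_cmult_indicator)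
  also have "\<dots> < \<infinity>" by (simp add: ennreal_mult_less_top)
  finally show "(\<integral>\<^sup>+ t\<in>{0<..<T}. ennreal (hs_sq (s + \<alpha>) (\<lambda>x. \<theta> (x, t))) \<partial>lborel) < \<infinity>" .
next
  fix \<phi> :: "pt \<times> real \<Rightarrow> real"
  assume a: "smooth_on UNIV \<phi> \<and> (\<forall>t. periodic (\<lambda>x. \<phi> (x, t))) \<and> (\<exists>b<T. \<forall>x t. b \<le> t \<longrightarrow> \<phi> (x, t) = 0)"
  then obtain b where b: "b < T" "\<And>x t. b \<le> t \<Longrightarrow> \<phi> (x, t) = 0" by blast
  from a have a': "smooth_on UNIV \<phi>" "\<And>t. periodic (\<lambda>x. \<phi> (x, t))" by blast+
  note W = weak_form[OF a' b]
  show "set_integrable lborel (Qcell \<times> {0<..<T}) (\<lambda>z. - \<theta> z * pd ((0, 0), 1) \<phi> z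
                   + (fst (Rop K (\<lambda>y. \<theta> (y, snd z)) (fst z)) * pd (1, 0) (\<lambda>y. \<theta> (y, snd z)) (fst z)
                    + snd (Rop K (\<lambda>y. \<theta> (y, snd z)) (fst z)) * pd (0, 1) (\<lambda>y. \<theta> (y, snd z)) (fst z))
                     * \<phi> z
                   + \<theta> z * fraclap \<alpha> (\<lambda>y. \<phi> (y, snd z)) (fst z)
                   - f z * \<phi> z)" by (rule W(1))
  show "(LINT z:(Qcell \<times> {0<..<T})|lborel. - \<theta> z * pd ((0, 0), 1) \<phi> z
                   + (fst (Rop K (\<lambda>y. \<theta> (y, snd z)) (fst z)) * pd (1, 0) (\<lambda>y. \<theta> (y, snd z)) (fst z)
                    + snd (Rop K (\<lambda>y. \<theta> (y, snd z)) (fst z)) * pd (0, 1) (\<lambda>y. \<theta> (y, snd z)) (fst z))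
                     * \<phi> z
                   + \<theta> z * fraclap \<alpha> (\<lambda>y. \<phi> (y, snd z)) (fst z)
                   - f z * \<phi> z) = 0" by (rule W(2))
qed

end

section \<open>Dirichlet series and trigonometric polynomials\<close>

text \<open>With nonnegative rates every exponential is at most 1 in modulus on the right half
  plane, so the series converges uniformly on discs there and its sum is holomorphic. The midpoint
  of the real interval is a limit point of zeros, and the identity theorem applies.\<close>

lemma dirichlet_extension:
  fixes l :: "int \<times> int \<Rightarrow> real"
  assumes d: "acs d" and l: "\<And>k. l k \<ge> 0" and ab: "0 \<le> a" "a < b"
    and z: "\<And>\<tau>. a < \<tau> \<Longrightarrow> \<tau> < b \<Longrightarrow> (\<Sum>\<^sub>\<infinity>k. d k * exp (- complex_of_real (l k) * complex_of_real \<tau>)) = 0" and \<tau>: "\<tau> > 0"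
  shows "(\<Sum>\<^sub>\<infinity>k. d k * exp (- complex_of_real (l k) * complex_of_real \<tau>)) = 0"
proof -
  let ?H = "{z. Re z > 0}"
  define G where "G w = (\<Sum>\<^sub>\<infinity>k. d k * exp (- complex_of_real (l k) * w))" for w
  have "G field_differentiable (at w)" if w: "w \<in> ?H" for w
  proof -
    define r where "r = Re w / 2"
    have r: "r > 0" using w by (simp add: r_def)
    have pos: "Re u \<ge> 0" if "u \<in> cball w r" for u
      using abs_Re_le_cmod[of "w - u"] that w by (auto simp: dist_norm r_def)
    have U: "uniform_limit (cball w r) (\<lambda>X u. \<Sum>k\<in>X. d k * exp (- complex_of_real (l k) * u)) G (finite_subsets_at_top UNIV)"
      unfolding G_def
    proof (rule Weierstrass_m_test_general[OF _ d])
      fix k u assume "u \<in> cball w r"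
      then have "exp (- (l k * Re u)) \<le> 1" using pos l by simp
      then have "cmod (d k) * exp (- (l k * Re u)) \<le> cmod (d k) * 1" by (intro mult_left_mono) auto
      then show "cmod (d k * exp (- complex_of_real (l k) * u)) \<le> cmod (d k)" by (simp add: norm_mult)
    qed
    have E: "\<forall>\<^sub>F X in finite_subsets_at_top UNIV. continuous_on (cball w r) (\<lambda>u. \<Sum>k\<in>X. d k * exp (- complex_of_real (l k) * u)) \<and>
       (\<lambda>u. \<Sum>k\<in>X. d k * exp (- complex_of_real (l k) * u)) holomorphic_on ball w r"
      by (intro always_eventually allI conjI continuous_intros holomorphic_intros)
    have "G holomorphic_on ball w r" using holomorphic_uniform_limit[OF E U] by simp
    then show ?thesis by (rule holomorphic_on_imp_differentiable_at) (use r in auto)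
  qed
  then have hol: "G holomorphic_on ?H" by (simp add: holomorphic_on_def field_differentiable_at_within)
  let ?x = "complex_of_real ((a + b) / 2)"
  have "G (complex_of_real \<tau>) = 0"
  proof (rule analytic_continuation[OF hol, where U = "complex_of_real ` {a<..<b}" and \<xi> = ?x])
    show "open ?H" by (rule open_halfspace_Re_gt)
    show "connected ?H" by (intro convex_connected convex_halfspace_Re_gt)
    show "complex_of_real ` {a<..<b} \<subseteq> ?H" using ab by auto
    show "?x \<in> ?H" using ab by simp
    show "?x islimpt complex_of_real ` {a<..<b}"
      unfolding islimpt_approachable
    proof (intro allI impI)
      fix e :: real assume e: "e > 0"
      define h where "h = min (e / 2) ((b - a) / 4)"
      have "h \<le> e / 2" unfolding h_def by (rule min.cobounded1)
      moreover have "h \<le> (b - a) / 4" unfolding h_def by (rule min.cobounded2)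
      moreover have "0 < h" using e ab unfolding h_def by (simp add: min_def)
      ultimately have h: "0 < h" "h < e" "h \<le> (b - a) / 4" using e by auto
      show "\<exists>x'\<in>complex_of_real ` {a<..<b}. x' \<noteq> ?x \<and> dist x' ?x < e"
      proof (intro bexI conjI)
        show "complex_of_real ((a + b) / 2 + h) \<noteq> ?x" using h by (metis add_cancel_right_right of_real_eq_iff less_irrefl)
        have "dist (complex_of_real ((a + b) / 2 + h)) ?x = \<bar>h\<bar>"
          unfolding dist_norm of_real_diff[symmetric] norm_of_real by simp
        then show "dist (complex_of_real ((a + b) / 2 + h)) ?x < e" using h by simp
        show "complex_of_real ((a + b) / 2 + h) \<in> complex_of_real ` {a<..<b}"
          using h ab by (intro imageI) (auto simp: field_simps)
      qed
    qed
    show "G w = 0" if "w \<in> complex_of_real ` {a<..<b}" for w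
      using that z unfolding G_def by auto
    show "complex_of_real \<tau> \<in> ?H" using \<tau> by simp
  qed
  then show ?thesis by (simp add: G_def)
qed

text \<open>The squared length as a natural number. The rate \<open>lamk\<close> is a strictly
  increasing function of it for \<open>\<alpha> > 0\<close>, so the blocks of equal rate are
  numbered and can be removed by induction.\<close>

definition qk :: "int \<times> int \<Rightarrow> nat" where
  "qk k = nat ((fst k)\<^sup>2 + (snd k)\<^sup>2)"

lemma knorm_qk: "knorm k = sqrt (real (qk k))"
  by (simp add: knorm_def qk_def)

lemma finite_qk: "finite {k. qk k \<le> m}"
proof (rule finite_subset)
  show "{k. qk k \<le> m} \<subseteq> {- int m..int m} \<times> {- int m..int m}"
  proof
    fix k assume "k \<in> {k. qk k \<le> m}"
    then have le: "(fst k)\<^sup>2 + (snd k)\<^sup>2 \<le> int m" by (simp add: qk_def)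
    have *: "\<bar>a\<bar> \<le> a\<^sup>2" for a :: int
      by (metis abs_ge_zero abs_le_square_iff abs_of_nonneg int_one_le_iff_zero_less mult.right_neutral mult_left_mono
          order_le_less power2_abs power2_eq_square zero_eq_power2 abs_eq_0 order_refl)
    have "\<bar>fst k\<bar> \<le> int m" "\<bar>snd k\<bar> \<le> int m"
      using *[of "fst k"] *[of "snd k"] le zero_le_power2[of "fst k"] zero_le_power2[of "snd k"] by linarith+
    then show "k \<in> {- int m..int m} \<times> {- int m..int m}" by (auto simp: mem_Times_iff abs_le_iff)
  qed
qed auto

lemma lamk_qk: "lamk \<alpha> k = (2 * pi * sqrt (real (qk k))) powr (2 * \<alpha>)"
  by (simp add: lamk_def knorm_qk)

text \<open>Strong induction on the block. The lower blocks contribute nothing, and after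
  multiplication by the inverse of the exponential of block \<open>m\<close> the higher ones decay,
  so letting time tend to infinity isolates the block sum.\<close>

lemma dirichlet_blocks:
  assumes a: "\<alpha> > 0" and d: "acs d"
    and z: "\<And>\<tau>. \<tau> > 0 \<Longrightarrow> (\<Sum>\<^sub>\<infinity>k. d k * exp (- complex_of_real (lamk \<alpha> k) * complex_of_real \<tau>)) = 0"
  shows "(\<Sum>k | qk k = m. d k) = 0"
proof (induction m rule: less_induct)
  case (less m)
  define L where "L n = (2 * pi * sqrt (real n)) powr (2 * \<alpha>)" for n
  have Lk: "lamk \<alpha> k = L (qk k)" for k by (simp add: L_def lamk_qk)
  have Lmono: "L n \<le> L n'" if "n \<le> n'" for n n'
    unfolding L_def using that a by (intro powr_mono2) auto
  \<comment> \<open>The rate at \<open>Suc m\<close> bounds the rates of all higher blocks from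
    below, even when no lattice point has squared length \<open>Suc m\<close>.\<close>
  have gap: "L m < L (Suc m)" unfolding L_def using a by (intro powr_less_mono2) auto
  define D where "D = (\<Sum>\<^sub>\<infinity>k. cmod (d k))"
  let ?F = "{k. qk k < m}" and ?A = "{k. qk k = m}" and ?R = "{k. qk k > m}"
  have finF: "finite ?F" by (rule finite_subset[OF _ finite_qk[of m]]) auto
  have finA: "finite ?A" by (rule finite_subset[OF _ finite_qk[of m]]) auto
  have b: "cmod (\<Sum>k\<in>?A. d k) \<le> exp (- (L (Suc m) - L m) * \<tau>) * D" if t: "\<tau> > 0" for \<tau>
  proof -
    let ?f = "\<lambda>k. d k * exp (- complex_of_real (lamk \<alpha> k) * complex_of_real \<tau>)"
    have nf: "cmod (?f k) = cmod (d k) * exp (- (lamk \<alpha> k * \<tau>))" for k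
      by (simp add: norm_mult)
    have fs: "(\<lambda>k. cmod (?f k)) summable_on UNIV"
    proof (rule summable_on_comparison_test[OF d])
      fix k
      have "exp (- (lamk \<alpha> k * \<tau>)) \<le> 1" using t by (simp add: lamk_def)
      then have "cmod (d k) * exp (- (lamk \<alpha> k * \<tau>)) \<le> cmod (d k) * 1" by (intro mult_left_mono) auto
      then show "cmod (?f k) \<le> cmod (d k)" unfolding nf by simp
    qed simp
    have s: "?f summable_on B" for B
      using summable_on_subset_banach[OF abs_summable_summable[OF fs]] by blast
    have sR: "(\<lambda>k. cmod (?f k)) summable_on ?R" using summable_on_subset_banach[OF fs] by blast
    have dR: "(\<lambda>k. cmod (d k)) summable_on ?R" using summable_on_subset_banach[OF d] by blast
    have "(\<Sum>\<^sub>\<infinity>k. ?f k) = infsum ?f ((?F \<union> ?A) \<union> ?R)"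
      by (rule arg_cong[where f = "infsum ?f"]) auto
    also have "\<dots> = infsum ?f (?F \<union> ?A) + infsum ?f ?R"
      by (rule infsum_Un_disjoint[OF s s]) auto
    also have "infsum ?f (?F \<union> ?A) = infsum ?f ?F + infsum ?f ?A"
      by (rule infsum_Un_disjoint[OF s s]) auto
    finally have split: "sum ?f ?F + sum ?f ?A + infsum ?f ?R = 0" using z[OF t] finF finA by simp
    have "sum ?f ?F = (\<Sum>n<m. \<Sum>k\<in>{k \<in> ?F. qk k = n}. ?f k)"
      by (rule sum.group[symmetric]) (use finF in auto)
    also have "\<dots> = 0"
    proof (rule sum.neutral, rule ballI)
      fix n assume n: "n \<in> {..<m}"
      have "(\<Sum>k\<in>{k \<in> ?F. qk k = n}. ?f k) = (\<Sum>k | qk k = n. d k * exp (- complex_of_real (L n) * complex_of_real \<tau>))"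
        by (rule sum.cong) (use n in \<open>auto simp: Lk\<close>)
      also have "\<dots> = (\<Sum>k | qk k = n. d k) * exp (- complex_of_real (L n) * complex_of_real \<tau>)"
        by (rule sum_distrib_right[symmetric])
      finally show "(\<Sum>k\<in>{k \<in> ?F. qk k = n}. ?f k) = 0" using less[of n] n by simp
    qed
    finally have F0: "sum ?f ?F = 0" .
    have "sum ?f ?A = (\<Sum>k\<in>?A. d k * exp (- complex_of_real (L m) * complex_of_real \<tau>))"
      by (rule sum.cong) (auto simp: Lk)
    also have "\<dots> = (\<Sum>k\<in>?A. d k) * exp (- complex_of_real (L m) * complex_of_real \<tau>)"
      by (rule sum_distrib_right[symmetric])
    finally have A1: "sum ?f ?A = (\<Sum>k\<in>?A. d k) * exp (- complex_of_real (L m) * complex_of_real \<tau>)" .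
    have "cmod (\<Sum>k\<in>?A. d k) * exp (- (L m * \<tau>)) = cmod (sum ?f ?A)" unfolding A1 by (simp add: norm_mult)
    also have "\<dots> = cmod (infsum ?f ?R)" 
    proof -
      have "sum ?f ?A = - infsum ?f ?R" using split unfolding F0 add_0 by (simp only: eq_neg_iff_add_eq_0)
      then show ?thesis by (simp only: norm_minus_cancel)
    qed
    also have "\<dots> \<le> infsum (\<lambda>k. cmod (?f k)) ?R" by (rule norm_infsum_bound[OF sR])
    also have "\<dots> \<le> infsum (\<lambda>k. exp (- (L (Suc m) * \<tau>)) * cmod (d k)) ?R"
    proof (rule infsum_mono[OF sR summable_on_cmult_right[OF dR]])
      fix k assume "k \<in> ?R"
      then have "L (Suc m) * \<tau> \<le> lamk \<alpha> k * \<tau>" unfolding Lk using t by (intro mult_right_mono Lmono) auto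
      then show "cmod (?f k) \<le> exp (- (L (Suc m) * \<tau>)) * cmod (d k)"
        unfolding nf by (simp add: mult.commute mult_left_mono)
    qed
    also have "\<dots> = exp (- (L (Suc m) * \<tau>)) * infsum (\<lambda>k. cmod (d k)) ?R" by (rule infsum_cmult_right')
    also have "\<dots> \<le> exp (- (L (Suc m) * \<tau>)) * D"
      unfolding D_def by (intro mult_left_mono infsum_mono_neutral[OF dR d]) auto
    finally have "exp (L m * \<tau>) * (cmod (\<Sum>k\<in>?A. d k) * exp (- (L m * \<tau>))) \<le> exp (L m * \<tau>) * (exp (- (L (Suc m) * \<tau>)) * D)"
      by (intro mult_left_mono) auto
    moreover have "exp (L m * \<tau>) * (cmod (\<Sum>k\<in>?A. d k) * exp (- (L m * \<tau>))) = cmod (\<Sum>k\<in>?A. d k)"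
      by (simp add: exp_minus)
    moreover have "exp (L m * \<tau>) * (exp (- (L (Suc m) * \<tau>)) * D) = exp (- (L (Suc m) - L m) * \<tau>) * D"
      unfolding mult.assoc[symmetric] exp_add[symmetric] by (simp add: algebra_simps)
    ultimately show ?thesis by simp
  qed
  have "((\<lambda>\<tau>. exp (- (L (Suc m) - L m) * \<tau>) * D) \<longlongrightarrow> 0 * D) at_top"
  proof (intro tendsto_intros filterlim_compose[OF exp_at_bot])
    show "filterlim (\<lambda>\<tau>. - (L (Suc m) - L m) * \<tau>) at_bot at_top"
      using gap by (intro filterlim_tendsto_neg_mult_at_bot[OF tendsto_const _ filterlim_ident]) auto
  qed
  then have "cmod (\<Sum>k\<in>?A. d k) \<le> 0 * D"
    by (rule tendsto_lowerbound) (use b in \<open>auto intro: eventually_mono[OF eventually_gt_at_top[of 0]]\<close>)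
  then show ?case by simp
qed

section \<open>Linear independence of characters on an open set\<close>

lemma trig_poly_derivative_zero:
  assumes "finite S" "open W" and z: "\<And>x. x \<in> W \<Longrightarrow> (\<Sum>k\<in>S. c k * ek k x) = 0" and x: "x \<in> W"
  shows "(\<Sum>k\<in>S. c k * (dsym v k * ek k x)) = 0"
proof -
  have 1: "((\<lambda>t. \<Sum>k\<in>S. c k * ek k (x + t *\<^sub>R v)) has_vector_derivative (\<Sum>k\<in>S. c k * (dsym v k * ek k x))) (at 0)"
    by (intro has_vector_derivative_sum has_vector_derivative_mult_right ek_has_vector_derivative)
  have o: "open ((\<lambda>t::real. x + t *\<^sub>R v) -` W)"
    by (rule open_vimage[OF assms(2)]) (intro continuous_intros)
  have "((\<lambda>t::real. 0::complex) has_vector_derivative (\<Sum>k\<in>S. c k * (dsym v k * ek k x))) (at 0)"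
    by (rule has_vector_derivative_transform_within_open[OF 1 o]) (use x z in auto)
  then show ?thesis using vector_derivative_unique_at[OF _ has_vector_derivative_const] by blast
qed

text \<open>The derivative along \<open>v\<close> minus multiplication by \<open>dsym v k0\<close>
  annihilates the mode \<open>k0\<close> and multiplies every other mode \<open>l\<close> by
  \<open>dsym v l - dsym v k0\<close>. For \<open>l\<close> different from \<open>k0\<close> this
  factor is nonzero for one of the two coordinate directions.\<close>

lemma trig_poly_independent:
  assumes "finite S" "open W" "W \<noteq> {}" "\<And>x. x \<in> W \<Longrightarrow> (\<Sum>k\<in>S. c k * ek k x) = 0" "k \<in> S"
  shows "c k = 0"
  using assms
proof (induction S arbitrary: c k rule: finite_induct)
  case (insert k0 S)
  have z: "c k0 * ek k0 x + (\<Sum>k\<in>S. c k * ek k x) = 0" if "x \<in> W" for x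
    using insert.prems(3)[OF that] insert.hyps by simp
  have S0: "c l = 0" if l: "l \<in> S" for l
  proof -
    have dz: "(dsym v l - dsym v k0) * c l = 0" for v
    proof (rule insert.IH[where c = "\<lambda>l. (dsym v l - dsym v k0) * c l", OF insert.prems(1,2) _ l])
      fix x assume x: "x \<in> W"
      have "(\<Sum>k\<in>insert k0 S. c k * (dsym v k * ek k x)) = 0"
        by (rule trig_poly_derivative_zero[OF _ insert.prems(1,3) x]) (use insert.hyps in auto)
      then have "c k0 * (dsym v k0 * ek k0 x) + (\<Sum>k\<in>S. c k * (dsym v k * ek k x)) = 0" using insert.hyps by simp
      moreover have "(\<Sum>k\<in>S. (dsym v k - dsym v k0) * c k * ek k x) = (\<Sum>k\<in>S. c k * (dsym v k * ek k x)) - dsym v k0 * (\<Sum>k\<in>S. c k * ek k x)"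
        by (simp add: sum_subtractf[symmetric] sum_distrib_left algebra_simps)
      moreover have "(\<Sum>k\<in>S. c k * ek k x) = - (c k0 * ek k0 x)" using z[OF x] by (simp add: eq_neg_iff_add_eq_0 add.commute)
      ultimately show "(\<Sum>k\<in>S. (dsym v k - dsym v k0) * c k * ek k x) = 0"
        by (simp add: eq_neg_iff_add_eq_0 algebra_simps)
    qed
    have "l \<noteq> k0" using l insert.hyps by auto
    then have "fst l \<noteq> fst k0 \<or> snd l \<noteq> snd k0" by (simp add: prod_eq_iff)
    then show ?thesis using dz[of "(1,0)"] dz[of "(0,1)"] by (auto simp: dsym_def ip_def)
  qed
  obtain x where x: "x \<in> W" using insert.prems(2) by blast
  have "c k0 * ek k0 x = 0" using z[OF x] S0 by simp
  moreover have "ek k0 x \<noteq> 0" using cmod_ek[of k0 x] by fastforce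
  ultimately have "c k0 = 0" by simp
  then show ?case using S0 insert.prems(4) by blast
qed simp

text \<open>First \<open>x\<close> is fixed and time separates the blocks; within a block, which is
  finite, \<open>x\<close> then varies over \<open>W\<close> and separates the modes.\<close>

lemma dirichlet_trig_vanish:
  assumes a: "\<alpha> > 0" and d: "acs d" and ab: "0 \<le> a" "a < b" and W: "open W" "W \<noteq> {}"
    and z: "\<And>\<tau> x. a < \<tau> \<Longrightarrow> \<tau> < b \<Longrightarrow> x \<in> W \<Longrightarrow> fser (\<lambda>k. exp (- complex_of_real (lamk \<alpha> k) * complex_of_real \<tau>) * d k) x = 0"
  shows "d k = 0"
proof (rule trig_poly_independent[OF _ W])
  show "finite {l. qk l = qk k}" by (rule finite_subset[OF _ finite_qk[of "qk k"]]) auto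
  show "k \<in> {l. qk l = qk k}" by simp
  fix x assume x: "x \<in> W"
  have dx: "acs (\<lambda>k. d k * ek k x)" using d by (simp add: norm_mult)
  show "(\<Sum>l | qk l = qk k. d l * ek l x) = 0"
  proof (rule dirichlet_blocks[OF a dx])
    fix \<tau> :: real assume t: "\<tau> > 0"
    show "(\<Sum>\<^sub>\<infinity>k. d k * ek k x * exp (- complex_of_real (lamk \<alpha> k) * complex_of_real \<tau>)) = 0"
      by (rule dirichlet_extension[OF dx _ ab _ t]) (use z[OF _ _ x] in \<open>auto simp: fser_def lamk_def mult_ac\<close>)
  qed
qed

section \<open>Linearization of the source-to-solution map\<close>

text \<open>The set where the inequality fails is open by continuity and null by assumption, hence
  empty.\<close>

lemma AE_le_imp_le:
  fixes h :: "'a::euclidean_space \<Rightarrow> real"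
  assumes O: "open O'" and c: "continuous_on O' h" and ae: "AE z in lborel. z \<in> O' \<longrightarrow> h z \<le> b" and z: "z \<in> O'"
  shows "h z \<le> b"
proof (rule ccontr)
  assume "\<not> h z \<le> b"
  let ?S = "O' \<inter> h -` {b<..}"
  have S: "open ?S" by (rule continuous_open_preimage[OF c O open_greaterThan])
  have "AE z in lborel. z \<notin> ?S" using ae by eventually_elim auto
  then have "?S \<in> null_sets lborel" using S by (subst AE_iff_null_sets) auto
  then have "negligible ?S" by (simp add: negligible_iff_null_sets null_sets_completionI)
  moreover have "?S \<noteq> {}" using z \<open>\<not> h z \<le> b\<close> by auto
  ultimately show False using open_not_negligible[OF S] by blast
qed

lemma duh_scale: "duh l (\<lambda>s. complex_of_real e * h s) t = complex_of_real e * duh l h t"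
proof -
  have "integral {0..t} (\<lambda>s. exp (l * s) *\<^sub>R (complex_of_real e * h s)) = integral {0..t} (\<lambda>s. complex_of_real e * (exp (l * s) *\<^sub>R h s))"
    by simp
  also have "\<dots> = complex_of_real e * integral {0..t} (\<lambda>s. exp (l * s) *\<^sub>R h s)" by (rule integral_mult_right)
  finally show ?thesis unfolding duh_def by simp
qed

lemma smooth_on_scale:
  assumes "smooth_on UNIV u"
  shows "smooth_on UNIV (\<lambda>z. e * u z)"
proof -
  have "iter_pd vs (\<lambda>z. e * u z) = (\<lambda>z. e * iter_pd vs u z)" if "set vs \<subseteq> Basis" for vs
    using that
  proof (induction vs)
    case (Cons v vs)
    have "pd v (\<lambda>z. e * iter_pd vs u z) z = e * pd v (iter_pd vs u) z" for z
    proof -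
      have "iter_pd vs u differentiable (at z)" by (rule smooth_on_differentiable[OF assms]) (use Cons.prems in simp)
      then obtain D where D: "(iter_pd vs u has_derivative D) (at z)" unfolding differentiable_def by blast
      show ?thesis using pd_eqI[OF has_derivative_mult_right[OF D, of e]] pd_eqI[OF D] by simp
    qed
    moreover have "iter_pd vs (\<lambda>z. e * u z) = (\<lambda>z. e * iter_pd vs u z)" using Cons by simp
    ultimately show ?case by (auto simp only: iter_pd.simps)
  qed simp
  then show ?thesis using assms unfolding smooth_on_def
    by (auto intro!: differentiable_on_mult differentiable_on_const)
qed

lemma fcoef_scale: "fcoef (\<lambda>x. e * u x) k = complex_of_real e * fcoef u k"
  unfolding fcoef_ek by (simp add: mult.assoc set_integral_mult_right)

context active_scalar
begin

definition rsym :: "pt \<Rightarrow> int \<times> int \<Rightarrow> complex" where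
  "rsym v k = dsym v k * fcoef K k"

text \<open>The velocity operator has order zero: the derivative costs \<open>knorm k\<close> and
  the decay of the kernel returns it. For \<open>k = 0\<close> the symbol of the derivative is
  zero.\<close>

lemma rsym_bound: "cmod (rsym v k) \<le> 4 * pi * norm v * CK"
proof (cases "k = 0")
  case True
  then show ?thesis using CK by (simp add: rsym_def dsym_def ip_def)
next
  case False
  have k: "knorm k \<ge> 1" by (rule knorm_ge1[OF False])
  have "cmod (dsym v k) \<le> 2 * pi * (2 * knorm k * norm v)"
    using mult_left_mono[OF abs_ip_le[of k v], of "2 * pi"] by (simp add: dsym_def norm_mult)
  then have "cmod (dsym v k) * cmod (fcoef K k) \<le> (2 * pi * (2 * knorm k * norm v)) * (CK / knorm k)"
    by (intro mult_mono CK(2)[OF False]) auto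
  also have "\<dots> = 4 * pi * norm v * CK" using k by simp
  finally show ?thesis by (simp add: rsym_def norm_mult)
qed

text \<open>The radius of the ball in \<open>fixpoint_exists\<close> is proportional to
  \<open>e\<close>, so the quadratic remainder is \<open>O(e^2)\<close>, and the bounded symbols
  \<open>rsym\<close> carry this to the velocity. The family \<open>U\<close> is built from
  \<open>\<alpha>\<close> and \<open>f0\<close> only, so it is shared by the two kernels.\<close>

lemma small_solution:
  fixes f0 :: "pt \<times> real \<Rightarrow> real"
  assumes fs: "smooth_on UNIV f0" and fp: "\<And>t. periodic (\<lambda>x. f0 (x, t))"
  defines "U \<equiv> \<lambda>k. duh (lamk \<alpha> k) (\<lambda>t. fcoef (\<lambda>x. f0 (x, t)) k)"
  obtains e0 D A where "e0 > 0" "\<And>k t. t \<in> {0..T} \<Longrightarrow> cmod (U k t) \<le> A * jb k powr (- 2)"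
    "\<And>e. 0 < e \<Longrightarrow> e \<le> e0 \<Longrightarrow> \<exists>\<theta>. is_solution K \<alpha> T (\<lambda>z. e * f0 z) \<theta> \<and>
       (\<forall>x. \<forall>t\<in>{0..T}. \<bar>fst (Rop K (\<lambda>y. \<theta> (y, t)) x) - e * Re (fser (\<lambda>k. - rsym (0,1) k * U k t) x)\<bar> \<le> D * e\<^sup>2
         \<and> \<bar>snd (Rop K (\<lambda>y. \<theta> (y, t)) x) - e * Re (fser (\<lambda>k. rsym (1,0) k * U k t) x)\<bar> \<le> D * e\<^sup>2)"
proof -
  define g where "g k t = fcoef (\<lambda>x. f0 (x, t)) k" for k t
  have gc: "continuous_on B (g k)" for B k
    unfolding g_def[abs_def] by (rule continuous_on_vector_derivative[OF has_vector_derivative_at_within[OF fcoef_has_vector_derivative[OF fs fp]]])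
  obtain G where G: "\<And>t. t \<in> {0..T} \<Longrightarrow> dec (real 2) G (\<lambda>k. g k t)"
    using fcoef_slice_dec[OF fs fp, of 0 T 2] unfolding g_def by blast
  have gb: "cmod (g k t) \<le> G * jb k powr (- 2)" if "t \<in> {0..T}" for k t using decD[OF G[OF that], of k] by simp
  have G0: "G \<ge> 0" using dec_nonneg[OF G, of 0] T by simp
  have Ub: "cmod (U k t) \<le> (G * T) * jb k powr (- 2)" if t: "t \<in> {0..T}" for k t
    using duh_bound(1)[OF gc t gb lam_nonneg] unfolding U_def g_def by (simp add: mult_ac)
  \<comment> \<open>Solves the smallness condition \<open>4 * Q * (2 * (e * G) * T) \<le> 1\<close>
    for \<open>e\<close>; the added 1 keeps the denominator positive.\<close>
  define e0 where "e0 = 1 / (8 * Q * G * T + 1)"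
  have den: "8 * Q * G * T + 1 > 0" using Q_nonneg G0 T by (simp add: add_nonneg_pos)
  then have e0: "e0 > 0" by (simp add: e0_def)
  define Z where "Z = (\<Sum>\<^sub>\<infinity>k. jb k powr (- 2))"
  \<comment> \<open>The bound \<open>4 * pi * CK\<close> of the multiplier, times the remainder of
    \<open>fixpoint_linearization\<close> with \<open>e^2\<close> split off, summed over the
    lattice.\<close>
  define D where "D = 4 * pi * CK * Q * (2 * G * T)\<^sup>2 * Z"
  show ?thesis
  proof (rule that[OF e0 Ub])
    fix e :: real assume e: "0 < e" "e \<le> e0"
    define ge where "ge k t = fcoef (\<lambda>x. e * f0 (x, t)) k" for k t
    have ge: "ge k t = complex_of_real e * g k t" for k t by (simp add: ge_def g_def fcoef_scale)
    have gec: "continuous_on {0..T} (ge k)" for k unfolding ge[abs_def] by (intro continuous_intros gc)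
    have geb: "cmod (ge k t) \<le> (e * G) * jb k powr (- 2)" if "t \<in> {0..T}" for k t
      using mult_left_mono[OF gb[OF that, of k], of e] e by (simp add: ge norm_mult mult_ac)
    have geh: "herm (\<lambda>k. ge k t)" for t unfolding ge_def by (rule herm_fcoef)
    have small: "4 * Q * (2 * (e * G) * T) \<le> 1"
    proof -
      have "e * (8 * Q * G * T + 1) \<le> e0 * (8 * Q * G * T + 1)" using e den by (intro mult_right_mono) auto
      also have "\<dots> = 1" using den by (simp add: e0_def)
      finally have "e * (8 * Q * G * T) \<le> 1" using e by (simp add: distrib_left)
      then show ?thesis by (simp add: mult_ac)
    qed
    obtain c where c: "\<And>k. continuous_on UNIV (c k)" "\<And>k t. cmod (c k t) \<le> 2 * (e * G) * T * jb k powr (- 2)" "\<And>t. herm (\<lambda>k. c k t)"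
      "\<And>k t. c k t = duh (lamk \<alpha> k) (ge k) (cl t) - duh (lamk \<alpha> k) (Nl c c k) (cl t)"
      by (rule fixpoint_exists[of ge "e * G", OF gec geb geh _ small]) (use e G0 in auto)
    interpret S: active_scalar_solution K \<alpha> T CK "\<lambda>z. e * f0 z" c "2 * (e * G) * T"
    proof
      show "smooth_on UNIV (\<lambda>z. e * f0 z)" by (rule smooth_on_scale[OF fs])
      show "periodic (\<lambda>x. e * f0 (x, t))" for t using fp[of t] by (rule periodic_compose)
    qed (use c in \<open>auto simp: ge_def[abs_def]\<close>)
    have lin: "cmod (c k t - complex_of_real e * U k t) \<le> Q * (2 * (e * G) * T) * (2 * (e * G) * T) * jb k powr (- 2)" if "t \<in> {0..T}" for k t
    proof -
      have "duh (lamk \<alpha> k) (ge k) (cl t) = complex_of_real e * U k t"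
        unfolding ge[abs_def] duh_scale U_def g_def[abs_def] cl_id[OF that] ..
      then show ?thesis using fixpoint_linearization[OF c(1,2,4), of k t] by simp
    qed
    have comp: "\<bar>Re (fser (\<lambda>k. m k * c k t) x) - e * Re (fser (\<lambda>k. m k * U k t) x)\<bar> \<le> D * e\<^sup>2"
      if m: "\<And>k. cmod (m k) \<le> 4 * pi * CK" and t: "t \<in> {0..T}" for m x t
    proof -
      have aU: "acs (\<lambda>k. U k t)" by (rule acs_mono[of "\<lambda>k. (G * T) * jb k powr (- 2)"]) (intro summable_on_cmult_right summable_jb Ub t | simp)+
      have a1: "acs (\<lambda>k. m k * c k t)" and a2: "acs (\<lambda>k. m k * U k t)"
        by (rule acs_mult_bounded[OF rapid_acs[OF S.c_rapid] m], rule acs_mult_bounded[OF aU m])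
      have a3: "acs (\<lambda>k. complex_of_real e * (m k * U k t))" using a2 by (rule acs_mult_bounded) (rule order_refl)
      let ?B = "\<lambda>k. 4 * pi * CK * (Q * (2 * (e * G) * T) * (2 * (e * G) * T) * jb k powr (- 2))"
      have d: "cmod (m k * c k t - complex_of_real e * (m k * U k t)) \<le> ?B k" for k
      proof -
        have "cmod (m k) * cmod (c k t - complex_of_real e * U k t) \<le> 4 * pi * CK * (Q * (2 * (e * G) * T) * (2 * (e * G) * T) * jb k powr (- 2))"
          using CK by (intro mult_mono m lin t) auto
        then show ?thesis by (simp add: norm_mult[symmetric] right_diff_distrib mult_ac)
      qed
      have sB: "?B summable_on UNIV" by (intro summable_on_cmult_right summable_jb) simp
      have "\<bar>Re (fser (\<lambda>k. m k * c k t) x) - e * Re (fser (\<lambda>k. m k * U k t) x)\<bar>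
         = \<bar>Re (fser (\<lambda>k. m k * c k t) x - complex_of_real e * fser (\<lambda>k. m k * U k t) x)\<bar>" by simp
      also have "fser (\<lambda>k. m k * c k t) x - complex_of_real e * fser (\<lambda>k. m k * U k t) x = fser (\<lambda>k. m k * c k t - complex_of_real e * (m k * U k t)) x"
        unfolding fser_cmult[symmetric] by (rule fser_diff[OF a1 a3, symmetric])
      also have "\<bar>Re \<dots>\<bar> \<le> cmod (fser (\<lambda>k. m k * c k t - complex_of_real e * (m k * U k t)) x)" by (rule abs_Re_le_cmod)
      also have "\<dots> \<le> (\<Sum>\<^sub>\<infinity>k. cmod (m k * c k t - complex_of_real e * (m k * U k t)))"
        by (rule fser_norm_le[OF acs_mono[OF sB d]])
      also have "\<dots> \<le> (\<Sum>\<^sub>\<infinity>k. ?B k)" by (rule infsum_mono[OF acs_mono[OF sB d] sB d])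
      also have "\<dots> = D * e\<^sup>2"
        unfolding infsum_cmult_right' Z_def[symmetric] D_def by (simp add: power2_eq_square)
      finally show ?thesis .
    qed
    have mb: "cmod (- rsym (0,1) k) \<le> 4 * pi * CK" "cmod (rsym (1,0) k) \<le> 4 * pi * CK" for k
      using rsym_bound[of "(0,1)" k] rsym_bound[of "(1,0)" k] by (simp_all add: norm_prod_def)
    show "\<exists>\<theta>. is_solution K \<alpha> T (\<lambda>z. e * f0 z) \<theta> \<and>
       (\<forall>x. \<forall>t\<in>{0..T}. \<bar>fst (Rop K (\<lambda>y. \<theta> (y, t)) x) - e * Re (fser (\<lambda>k. - rsym (0,1) k * U k t) x)\<bar> \<le> D * e\<^sup>2
         \<and> \<bar>snd (Rop K (\<lambda>y. \<theta> (y, t)) x) - e * Re (fser (\<lambda>k. rsym (1,0) k * U k t) x)\<bar> \<le> D * e\<^sup>2)"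
    proof (intro exI conjI allI ballI)
      show "is_solution K \<alpha> T (\<lambda>z. e * f0 z) S.\<theta>" by (rule S.solution)
      fix x t assume t: "t \<in> {0..T}"
      show "\<bar>fst (Rop K (\<lambda>y. S.\<theta> (y, t)) x) - e * Re (fser (\<lambda>k. - rsym (0,1) k * U k t) x)\<bar> \<le> D * e\<^sup>2"
        using comp[where x = x, OF mb(1) t] unfolding S.Rop_\<theta> rsym_def by simp
      show "\<bar>snd (Rop K (\<lambda>y. S.\<theta> (y, t)) x) - e * Re (fser (\<lambda>k. rsym (1,0) k * U k t) x)\<bar> \<le> D * e\<^sup>2"
        using comp[where x = x, OF mb(2) t] unfolding S.Rop_\<theta> rsym_def by simp
    qed
  qed
qed

end

section \<open>Recovering the kernel\<close>

definition pulse :: "real \<Rightarrow> real \<Rightarrow> real \<Rightarrow> real" where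
  "pulse t1 t2 t = flat 1 ((t - t1) * (t2 - t))"

lemma pulse_nonzero: "t1 < t2 \<Longrightarrow> pulse t1 t2 t \<noteq> 0 \<longleftrightarrow> t1 < t \<and> t < t2"
  by (auto simp: pulse_def flat_1 zero_less_mult_iff)

lemma pulse_nonneg: "pulse t1 t2 t \<ge> 0"
  by (simp add: pulse_def flat_1)

lemma continuous_pulse: "continuous_on A (pulse t1 t2)"
  unfolding pulse_def[abs_def] by (intro continuous_on_compose2[OF continuous_flat[of UNIV]] continuous_intros) auto

lemma bump_pulse_smooth: "smooth_on UNIV (\<lambda>z. bump r p (fst z) * pulse t1 t2 (snd z))"
proof -
  define b1 b2 b3 :: "pt \<times> real" where "b1 = ((1,0),0)" and "b2 = ((0,1),0)" and "b3 = ((0,0),1)"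
  have i: "z \<bullet> b1 = fst (fst z)" "z \<bullet> b2 = snd (fst z)" "z \<bullet> b3 = snd z" for z
    by (simp_all add: b1_def b2_def b3_def inner_prod_def)
  have "(\<lambda>z. flat 1 (cos (2 * pi * (z \<bullet> b1 + - fst p)) + - cos (2 * pi * r)) * flat 1 (cos (2 * pi * (z \<bullet> b2 + - snd p)) + - cos (2 * pi * r))
      * flat 1 ((z \<bullet> b3 + - t1) * (t2 + (-1) * (z \<bullet> b3)))) \<in> smooth_expr"
    by (intro smooth_expr.intros)
  from smooth_expr_smooth[OF this] show ?thesis unfolding i bump_def bump1_def pulse_def by simp
qed

text \<open>Past \<open>t2\<close> the forcing is zero, so the mode decays freely from its value at
  \<open>t2\<close>.\<close>

lemma duh_after_pulse:
  assumes t: "0 \<le> t1" "t1 < t2" "t2 \<le> t"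
  shows "duh l (\<lambda>s. complex_of_real (pulse t1 t2 s) * b) t = exp (- complex_of_real l * complex_of_real (t - t2)) * duh l (\<lambda>s. complex_of_real (pulse t1 t2 s) * b) t2"
proof -
  let ?F = "\<lambda>s. exp (l * s) *\<^sub>R (complex_of_real (pulse t1 t2 s) * b)"
  have i: "?F integrable_on {0..t}" by (intro integrable_continuous_real continuous_intros continuous_pulse)
  have "integral {0..t2} ?F + integral {t2..t} ?F = integral {0..t} ?F"
    by (rule Henstock_Kurzweil_Integration.integral_combine[OF _ _ i]) (use t in auto)
  moreover have "integral {t2..t} ?F = integral {t2..t} (\<lambda>s. 0)"
  proof (rule Henstock_Kurzweil_Integration.integral_cong)
    fix s assume "s \<in> {t2..t}"
    then have "pulse t1 t2 s = 0" using pulse_nonzero[OF t(2), of s] by auto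
    then show "?F s = 0" by simp
  qed
  ultimately have eq: "integral {0..t} ?F = integral {0..t2} ?F" by simp
  have "exp (- l * t) = exp (- l * (t - t2)) * exp (- l * t2)" by (simp add: exp_add[symmetric] algebra_simps)
  moreover have "exp (- complex_of_real l * complex_of_real (t - t2)) = complex_of_real (exp (- l * (t - t2)))"
    by (simp add: exp_of_real[symmetric])
  ultimately show ?thesis unfolding duh_def eq by (simp add: scaleR_conv_of_real)
qed

text \<open>Because the forcing is a real pulse times a constant, the mode is \<open>b\<close> times
  the integral of a nonnegative continuous function that is positive at the midpoint of the pulse;
  there is no cancellation in time.\<close>

lemma duh_pulse_nonzero:
  assumes t: "0 \<le> t1" "t1 < t2" and b: "b \<noteq> 0"
  shows "duh l (\<lambda>s. complex_of_real (pulse t1 t2 s) * b) t2 \<noteq> 0"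
proof
  assume z: "duh l (\<lambda>s. complex_of_real (pulse t1 t2 s) * b) t2 = 0"
  let ?f = "\<lambda>s. exp (l * s) * pulse t1 t2 s"
  have c: "continuous_on {0..t2} ?f" by (intro continuous_intros continuous_pulse)
  have "bounded_linear (\<lambda>r. complex_of_real r * b)"
    by (intro bounded_linear_intros bounded_linear_mult_left[THEN bounded_linear_compose] bounded_linear_of_real)
  from integral_linear[OF integrable_continuous_real[OF c] this]
  have "integral {0..t2} (\<lambda>s. exp (l * s) *\<^sub>R (complex_of_real (pulse t1 t2 s) * b)) = complex_of_real (integral {0..t2} ?f) * b"
    by (simp add: o_def scaleR_conv_of_real mult.assoc)
  then have "integral {0..t2} ?f = 0" using z b by (simp add: duh_def)
  then have "\<forall>s\<in>{0..t2}. ?f s = 0"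
    using integral_eq_0_iff[OF c] t pulse_nonneg by simp
  then have "pulse t1 t2 ((t1 + t2) / 2) = 0" using t by (auto simp: field_simps)
  then show False using pulse_nonzero[OF t(2), of "(t1 + t2) / 2"] t by (simp add: field_simps)
qed

lemma bump_pulse_source:
  assumes W: "open W" "periodic (\<lambda>x. x \<in> W)"
    and supp: "\<And>x. cos (2 * pi * (fst x - fst p)) \<ge> cos (2 * pi * r) \<Longrightarrow> cos (2 * pi * (snd x - snd p)) \<ge> cos (2 * pi * r) \<Longrightarrow> x \<in> W"
    and t: "0 < t1" "t1 < t2" "t2 < T"
  shows "source W T (\<lambda>z. e * (bump r p (fst z) * pulse t1 t2 (snd z)))"
  unfolding source_def
proof (intro conjI allI exI)
  show "smooth_on UNIV (\<lambda>z. e * (bump r p (fst z) * pulse t1 t2 (snd z)))"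
    by (rule smooth_on_scale[OF bump_pulse_smooth])
  show "periodic (\<lambda>x. e * (bump r p (fst (x, s)) * pulse t1 t2 (snd (x, s))))" for s
    using periodic_compose[OF periodic_bump[of r p], of "\<lambda>y. e * (y * pulse t1 t2 s)"] by simp
  show "0 < t1" "t1 \<le> t2" "t2 < T" using t by auto
  let ?C = "{z. cos (2 * pi * r) \<le> cos (2 * pi * (fst (fst z) - fst p)) \<and> cos (2 * pi * r) \<le> cos (2 * pi * (snd (fst z) - snd p)) \<and> t1 \<le> snd z \<and> snd z \<le> t2}"
  have cl: "closed ?C"
    by (intro closed_Collect_conj closed_Collect_le continuous_intros)
  have "{z. e * (bump r p (fst z) * pulse t1 t2 (snd z)) \<noteq> 0} \<subseteq> ?C"
  proof
    fix z assume "z \<in> {z. e * (bump r p (fst z) * pulse t1 t2 (snd z)) \<noteq> 0}"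
    then have "bump1 r (fst (fst z) - fst p) \<noteq> 0" "bump1 r (snd (fst z) - snd p) \<noteq> 0" "pulse t1 t2 (snd z) \<noteq> 0"
      by (auto simp: bump_def)
    then show "z \<in> ?C" unfolding bump1_nonzero_iff pulse_nonzero[OF t(2)] by auto
  qed
  then have "closure {z. e * (bump r p (fst z) * pulse t1 t2 (snd z)) \<noteq> 0} \<subseteq> ?C" using cl by (rule closure_minimal)
  also have "?C \<subseteq> W \<times> {t1..t2}" using supp by (auto simp: mem_Times_iff)
  finally show "closure {z. e * (bump r p (fst z) * pulse t1 t2 (snd z)) \<noteq> 0} \<subseteq> W \<times> {t1..t2}" .
qed

section \<open>Facts extracted from admissibility\<close>

lemma admissible_coef_bound:
  assumes "admissible K"
  obtains C where "C \<ge> 0" "\<And>k. k \<noteq> 0 \<Longrightarrow> cmod (fcoef K k) \<le> C / knorm k"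
proof -
  obtain c C where c: "0 < c" "c \<le> C" "\<And>k. k \<noteq> (0, 0) \<Longrightarrow> Im (fcoef K k) = 0 \<and> c / knorm k \<le> Re (fcoef K k) \<and> Re (fcoef K k) \<le> C / knorm k"
    using assms unfolding admissible_def by blast
  show ?thesis
  proof (rule that[of C])
    show "C \<ge> 0" using c by simp
    fix k :: "int \<times> int" assume "k \<noteq> 0"
    then have k: "Im (fcoef K k) = 0" "c / knorm k \<le> Re (fcoef K k)" "Re (fcoef K k) \<le> C / knorm k"
      using c(3)[of k] by (auto simp: zero_prod_def)
    moreover have "0 \<le> c / knorm k" using c(1) by simp
    ultimately show "cmod (fcoef K k) \<le> C / knorm k" by (simp add: cmod_eq_Re)
  qed
qed

lemma closed_lat: "closed (range lat)"
proof (rule discrete_imp_closed[of 1])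
  show "\<forall>x\<in>range lat. \<forall>y\<in>range lat. dist y x < 1 \<longrightarrow> y = x"
  proof (intro ballI impI)
    fix x y assume "x \<in> range lat" "y \<in> range lat" and d: "dist y x < 1"
    then obtain k l where kl: "x = lat k" "y = lat l" by blast
    have "\<bar>fst (y - x)\<bar> < 1" "\<bar>snd (y - x)\<bar> < 1"
      using norm_fst_le[of "fst (y - x)" "snd (y - x)"] norm_snd_le[of "snd (y - x)" "fst (y - x)"] d
      unfolding prod.collapse dist_norm by simp_all
    then have "\<bar>real_of_int (fst l - fst k)\<bar> < 1" "\<bar>real_of_int (snd l - snd k)\<bar> < 1" by (simp_all add: kl lat_def)
    then have "fst l = fst k" "snd l = snd k" by linarith+
    then show "y = x" by (simp add: kl lat_def)
  qed
qed simp

lemma admissible_isCont: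
  assumes "admissible K" "x \<notin> range lat"
  shows "isCont K x"
proof -
  have "iter_pd [] K differentiable_on (- range lat)"
    using assms(1) unfolding admissible_def smooth_on_def by (metis empty_set empty_subsetI)
  then have "continuous_on (- range lat) K" by (simp add: differentiable_imp_continuous_on)
  then show ?thesis using closed_lat assms(2) by (simp add: continuous_on_eq_continuous_at open_Compl)
qed

lemma fcoef_eq_of_data_eq:
  fixes T \<alpha> :: real and W :: "pt set" and K1 K2 :: "pt \<Rightarrow> real"
  assumes T: "0 < T" and a: "1/2 < \<alpha>" "\<alpha> < 1"
    and W: "open W" "W \<noteq> {}" "periodic (\<lambda>x. x \<in> W)"
    and adm: "admissible K1" "admissible K2"
    and data: "\<And>f \<theta>1 \<theta>2. source W T f \<Longrightarrow> is_solution K1 \<alpha> T f \<theta>1 \<Longrightarrow> is_solution K2 \<alpha> T f \<theta>2 \<Longrightarrow>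
              (AE z in lborel. z \<in> W \<times> {0<..<T} \<longrightarrow>
                 Rop K1 (\<lambda>y. \<theta>1 (y, snd z)) (fst z) = Rop K2 (\<lambda>y. \<theta>2 (y, snd z)) (fst z))"
    and k: "k \<noteq> 0"
  shows "fcoef K1 k = fcoef K2 k"
proof -
  obtain C1 where C1: "C1 \<ge> 0" "\<And>k. k \<noteq> 0 \<Longrightarrow> cmod (fcoef K1 k) \<le> C1 / knorm k" by (rule admissible_coef_bound[OF adm(1)]) blast
  obtain C2 where C2: "C2 \<ge> 0" "\<And>k. k \<noteq> 0 \<Longrightarrow> cmod (fcoef K2 k) \<le> C2 / knorm k" by (rule admissible_coef_bound[OF adm(2)]) blast
  have pi: "periodic K1" "set_integrable lborel Qcell K1" "periodic K2" "set_integrable lborel Qcell K2"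
    using adm unfolding admissible_def by blast+
  interpret A1: active_scalar K1 \<alpha> T C1 by unfold_locales (use pi a T C1 in auto)
  interpret A2: active_scalar K2 \<alpha> T C2 by unfold_locales (use pi a T C2 in auto)
  obtain p where p: "p \<in> W" using W(2) by blast
  obtain r0 where r0: "0 < r0" "\<And>r x. 0 < r \<Longrightarrow> r \<le> r0 \<Longrightarrow> cos (2 * pi * (fst x - fst p)) \<ge> cos (2 * pi * r) \<Longrightarrow>
     cos (2 * pi * (snd x - snd p)) \<ge> cos (2 * pi * r) \<Longrightarrow> x \<in> W"
    by (rule bump_support_in_open[OF W(1,3) p]) blast
  define kk where "kk = \<bar>real_of_int (fst k)\<bar> + \<bar>real_of_int (snd k)\<bar>"
  \<comment> \<open>Below \<open>r0\<close>, so that the support stays in \<open>W\<close>, and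
    small relative to \<open>k\<close>: the second bound gives
    \<open>8 * kk * r + 8 * r \<le> 1\<close>, which yields both conditions of
    \<open>fcoef_bump_nonzero\<close>.\<close>
  define r where "r = min r0 (1 / (8 * (kk + 1)))"
  have kk: "kk \<ge> 0" by (simp add: kk_def)
  have r8: "r \<le> 1 / (8 * (kk + 1))" and rr0: "r \<le> r0" by (simp_all add: r_def)
  have r: "0 < r" using r0(1) kk by (simp add: r_def)
  have "r * (8 * (kk + 1)) \<le> 1" using r8 kk by (simp add: pos_le_divide_eq)
  then have r8': "8 * (kk * r) + 8 * r \<le> 1" by (simp add: algebra_simps)
  have krr: "0 \<le> kk * r" using kk r by simp
  have r4: "r \<le> 1/4" and kr: "kk * r < 1/4" using r8' krr r by linarith+
  define b where "b = fcoef (bump r p)"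
  have bk: "b k \<noteq> 0" unfolding b_def by (rule fcoef_bump_nonzero[OF r r4 kr[unfolded kk_def]])
  \<comment> \<open>The pulse ends at \<open>T / 2\<close>, so that free decay is observed for the
    rest of the time interval.\<close>
  define t1 t2 where "t1 = T / 3" and "t2 = T / 2"
  have t: "0 < t1" "t1 < t2" "t2 < T" using T by (auto simp: t1_def t2_def)
  define f0 where "f0 z = bump r p (fst z) * pulse t1 t2 (snd z)" for z
  have fs: "smooth_on UNIV f0" unfolding f0_def[abs_def] by (rule bump_pulse_smooth)
  have fp: "periodic (\<lambda>x. f0 (x, s))" for s
    unfolding f0_def using periodic_compose[OF periodic_bump[of r p], of "\<lambda>y. y * pulse t1 t2 s"] by simp
  have src: "source W T (\<lambda>z. e * f0 z)" for e
    unfolding f0_def by (rule bump_pulse_source[OF W(1,3) r0(2)[OF r rr0] t])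
  define U where "U k = duh (lamk \<alpha> k) (\<lambda>t. fcoef (\<lambda>x. f0 (x, t)) k)" for k
  have U_eq: "U k = duh (lamk \<alpha> k) (\<lambda>t. complex_of_real (pulse t1 t2 t) * b k)" for k
    unfolding U_def f0_def b_def by (simp add: mult.commute[of "bump _ _ _"] fcoef_scale)
  obtain e1 D1 B where S1: "e1 > 0" "\<And>k t. t \<in> {0..T} \<Longrightarrow> cmod (U k t) \<le> B * jb k powr (- 2)"
    "\<And>e. 0 < e \<Longrightarrow> e \<le> e1 \<Longrightarrow> \<exists>\<theta>. is_solution K1 \<alpha> T (\<lambda>z. e * f0 z) \<theta> \<and>
       (\<forall>x. \<forall>t\<in>{0..T}. \<bar>fst (Rop K1 (\<lambda>y. \<theta> (y, t)) x) - e * Re (fser (\<lambda>k. - A1.rsym (0,1) k * U k t) x)\<bar> \<le> D1 * e\<^sup>2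
         \<and> \<bar>snd (Rop K1 (\<lambda>y. \<theta> (y, t)) x) - e * Re (fser (\<lambda>k. A1.rsym (1,0) k * U k t) x)\<bar> \<le> D1 * e\<^sup>2)"
    by (rule A1.small_solution[OF fs fp, folded U_def]) blast
  obtain e2 D2 B2 where S2: "e2 > 0" "\<And>k t. t \<in> {0..T} \<Longrightarrow> cmod (U k t) \<le> B2 * jb k powr (- 2)"
    "\<And>e. 0 < e \<Longrightarrow> e \<le> e2 \<Longrightarrow> \<exists>\<theta>. is_solution K2 \<alpha> T (\<lambda>z. e * f0 z) \<theta> \<and>
       (\<forall>x. \<forall>t\<in>{0..T}. \<bar>fst (Rop K2 (\<lambda>y. \<theta> (y, t)) x) - e * Re (fser (\<lambda>k. - A2.rsym (0,1) k * U k t) x)\<bar> \<le> D2 * e\<^sup>2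
         \<and> \<bar>snd (Rop K2 (\<lambda>y. \<theta> (y, t)) x) - e * Re (fser (\<lambda>k. A2.rsym (1,0) k * U k t) x)\<bar> \<le> D2 * e\<^sup>2)"
    by (rule A2.small_solution[OF fs fp, folded U_def]) blast
  have acsU: "acs (\<lambda>k. U k t)" if "t \<in> {0..T}" for t
    by (rule acs_mono[of "\<lambda>k. B * jb k powr (- 2)"]) (use S1(2) that in \<open>auto intro!: summable_on_cmult_right summable_jb\<close>)
  have Ucont: "continuous_on {0..T} (U k)" for k
    unfolding U_eq by (rule duh_continuous) (intro continuous_intros continuous_pulse)
  define V where "V m z = Re (fser (\<lambda>k. m k * U k (snd z)) (fst z))" for m z
  have Vcont: "continuous_on (UNIV \<times> {0..T}) (V m)" if m: "\<And>k. cmod (m k) \<le> M" for m M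
  proof -
    have "continuous_on (UNIV \<times> {0..T}) (\<lambda>z. fser (\<lambda>k. m k * U k (snd z)) (fst z))"
    proof (rule continuous_fser_param)
      show "continuous_on {0..T} (\<lambda>t. m k * U k t)" for k by (intro continuous_intros Ucont)
      have "M \<ge> 0" using m[of 0] norm_ge_zero order_trans by blast
      then show "cmod (m k * U k t) \<le> M * (B * jb k powr (- 2))" if "t \<in> {0..T}" for k t
        unfolding norm_mult using m S1(2)[OF that] by (intro mult_mono) auto
      show "(\<lambda>k. M * (B * jb k powr (- 2))) summable_on UNIV" by (intro summable_on_cmult_right summable_jb) simp
    qed
    then show ?thesis unfolding V_def[abs_def] by (intro continuous_intros)
  qed
  \<comment> \<open>Dividing the \<open>O(e^2)\<close> comparison by \<open>e\<close> and letting
    \<open>e\<close> tend to 0 leaves equality of the linear parts. Before the limit, continuity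
    removes the null set, which may vary with \<open>e\<close>.\<close>
  have small: "\<bar>V m1 z - V m2 z\<bar> = 0"
    if z: "z \<in> W \<times> {0<..<T}" and m1: "\<And>k. cmod (m1 k) \<le> M1" and m2: "\<And>k. cmod (m2 k) \<le> M2"
      and near: "\<And>e. 0 < e \<Longrightarrow> e \<le> min e1 e2 \<Longrightarrow> AE z in lborel. z \<in> W \<times> {0<..<T} \<longrightarrow> \<bar>e * V m1 z - e * V m2 z\<bar> \<le> (D1 + D2) * e\<^sup>2" for m1 m2 M1 M2 z
  proof -
    have le: "\<bar>V m1 z - V m2 z\<bar> \<le> (D1 + D2) * e" if e: "0 < e" "e \<le> min e1 e2" for e
    proof (rule AE_le_imp_le[OF _ _ _ z])
      show "open (W \<times> {0<..<T})" by (intro open_Times W) simp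
      have sub: "W \<times> {0<..<T} \<subseteq> UNIV \<times> {0..T}" by auto
      show "continuous_on (W \<times> {0<..<T}) (\<lambda>z. \<bar>V m1 z - V m2 z\<bar>)"
        by (intro continuous_intros continuous_on_subset[OF Vcont[OF m1] sub] continuous_on_subset[OF Vcont[OF m2] sub])
      show "AE z in lborel. z \<in> W \<times> {0<..<T} \<longrightarrow> \<bar>V m1 z - V m2 z\<bar> \<le> (D1 + D2) * e"
        using near[OF e]
      proof eventually_elim
        case (elim z)
        show ?case
        proof
          assume "z \<in> W \<times> {0<..<T}"
          then have "e * \<bar>V m1 z - V m2 z\<bar> \<le> e * ((D1 + D2) * e)"
            using elim e by (simp add: right_diff_distrib[symmetric] abs_mult power2_eq_square mult_ac)
          then show "\<bar>V m1 z - V m2 z\<bar> \<le> (D1 + D2) * e" using e by simp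
        qed
      qed
    qed
    have "((\<lambda>e. (D1 + D2) * e) \<longlongrightarrow> (D1 + D2) * 0) (at_right 0)" by (intro tendsto_intros)
    moreover have "\<forall>\<^sub>F e in at_right 0. \<bar>V m1 z - V m2 z\<bar> \<le> (D1 + D2) * e"
      using eventually_at_right_less[of 0] eventually_at_right_real[of 0 "min e1 e2"] S1(1) S2(1)
      by (auto elim!: eventually_mono intro!: le)
    ultimately have "\<bar>V m1 z - V m2 z\<bar> \<le> (D1 + D2) * 0"
      by (rule tendsto_lowerbound) simp
    then show ?thesis by simp
  qed
  have near: "AE z in lborel. z \<in> W \<times> {0<..<T} \<longrightarrow>
      \<bar>e * V (\<lambda>k. - A1.rsym (0,1) k) z - e * V (\<lambda>k. - A2.rsym (0,1) k) z\<bar> \<le> (D1 + D2) * e\<^sup>2 \<and>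
      \<bar>e * V (A1.rsym (1,0)) z - e * V (A2.rsym (1,0)) z\<bar> \<le> (D1 + D2) * e\<^sup>2"
    if e: "0 < e" "e \<le> min e1 e2" for e
  proof -
    have e': "e \<le> e1" "e \<le> e2" using e by auto
    obtain \<theta>1 where th1: "is_solution K1 \<alpha> T (\<lambda>z. e * f0 z) \<theta>1"
       "\<forall>x. \<forall>t\<in>{0..T}. \<bar>fst (Rop K1 (\<lambda>y. \<theta>1 (y, t)) x) - e * Re (fser (\<lambda>k. - A1.rsym (0,1) k * U k t) x)\<bar> \<le> D1 * e\<^sup>2
         \<and> \<bar>snd (Rop K1 (\<lambda>y. \<theta>1 (y, t)) x) - e * Re (fser (\<lambda>k. A1.rsym (1,0) k * U k t) x)\<bar> \<le> D1 * e\<^sup>2"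
      using S1(3)[OF e(1) e'(1)] by (elim exE conjE) (rule that)
    obtain \<theta>2 where th2: "is_solution K2 \<alpha> T (\<lambda>z. e * f0 z) \<theta>2"
       "\<forall>x. \<forall>t\<in>{0..T}. \<bar>fst (Rop K2 (\<lambda>y. \<theta>2 (y, t)) x) - e * Re (fser (\<lambda>k. - A2.rsym (0,1) k * U k t) x)\<bar> \<le> D2 * e\<^sup>2
         \<and> \<bar>snd (Rop K2 (\<lambda>y. \<theta>2 (y, t)) x) - e * Re (fser (\<lambda>k. A2.rsym (1,0) k * U k t) x)\<bar> \<le> D2 * e\<^sup>2"
      using S2(3)[OF e(1) e'(2)] by (elim exE conjE) (rule that)
    show ?thesis using data[OF src th1(1) th2(1)]
    proof eventually_elim
      case (elim z)
      show ?case
      proof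
        assume z: "z \<in> W \<times> {0<..<T}"
        then have t: "snd z \<in> {0..T}" by auto
        show "\<bar>e * V (\<lambda>k. - A1.rsym (0,1) k) z - e * V (\<lambda>k. - A2.rsym (0,1) k) z\<bar> \<le> (D1 + D2) * e\<^sup>2 \<and>
          \<bar>e * V (A1.rsym (1,0)) z - e * V (A2.rsym (1,0)) z\<bar> \<le> (D1 + D2) * e\<^sup>2"
          using elim[rule_format, OF z] th1(2)[rule_format, OF t, of "fst z"] th2(2)[rule_format, OF t, of "fst z"]
          unfolding V_def distrib_right by simp linarith
      qed
    qed
  qed
  have mb: "cmod (- A1.rsym v k) \<le> 4 * pi * norm v * C1" "cmod (- A2.rsym v k) \<le> 4 * pi * norm v * C2" for v k
    using A1.rsym_bound[of v k] A2.rsym_bound[of v k] by simp_all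
  have V1: "V (\<lambda>k. - A1.rsym (0,1) k) z = V (\<lambda>k. - A2.rsym (0,1) k) z" if z: "z \<in> W \<times> {0<..<T}" for z
  proof -
    have "\<bar>V (\<lambda>k. - A1.rsym (0,1) k) z - V (\<lambda>k. - A2.rsym (0,1) k) z\<bar> = 0"
    proof (rule small[OF z mb(1) mb(2)])
      fix e assume "0 < e" "e \<le> min e1 e2"
      from near[OF this] show "AE z in lborel. z \<in> W \<times> {0<..<T} \<longrightarrow> \<bar>e * V (\<lambda>k. - A1.rsym (0,1) k) z - e * V (\<lambda>k. - A2.rsym (0,1) k) z\<bar> \<le> (D1 + D2) * e\<^sup>2"
        by eventually_elim blast
    qed
    then show ?thesis by simp
  qed
  have V2: "V (A1.rsym (1,0)) z = V (A2.rsym (1,0)) z" if z: "z \<in> W \<times> {0<..<T}" for z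
  proof -
    have "\<bar>V (A1.rsym (1,0)) z - V (A2.rsym (1,0)) z\<bar> = 0"
    proof (rule small[OF z A1.rsym_bound A2.rsym_bound])
      fix e assume "0 < e" "e \<le> min e1 e2"
      from near[OF this] show "AE z in lborel. z \<in> W \<times> {0<..<T} \<longrightarrow> \<bar>e * V (A1.rsym (1,0)) z - e * V (A2.rsym (1,0)) z\<bar> \<le> (D1 + D2) * e\<^sup>2"
        by eventually_elim blast
    qed
    then show ?thesis by simp
  qed
  have Uherm: "herm (\<lambda>k. U k t)" if t: "t \<in> {0..T}" for t
    unfolding herm_def
  proof
    fix k
    have c: "continuous_on {0..T} (\<lambda>t. complex_of_real (pulse t1 t2 t) * b k)" by (intro continuous_intros continuous_pulse)
    show "U (- k) t = cnj (U k t)"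
      using duh_cnj[OF c t, of "lamk \<alpha> k"] unfolding U_eq A1.lam_uminus b_def hermD[OF herm_fcoef] by simp
  qed
  define del where "del k = fcoef K1 k - fcoef K2 k" for k
  have rd: "A1.rsym v k - A2.rsym v k = dsym v k * del k" for v k
    unfolding A1.rsym_def A2.rsym_def del_def by (simp add: right_diff_distrib)
  have key: "fser (\<lambda>k. dsym v k * del k * U k t) x = 0"
    if v: "v = (0,1) \<or> v = (1,0)" and x: "x \<in> W" and t: "0 < t" "t < T" for v x t
  proof -
    have tT: "t \<in> {0..T}" using t by simp
    have a1: "acs (\<lambda>k. A1.rsym v k * U k t)" by (rule acs_mult_bounded[OF acsU[OF tT] A1.rsym_bound])
    have a2: "acs (\<lambda>k. A2.rsym v k * U k t)" by (rule acs_mult_bounded[OF acsU[OF tT] A2.rsym_bound])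
    have eq: "fser (\<lambda>k. dsym v k * del k * U k t) x = fser (\<lambda>k. A1.rsym v k * U k t) x - fser (\<lambda>k. A2.rsym v k * U k t) x"
      unfolding fser_diff[OF a1 a2, symmetric] by (simp add: rd[symmetric] left_diff_distrib)
    have neg: "fser (\<lambda>k. - (m k * U k t)) x = - fser (\<lambda>k. m k * U k t) x" for m
      using fser_cmult[of "-1" "\<lambda>k. m k * U k t" x] by simp
    have "Re (fser (\<lambda>k. A1.rsym v k * U k t) x) = Re (fser (\<lambda>k. A2.rsym v k * U k t) x)"
      using v V1[of "(x, t)"] V2[of "(x, t)"] x t by (auto simp: V_def neg)
    then have R: "Re (fser (\<lambda>k. dsym v k * del k * U k t) x) = 0" unfolding eq by simp
    \<comment> \<open>So far only the real part is known to vanish; hermitian symmetry of the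
      coefficients makes the series real, so the complex sum vanishes as well.\<close>
    have dh: "herm del" using herm_fcoef[of K1] herm_fcoef[of K2] unfolding herm_def del_def by (simp del: split_paired_All)
    have "herm (\<lambda>k. dsym v k * del k * U k t)" by (intro herm_mult herm_dsym dh Uherm[OF tT])
    from of_real_Re_fser[OF this, of x] R show ?thesis by simp
  qed
  have t2T: "t2 \<in> {0..T}" using t by simp
  \<comment> \<open>Time is measured from the end of the pulse. There each mode is its value at
    \<open>t2\<close> times a pure exponential, and \<open>key\<close> gives vanishing on
    \<open>W\<close> for \<open>\<tau>\<close> between 0 and \<open>T - t2\<close>.\<close>
  have vanish: "dsym v k * del k * U k t2 = 0" if v: "v = (0,1) \<or> v = (1,0)" for v
  proof (rule dirichlet_trig_vanish[where a = 0 and b = "T - t2" and \<alpha> = \<alpha>, OF _ _ _ _ W(1,2)])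
    show "0 < \<alpha>" "0 < T - t2" "(0::real) \<le> 0" using a t by auto
    have "acs (\<lambda>k. (dsym v k * del k) * U k t2)"
    proof (rule acs_mult_bounded[OF acsU[OF t2T]])
      show "cmod (dsym v k * del k) \<le> 4 * pi * norm v * C1 + 4 * pi * norm v * C2" for k
        unfolding rd[symmetric] by (rule order_trans[OF norm_triangle_ineq4]) (intro add_mono A1.rsym_bound A2.rsym_bound)
    qed
    then show "acs (\<lambda>k. dsym v k * del k * U k t2)" .
    fix \<tau> x assume tau: "0 < \<tau>" "\<tau> < T - t2" and x: "x \<in> W"
    have "U k (t2 + \<tau>) = exp (- complex_of_real (lamk \<alpha> k) * complex_of_real \<tau>) * U k t2" for k
      unfolding U_eq using duh_after_pulse[of t1 t2 "t2 + \<tau>"] t tau by simp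
    then have "fser (\<lambda>k. exp (- complex_of_real (lamk \<alpha> k) * complex_of_real \<tau>) * (dsym v k * del k * U k t2)) x
      = fser (\<lambda>k. dsym v k * del k * U k (t2 + \<tau>)) x" by (simp add: mult_ac)
    also have "\<dots> = 0" by (rule key[OF v x]) (use t tau in auto)
    finally show "fser (\<lambda>k. exp (- complex_of_real (lamk \<alpha> k) * complex_of_real \<tau>) * (dsym v k * del k * U k t2)) x = 0" .
  qed
  have "U k t2 \<noteq> 0" unfolding U_eq by (rule duh_pulse_nonzero) (use t bk in auto)
  \<comment> \<open>Each component of the velocity sees only one coordinate of \<open>k\<close>.
    Both together force \<open>del k\<close> to vanish, since some coordinate is nonzero.\<close>
  then have "dsym (0,1) k * del k = 0" "dsym (1,0) k * del k = 0" using vanish by auto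
  moreover have "fst k \<noteq> 0 \<or> snd k \<noteq> 0" using k by (simp add: prod_eq_iff)
  ultimately have "del k = 0" by (auto simp: dsym_def ip_def)
  then show ?thesis by (simp add: del_def)
qed

theorem theorem1p1:
  fixes T \<alpha> :: real and W :: "pt set" and K1 K2 :: "pt \<Rightarrow> real"
  assumes "0 < T"
    and "1/2 < \<alpha>" and "\<alpha> < 1"
    and "open W" and "W \<noteq> {}" and "periodic (\<lambda>x. x \<in> W)"
    and "admissible K1" and "admissible K2"
    and "\<forall>f. source W T f \<longrightarrow>
           (\<forall>\<theta>1 \<theta>2. is_solution K1 \<alpha> T f \<theta>1 \<and> is_solution K2 \<alpha> T f \<theta>2 \<longrightarrow>
              (AE z in lborel. z \<in> W \<times> {0<..<T} \<longrightarrow>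
                 \<theta>1 z = \<theta>2 z \<and>
                 Rop K1 (\<lambda>y. \<theta>1 (y, snd z)) (fst z) = Rop K2 (\<lambda>y. \<theta>2 (y, snd z)) (fst z)))"
  shows "\<forall>g. smooth_on UNIV g \<and> periodic g \<and> closure {x. g x \<noteq> 0} \<subseteq> - closure W \<longrightarrow>
           (\<forall>x \<in> - closure W. Rop K1 g x = Rop K2 g x)"
proof (intro allI impI ballI)
  fix g x assume g: "smooth_on UNIV g \<and> periodic g \<and> closure {x. g x \<noteq> 0} \<subseteq> - closure W"
  have pi: "periodic K1" "set_integrable lborel Qcell K1" "periodic K2" "set_integrable lborel Qcell K2"
    using assms(7,8) unfolding admissible_def by blast+
  have eq: "fcoef K1 k = fcoef K2 k" if "k \<noteq> 0" for k
  proof (rule fcoef_eq_of_data_eq[OF assms(1-8) _ that])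
    fix f \<theta>1 \<theta>2 assume "source W T f" "is_solution K1 \<alpha> T f \<theta>1" "is_solution K2 \<alpha> T f \<theta>2"
    then have "AE z in lborel. z \<in> W \<times> {0<..<T} \<longrightarrow> \<theta>1 z = \<theta>2 z \<and>
                 Rop K1 (\<lambda>y. \<theta>1 (y, snd z)) (fst z) = Rop K2 (\<lambda>y. \<theta>2 (y, snd z)) (fst z)"
      using assms(9) by blast
    then show "AE z in lborel. z \<in> W \<times> {0<..<T} \<longrightarrow>
                 Rop K1 (\<lambda>y. \<theta>1 (y, snd z)) (fst z) = Rop K2 (\<lambda>y. \<theta>2 (y, snd z)) (fst z)"
      by eventually_elim blast
  qed
  \<comment> \<open>Off the lattice both kernels are continuous, which is where equality of the
    coefficients determines their pointwise difference.\<close>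
  have const: "K1 y - K2 y = Re (fcoef K1 0 - fcoef K2 0)" if "y \<notin> range lat" for y
    by (rule kernel_const_diff[OF pi eq admissible_isCont[OF assms(7) that] admissible_isCont[OF assms(8) that]])
  have "continuous_on UNIV g" using smooth_on_continuous[of g "[]"] g by simp
  then have "conv K1 g y = conv K2 g y + Re (fcoef K1 0 - fcoef K2 0) * (LINT y:Qcell|lborel. g y)" for y
    using g by (intro conv_diff_const[OF pi const]) auto
  then show "Rop K1 g x = Rop K2 g x" by (rule Rop_eq_of_const_diff)
qed

end
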